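(* Let $\beta>0$, let $\Lambda\subset\mathbb Z^d$ be finite, let $y\in\mathbb R^{\mathbb Z^d}$ and let $\zeta\in\Upsilon_\beta(y)$. Let $f\in\tilde C_{\rm b}(\Omega_\beta)$ and let $g\in C_{\rm b}(\mathbb R^{\mathbb Z^d})$ be the function determined by $f(\omega)=g(x)$ for all $x\in\mathbb R^{\mathbb Z^d}$ and $\omega\in\Upsilon_\beta(x)$. Then $$\int_{\Omega_\beta}f(\omega)\,\pi^{(m)}_{\beta,\Lambda}(d\omega|\zeta)\;\longrightarrow\;\int_{\mathbb R^{\mathbb Z^d}}g(x)\,\rho_{\beta,\Lambda}(dx|y)\qquad\text{as } m\to+\infty.$$
   Context: Standing assumptions. $d\ge 1$; $J=(J_{jk})_{j,k\in\mathbb Z^d}$ is a real symmetric matrix such that for some $r>0$, $J_{jk}=0$ whenever the Euclidean distance $|j-k|$ exceeds $r$, and $c:=\sup_j\sum_k|J_{jk}|<\infty$. The functions $U_k:\mathbb R\to\mathbb R$, $k\in\mathbb Z^d$, are continuous and there are constants $b\in\mathbb R$ and $\tilde c>\max\{c-1,0\}$ with $U_k(x)\ge\frac12\tilde c x^2+b$ for all $k\in\mathbb Z^d$, $x\in\mathbb R$. Loop spaces. For $\beta>0$, $C_\beta=\{\omega\in C([0,\beta],\mathbb R):\omega(0)=\omega(\beta)\}$ with the sup norm. For $\Lambda\subset\mathbb Z^d$, $\Omega_{\beta,\Lambda}=\{\omega_\Lambda=(\omega_k)_{k\in\Lambda}:\omega_k\in C_\beta\}$ with the product topology and the $\sigma$-algebra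 generated by cylinder sets; $\Omega_\beta=\Omega_{\beta,\mathbb Z^d}$ with $\sigma$-algebra $\mathcal B_\beta$. $\Lambda^c=\mathbb Z^d\setminus\Lambda$; $\omega_\Lambda\times\zeta_{\Lambda^c}$ is the configuration equal to $\omega_k$ for $k\in\Lambda$ and $\zeta_k$ for $k\in\Lambda^c$ (similarly $x_\Lambda\times y_{\Lambda^c}$ in $\mathbb R^{\mathbb Z^d}$). Equivalence classes. For $y\in\mathbb R^{\mathbb Z^d}$, $\Upsilon_\beta(y)=\{\zeta\in\Omega_\beta:\beta^{-1}\int_0^\beta\zeta_j(\tau)d\tau=y_j\ \forall j\in\mathbb Z^d\}$. Write $\omega\sim\tilde\omega$ if $\int_0^\beta\omega_j d\tau=\int_0^\beta\tilde\omega_j d\tau$ for all $j$. $C_{\rm b}(X)$ denotes bounded continuous real functions on $X$ ($\mathbb R^{\mathbb Z^d}$ has the product topology), and $\tilde C_{\rm b}(\Omega_\beta)=\{f\in C_{\rm b}(\Omega_\beta): f(\omega)=f(\tilde\omega)\text{ whenever }\omega\sim\tilde\omega\}$. For each $f\in\tilde C_{\rm b}(\Omega_\beta)$ there is a (unique) $g\in C_{\rm b}(\mathbb R^{\mathbb Z^d})$ with $f(\omega)=g(x)$ for $\omega\in\Upsilon_\beta(x)$. Quantum kernels. For finite $\Lambda$, $$E_{\beta,\Lambda}(\omega_\Lambda|\zeta)=\sum_{j\in\Lambda}\int_0^\beta U_j(\omega_j(\tau))d\tau+\tfrac12\sum_{j,k\in\Lambda}J_{jk}\int_0^\beta\omega_j(\tau)\omega_k(\tau)d\tau+\sum_{j\in\Lambda,k\in\Lambda^c}J_{jk}\int_0^\beta\omega_j(\tau)\zeta_k(\tau)d\tau.$$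 For $m>0$, $\gamma^{(m)}_\beta$ is the centered Gaussian measure on $L^2([0,\beta])$ with covariance operator $(-m\Delta_\beta+1)^{-1}$, where $\Delta_\beta$ is the Laplacian on $[0,\beta]$ with periodic boundary conditions (covariance eigenvalues $(mq^2+1)^{-1}$, $q\in\frac{2\pi}{\beta}\mathbb Z$, on the trigonometric orthonormal basis $\beta^{-1/2}$, $\sqrt{2/\beta}\cos q\tau$ for $q>0$, $\sqrt{2/\beta}\sin q\tau$ for $q<0$). It satisfies $\gamma_\beta^{(m)}(C_\beta)=1$ and is regarded as a measure on $C_\beta$; $\gamma^{(m)}_{\beta,\Lambda}=\prod_{j\in\Lambda}\gamma^{(m)}_\beta$. Put $\nu^{(m)}_{\beta,\Lambda}(d\omega_\Lambda|\zeta)=\frac1Z\exp\{-E_{\beta,\Lambda}(\omega_\Lambda|\zeta)\}\gamma^{(m)}_{\beta,\Lambda}(d\omega_\Lambda)$ with $Z$ the normalizing constant, and $\pi^{(m)}_{\beta,\Lambda}(B|\zeta)=\int_{\Omega_{\beta,\Lambda}}\mathbf 1_B(\omega_\Lambda\times\zeta_{\Lambda^c})\,\nu^{(m)}_{\beta,\Lambda}(d\omega_\Lambda|\zeta)$ for $B\in\mathcal B_\beta$. Classical kernels. $I_\Lambda(x_\Lambda|y)=\sum_{j\in\Lambda}U_j(x_j)+\frac12\sum_{j,k\in\Lambda}J_{jk}x_jx_k+\sum_{j\in\Lambda,k\in\Lambda^c}J_{jk}x_jy_k$; $\chi_{\beta,\Lambda}(dx_\Lambda)=\prod_{j\in\Lambda}\sqrt{\beta/2\pi}\,e^{-\beta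 x_j^2/2}dx_j$; $\mu_{\beta,\Lambda}(dx_\Lambda|y)=\frac1Y e^{-\beta I_\Lambda(x_\Lambda|y)}\chi_{\beta,\Lambda}(dx_\Lambda)$ with $Y$ the normalizing constant; $\rho_{\beta,\Lambda}(B|y)=\int_{\mathbb R^\Lambda}\mathbf 1_B(x_\Lambda\times y_{\Lambda^c})\,\mu_{\beta,\Lambda}(dx_\Lambda|y)$ for $B\in\mathcal B(\mathbb R^{\mathbb Z^d})$. *)

theory Defs
  imports "HOL-Probability.Probability"
begin

text \<open>
  The lattice \<open>\<int>\<^sup>d\<close> is the type \<open>int ^ 'd\<close>, with \<open>d = CARD('d) \<ge> 1\<close>.
\<close>

definition lattice_dist :: "int ^ 'd \<Rightarrow> int ^ 'd \<Rightarrow> real" where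
  "lattice_dist j k = norm (\<chi> i. real_of_int (j $ i - k $ i))"

text \<open>
  The library's function spaces consist of extensional functions, so a loop is a function on
  \<open>\<real>\<close> that is \<open>undefined\<close> outside \<open>{0..\<beta>}\<close>; the metric is the sup metric over \<open>{0..\<beta>}\<close>.
\<close>

definition loop_space :: "real \<Rightarrow> (real \<Rightarrow> real) metric" where
  "loop_space \<beta> =
     submetric (cfunspace (top_of_set {0..\<beta>}) euclidean_metric) {\<omega>. \<omega> 0 = \<omega> \<beta>}"

definition loop_borel :: "real \<Rightarrow> (real \<Rightarrow> real) measure" where
  "loop_borel \<beta> = sigma (mspace (loop_space \<beta>)) {S. openin (mtopology_of (loop_space \<beta>)) S}"

definition Omega_top :: "real \<Rightarrow> (int ^ 'd \<Rightarrow> real \<Rightarrow> real) topology" where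
  "Omega_top \<beta> = product_topology (\<lambda>_. mtopology_of (loop_space \<beta>)) UNIV"

text \<open>The product \<open>\<sigma>\<close>-algebra on \<open>\<Omega>\<^sub>\<beta>\<close>, generated by the cylinder sets.\<close>

definition Omega_sigma :: "real \<Rightarrow> (int ^ 'd \<Rightarrow> real \<Rightarrow> real) measure" where
  "Omega_sigma \<beta> = PiM UNIV (\<lambda>_. loop_borel \<beta>)"

definition Upsilon :: "real \<Rightarrow> (int ^ 'd \<Rightarrow> real) \<Rightarrow> (int ^ 'd \<Rightarrow> real \<Rightarrow> real) set" where
  "Upsilon \<beta> y =
     {\<zeta> \<in> topspace (Omega_top \<beta>). \<forall>j. (1 / \<beta>) * (LBINT \<tau>:{0..\<beta>}. \<zeta> j \<tau>) = y j}"

definition same_means ::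
    "real \<Rightarrow> (int ^ 'd \<Rightarrow> real \<Rightarrow> real) \<Rightarrow> (int ^ 'd \<Rightarrow> real \<Rightarrow> real) \<Rightarrow> bool" where
  "same_means \<beta> \<omega> \<omega>' \<longleftrightarrow>
     (\<forall>j. (LBINT \<tau>:{0..\<beta>}. \<omega> j \<tau>) = (LBINT \<tau>:{0..\<beta>}. \<omega>' j \<tau>))"

definition Cb_tilde :: "real \<Rightarrow> ((int ^ 'd \<Rightarrow> real \<Rightarrow> real) \<Rightarrow> real) set" where
  "Cb_tilde \<beta> =
     {f. continuous_map (Omega_top \<beta>) euclideanreal f \<and>
         bounded (f ` topspace (Omega_top \<beta>)) \<and>
         (\<forall>\<omega> \<in> topspace (Omega_top \<beta>). \<forall>\<omega>' \<in> topspace (Omega_top \<beta>).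
            same_means \<beta> \<omega> \<omega>' \<longrightarrow> f \<omega> = f \<omega>')}"

text \<open>
  The trigonometric orthonormal basis of \<open>L\<^sup>2([0,\<beta>])\<close>, indexed by \<open>n \<in> \<int>\<close> through
  \<open>q = 2 \<pi> n / \<beta>\<close>.
\<close>

definition trig_basis :: "real \<Rightarrow> int \<Rightarrow> real \<Rightarrow> real" where
  "trig_basis \<beta> n \<tau> =
     (let q = 2 * pi * of_int n / \<beta> in
      if n = 0 then 1 / sqrt \<beta>
      else if n > 0 then sqrt (2 / \<beta>) * cos (q * \<tau>)
      else sqrt (2 / \<beta>) * sin (q * \<tau>))"

text \<open>
  The quadratic form \<open>\<langle>h, (- m \<Delta>\<^sub>\<beta> + 1)\<^sup>-\<^sup>1 h\<rangle>\<close> of the covariance operator, which is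
  diagonal in the trigonometric basis with eigenvalues \<open>1 / (m q\<^sup>2 + 1)\<close>.
\<close>

definition loop_covariance :: "real \<Rightarrow> real \<Rightarrow> (real \<Rightarrow> real) \<Rightarrow> real" where
  "loop_covariance \<beta> m h =
     (\<Sum>\<^sub>\<infinity>n::int. (LBINT \<tau>:{0..\<beta>}. h \<tau> * trig_basis \<beta> n \<tau>)\<^sup>2
                   / (m * (2 * pi * of_int n / \<beta>)\<^sup>2 + 1))"

text \<open>The normal law \<open>N(0, v)\<close> for \<open>v \<ge> 0\<close>, a point mass if \<open>v = 0\<close>.\<close>

definition centered_normal :: "real \<Rightarrow> real measure" where
  "centered_normal v =
     (if v = 0 then return borel 0 else density lborel (\<lambda>x. ennreal (normal_density 0 (sqrt v) x)))"

text \<open>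
  \<open>\<gamma>\<close> is a measure on the loops which, viewed on \<open>L\<^sup>2([0,\<beta>])\<close>, is the centered Gaussian
  measure with covariance operator \<open>(- m \<Delta>\<^sub>\<beta> + 1)\<^sup>-\<^sup>1\<close>: every functional \<open>\<langle>h, \<cdot>\<rangle>\<close> with
  \<open>h \<in> L\<^sup>2([0,\<beta>])\<close> has law \<open>N(0, \<langle>h, (- m \<Delta>\<^sub>\<beta> + 1)\<^sup>-\<^sup>1 h\<rangle>)\<close>. These laws
  determine \<open>\<gamma>\<close>.
\<close>

definition is_gaussian_loop_measure :: "real \<Rightarrow> real \<Rightarrow> (real \<Rightarrow> real) measure \<Rightarrow> bool" where
  "is_gaussian_loop_measure \<beta> m \<gamma> \<longleftrightarrow>
     prob_space \<gamma> \<and> sets \<gamma> = sets (loop_borel \<beta>) \<and>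
     (\<forall>h. set_borel_measurable lborel {0..\<beta>} h \<and> set_integrable lborel {0..\<beta>} (\<lambda>\<tau>. (h \<tau>)\<^sup>2) \<longrightarrow>
        (\<lambda>\<omega>. LBINT \<tau>:{0..\<beta>}. h \<tau> * \<omega> \<tau>) \<in> borel_measurable \<gamma> \<and>
        distr \<gamma> borel (\<lambda>\<omega>. LBINT \<tau>:{0..\<beta>}. h \<tau> * \<omega> \<tau>)
          = centered_normal (loop_covariance \<beta> m h))"

definition quantum_energy ::
    "(int ^ 'd \<Rightarrow> int ^ 'd \<Rightarrow> real) \<Rightarrow> (int ^ 'd \<Rightarrow> real \<Rightarrow> real) \<Rightarrow> real \<Rightarrow> (int ^ 'd) set \<Rightarrow>
     (int ^ 'd \<Rightarrow> real \<Rightarrow> real) \<Rightarrow> (int ^ 'd \<Rightarrow> real \<Rightarrow> real) \<Rightarrow> real" where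
  "quantum_energy J U \<beta> \<Lambda> \<omega> \<zeta> =
     (\<Sum>j\<in>\<Lambda>. LBINT \<tau>:{0..\<beta>}. U j (\<omega> j \<tau>))
     + 1 / 2 * (\<Sum>j\<in>\<Lambda>. \<Sum>k\<in>\<Lambda>. J j k * (LBINT \<tau>:{0..\<beta>}. \<omega> j \<tau> * \<omega> k \<tau>))
     + (\<Sum>j\<in>\<Lambda>. \<Sum>\<^sub>\<infinity>k\<in>-\<Lambda>. J j k * (LBINT \<tau>:{0..\<beta>}. \<omega> j \<tau> * \<zeta> k \<tau>))"

text \<open>
  The argument \<open>\<gamma>\<close> of the quantum kernels is the one-site Gaussian loop measure
  \<open>\<gamma>\<^sub>\<beta>\<^sup>(\<^sup>m\<^sup>)\<close>; the mass enters through it only.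
\<close>

definition quantum_local ::
    "(int ^ 'd \<Rightarrow> int ^ 'd \<Rightarrow> real) \<Rightarrow> (int ^ 'd \<Rightarrow> real \<Rightarrow> real) \<Rightarrow> real \<Rightarrow> (real \<Rightarrow> real) measure \<Rightarrow>
     (int ^ 'd) set \<Rightarrow> (int ^ 'd \<Rightarrow> real \<Rightarrow> real) \<Rightarrow> (int ^ 'd \<Rightarrow> real \<Rightarrow> real) measure" where
  "quantum_local J U \<beta> \<gamma> \<Lambda> \<zeta> =
     (let \<gamma>\<Lambda> = PiM \<Lambda> (\<lambda>_. \<gamma>);
          Z = (\<integral>\<^sup>+ \<omega>. ennreal (exp (- quantum_energy J U \<beta> \<Lambda> \<omega> \<zeta>)) \<partial>\<gamma>\<Lambda>)
      in density \<gamma>\<Lambda> (\<lambda>\<omega>. ennreal (exp (- quantum_energy J U \<beta> \<Lambda> \<omega> \<zeta>)) / Z))"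

definition quantum_kernel ::
    "(int ^ 'd \<Rightarrow> int ^ 'd \<Rightarrow> real) \<Rightarrow> (int ^ 'd \<Rightarrow> real \<Rightarrow> real) \<Rightarrow> real \<Rightarrow> (real \<Rightarrow> real) measure \<Rightarrow>
     (int ^ 'd) set \<Rightarrow> (int ^ 'd \<Rightarrow> real \<Rightarrow> real) \<Rightarrow> (int ^ 'd \<Rightarrow> real \<Rightarrow> real) measure" where
  "quantum_kernel J U \<beta> \<gamma> \<Lambda> \<zeta> =
     distr (quantum_local J U \<beta> \<gamma> \<Lambda> \<zeta>) (Omega_sigma \<beta>) (\<lambda>\<omega>. merge \<Lambda> (- \<Lambda>) (\<omega>, \<zeta>))"

definition classical_energy ::
    "(int ^ 'd \<Rightarrow> int ^ 'd \<Rightarrow> real) \<Rightarrow> (int ^ 'd \<Rightarrow> real \<Rightarrow> real) \<Rightarrow> (int ^ 'd) set \<Rightarrow>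
     (int ^ 'd \<Rightarrow> real) \<Rightarrow> (int ^ 'd \<Rightarrow> real) \<Rightarrow> real" where
  "classical_energy J U \<Lambda> x y =
     (\<Sum>j\<in>\<Lambda>. U j (x j))
     + 1 / 2 * (\<Sum>j\<in>\<Lambda>. \<Sum>k\<in>\<Lambda>. J j k * x j * x k)
     + (\<Sum>j\<in>\<Lambda>. \<Sum>\<^sub>\<infinity>k\<in>-\<Lambda>. J j k * x j * y k)"

definition classical_reference :: "real \<Rightarrow> (int ^ 'd) set \<Rightarrow> (int ^ 'd \<Rightarrow> real) measure" where
  "classical_reference \<beta> \<Lambda> =
     PiM \<Lambda> (\<lambda>_. density lborel (\<lambda>x. ennreal (sqrt (\<beta> / (2 * pi)) * exp (- \<beta> * x\<^sup>2 / 2))))"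

definition classical_local ::
    "(int ^ 'd \<Rightarrow> int ^ 'd \<Rightarrow> real) \<Rightarrow> (int ^ 'd \<Rightarrow> real \<Rightarrow> real) \<Rightarrow> real \<Rightarrow> (int ^ 'd) set \<Rightarrow>
     (int ^ 'd \<Rightarrow> real) \<Rightarrow> (int ^ 'd \<Rightarrow> real) measure" where
  "classical_local J U \<beta> \<Lambda> y =
     (let \<chi>\<Lambda> = classical_reference \<beta> \<Lambda>;
          Y = (\<integral>\<^sup>+ x. ennreal (exp (- \<beta> * classical_energy J U \<Lambda> x y)) \<partial>\<chi>\<Lambda>)
      in density \<chi>\<Lambda> (\<lambda>x. ennreal (exp (- \<beta> * classical_energy J U \<Lambda> x y)) / Y))"

text \<open>On \<open>\<real>\<^sup>\<int>\<^sup>d\<close>, \<open>borel\<close> is the Borel \<open>\<sigma>\<close>-algebra of the product topology.\<close>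

definition classical_kernel ::
    "(int ^ 'd \<Rightarrow> int ^ 'd \<Rightarrow> real) \<Rightarrow> (int ^ 'd \<Rightarrow> real \<Rightarrow> real) \<Rightarrow> real \<Rightarrow> (int ^ 'd) set \<Rightarrow>
     (int ^ 'd \<Rightarrow> real) \<Rightarrow> (int ^ 'd \<Rightarrow> real) measure" where
  "classical_kernel J U \<beta> \<Lambda> y =
     distr (classical_local J U \<beta> \<Lambda> y) borel (\<lambda>x. merge \<Lambda> (- \<Lambda>) (x, y))"

end

theory Submission
  imports Defs
begin

text \<open>
  Under \<open>\<gamma>\<^sub>\<beta>\<^sup>(\<^sup>m\<^sup>)\<close> the mean \<open>X\<close> of a loop has the law
  \<open>N(0, 1/\<beta>)\<close> for every \<open>m\<close>, which is exactly the classical reference measure, and only the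
  fluctuation around the mean depends on \<open>m\<close>. The energy is a time integral of a density, and on
  constant loops it equals \<open>\<beta>\<close> times the classical energy; so it suffices that the quantum
  weight \<open>exp(- E(\<omega>))\<close> and the classical weight \<open>exp(- \<beta> I(X))\<close> become close in
  \<open>L\<^sup>1\<close>. Off a set of small probability this follows from the uniform smallness of the
  fluctuation, and on that set from uniform integrability, since \<open>c - c' < 1\<close> makes some power
  \<open>p > 1\<close> of the weights Gaussian integrable.

  The potentials have no growth bound from above, so the fluctuation must be small in the sup norm. This
  comes from chaining along averages over dyadic intervals: the increments are Gaussian with variance
  \<open>O(2\<^sup>-\<^sup>n\<^sup>/\<^sup>2 / m)\<close>, and a single random series controls both the sup norm and
  its Gaussian exponential moments.
\<close>

subsection \<open>Loops and dyadic averages\<close>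

text \<open>The hypothesis on \<open>\<gamma>\<close> gives the laws of pairings with square
  integrable functions, and evaluation at a time is not such a pairing. This is why the chain runs
  through averages: their increments are pairings with multiples of Haar functions, and a point
  value is reached only in the limit, by continuity. Only one-dimensional Gaussian laws are ever
  computed. Mean and fluctuation at a site are separated by a pointwise case distinction, which
  turns a product of exponentials into a sum, and the increments enter through expectations of
  single terms. Product structure is used only across sites. The margin left by \<open>c'\<close>
  can be arbitrarily small, so the coefficient of the squared mean may grow only by a factor close
  to 1. The splitting pays for this with a large coefficient \<open>K\<close> of the squared
  fluctuation, which is affordable because the increments have variance of order
  \<open>1 / m\<close>. The energy is \<open>\<beta>\<close> times the energy density at a single
  time depending on the loops, so bounds that are uniform in time pass directly to the
  weights.\<close>

lemma mem_loop_space_iff: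
  "\<omega> \<in> mspace (loop_space \<beta>) \<longleftrightarrow>
     continuous_on {0..\<beta>} \<omega> \<and> \<omega> \<in> extensional {0..\<beta>} \<and> \<omega> 0 = \<omega> \<beta>"
proof -
  have "Metric_space.mbounded UNIV dist (\<omega> ` {0..\<beta>})" if "continuous_on {0..\<beta>} \<omega>"
    using compact_imp_bounded[OF compact_continuous_image[OF that compact_Icc]]
    by (simp add: mbounded_iff_bounded)
  then show ?thesis
    unfolding loop_space_def by (auto simp: continuous_map_iff_continuous)
qed

lemma loop_dist_le:
  assumes "\<omega> \<in> mspace (loop_space \<beta>)" "\<omega>' \<in> mspace (loop_space \<beta>)" "t \<in> {0..\<beta>}"
  shows "\<bar>\<omega> t - \<omega>' t\<bar> \<le> mdist (loop_space \<beta>) \<omega> \<omega>'"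
  using mdist_cfunspace_imp_mdist_le[of \<omega> "top_of_set {0..\<beta>}" euclidean_metric \<omega>'] assms
  by (auto simp: loop_space_def dist_real_def)

text \<open>The loops carry an abstract metric on a carrier set, so their sigma-algebra is a
  \<open>sigma\<close> over the open sets rather than \<open>borel\<close>; preimages of open sets
  under a continuous map are generators.\<close>

lemma borel_measurable_sigma_openin:
  assumes "continuous_map (mtopology_of L) euclidean F"
  shows "F \<in> borel_measurable (sigma (mspace L) {S. openin (mtopology_of L) S})"
proof (rule borel_measurableI)
  fix S :: "'b set" assume "open S"
  then have "openin (mtopology_of L) {x \<in> topspace (mtopology_of L). F x \<in> S}"
    using openin_continuous_map_preimage[OF assms, of S] by simp
  then have *: "{x \<in> mspace L. F x \<in> S} \<in> {S. openin (mtopology_of L) S}" by simp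
  have sub: "{S. openin (mtopology_of L) S} \<subseteq> Pow (mspace L)"
    using openin_subset by fastforce
  have "F -` S \<inter> space (sigma (mspace L) {S. openin (mtopology_of L) S}) = {x \<in> mspace L. F x \<in> S}"
    by (auto simp: space_measure_of[OF sub])
  then show "F -` S \<inter> space (sigma (mspace L) {S. openin (mtopology_of L) S})
      \<in> sets (sigma (mspace L) {S. openin (mtopology_of L) S})"
    using * by (simp add: sets_measure_of[OF sub] sigma_sets.Basic)
qed

lemma space_loop_borel: "space (loop_borel \<beta>) = mspace (loop_space \<beta>)"
  unfolding loop_borel_def by (rule space_measure_of) (use openin_subset in fastforce)

lemma measurable_loop_eval:
  assumes "t \<in> {0..\<beta>}"
  shows "(\<lambda>\<omega>. \<omega> t) \<in> borel_measurable (loop_borel \<beta>)"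
  unfolding loop_borel_def
proof (rule borel_measurable_sigma_openin)
  have "Lipschitz_continuous_map (loop_space \<beta>) euclidean_metric (\<lambda>\<omega>. \<omega> t)"
    unfolding Lipschitz_continuous_map_def
    using loop_dist_le[OF _ _ assms] by (auto simp: dist_real_def intro!: exI[of _ 1])
  then have "continuous_map (mtopology_of (loop_space \<beta>)) (mtopology_of euclidean_metric) (\<lambda>\<omega>. \<omega> t)"
    by (rule Lipschitz_continuous_imp_continuous_map)
  then show "continuous_map (mtopology_of (loop_space \<beta>)) euclideanreal (\<lambda>\<omega>. \<omega> t)" by simp
qed

section \<open>Mean values and dyadic partitions of the period\<close>

lemma LBINT_eq_integral:
  fixes \<phi> :: "real \<Rightarrow> real"
  assumes "continuous_on {a..b} \<phi>"
  shows "(LBINT \<tau>:{a..b}. \<phi> \<tau>) = integral {a..b} \<phi>"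
  by (rule set_borel_integral_eq_integral(2)[OF borel_integrable_atLeastAtMost'[OF assms]])

text \<open>The main device for integrals here: an average of a continuous function is one of its
  values, so any bound valid at every time transfers to the integral.\<close>

lemma LBINT_mean_value:
  fixes \<phi> :: "real \<Rightarrow> real"
  assumes "a \<le> b" and cont: "continuous_on {a..b} \<phi>"
  obtains \<xi> where "\<xi> \<in> {a..b}" "(LBINT \<tau>:{a..b}. \<phi> \<tau>) = (b - a) * \<phi> \<xi>"
proof -
  have "((\<lambda>x. integral {a..x} \<phi>) has_derivative (*) (\<phi> t)) (at t within {a..b})"
    if "a \<le> t" "t \<le> b" for t
    using integral_has_real_derivative[OF cont, of t] that by (simp add: has_field_derivative_def)
  from mvt_very_simple[OF \<open>a \<le> b\<close> this] obtain \<xi> where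
    "\<xi> \<in> {a..b}" "integral {a..b} \<phi> - integral {a..a} \<phi> = \<phi> \<xi> * (b - a)" by blast
  then show ?thesis
    using LBINT_eq_integral[OF cont] that[of \<xi>] by (simp add: mult.commute)
qed

text \<open>Closed intervals, so that a mean value point stays inside; neighbours share an endpoint,
  which has no effect on integrals.\<close>

definition dyadic :: "real \<Rightarrow> nat \<Rightarrow> nat \<Rightarrow> real set" where
  "dyadic \<beta> n k = {\<beta> * real k / 2 ^ n .. \<beta> * real (Suc k) / 2 ^ n}"

definition dyadic_mean :: "real \<Rightarrow> nat \<Rightarrow> nat \<Rightarrow> (real \<Rightarrow> real) \<Rightarrow> real" where
  "dyadic_mean \<beta> n k \<phi> = 2 ^ n / \<beta> * (LBINT \<tau>:dyadic \<beta> n k. \<phi> \<tau>)"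

lemma dyadic_subset:
  assumes "0 < \<beta>" "k < 2 ^ n"
  shows "dyadic \<beta> n k \<subseteq> {0..\<beta>}"
proof -
  have "real (Suc k) \<le> 2 ^ n"
    using assms(2) by (metis Suc_leI numeral_power_le_of_nat_cancel_iff of_nat_le_iff of_nat_numeral of_nat_power)
  then have "\<beta> * real (Suc k) / 2 ^ n \<le> \<beta>"
    using assms(1) by (simp only: divide_le_eq mult_le_cancel_left_pos) simp
  then show ?thesis using assms(1) by (auto simp: dyadic_def intro: order_trans[rotated])
qed

lemma dyadic_child_subset:
  assumes "0 < \<beta>"
  shows "dyadic \<beta> (Suc n) j \<subseteq> dyadic \<beta> n (j div 2)"
proof -
  have "2 * (j div 2) \<le> j" "Suc j \<le> 2 * Suc (j div 2)"
    by presburger+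
  then have "2 * real (j div 2) \<le> real j" "real (Suc j) \<le> 2 * real (Suc (j div 2))"
    by (metis of_nat_le_iff of_nat_mult of_nat_numeral)+
  then have "\<beta> * (2 * real (j div 2)) \<le> \<beta> * real j" "\<beta> * real (Suc j) \<le> \<beta> * (2 * real (Suc (j div 2)))"
    using assms by (auto intro: mult_left_mono)
  then have "\<beta> * (2 * real (j div 2)) / 2 ^ Suc n \<le> \<beta> * real j / 2 ^ Suc n"
    "\<beta> * real (Suc j) / 2 ^ Suc n \<le> \<beta> * (2 * real (Suc (j div 2))) / 2 ^ Suc n"
    by (intro divide_right_mono; simp)+
  moreover have "\<beta> * (2 * u) / 2 ^ Suc n = \<beta> * u / 2 ^ n" for u by simp
  ultimately show ?thesis by (simp only: dyadic_def atLeastatMost_subset_iff) blast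
qed

lemma dyadic_diam:
  assumes "s \<in> dyadic \<beta> n k" "t \<in> dyadic \<beta> n k"
  shows "\<bar>s - t\<bar> \<le> \<beta> / 2 ^ n"
  using assms by (auto simp: dyadic_def algebra_simps add_divide_distrib)

lemma dyadic_mean_value:
  assumes "0 < \<beta>" "continuous_on (dyadic \<beta> n k) \<phi>"
  obtains \<xi> where "\<xi> \<in> dyadic \<beta> n k" "dyadic_mean \<beta> n k \<phi> = \<phi> \<xi>"
proof -
  have "\<beta> * real k / 2 ^ n \<le> \<beta> * real (Suc k) / 2 ^ n"
    using assms by (intro divide_right_mono mult_left_mono) auto
  from LBINT_mean_value[OF this, of \<phi>] assms obtain \<xi> where
    "\<xi> \<in> dyadic \<beta> n k" "(LBINT \<tau>:dyadic \<beta> n k. \<phi> \<tau>) = (\<beta> * real (Suc k) / 2 ^ n - \<beta> * real k / 2 ^ n) * \<phi> \<xi>"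
    unfolding dyadic_def by blast
  moreover have "\<beta> * real (Suc k) / 2 ^ n - \<beta> * real k / 2 ^ n = \<beta> / 2 ^ n"
    by (simp add: algebra_simps add_divide_distrib)
  ultimately show ?thesis using that[of \<xi>] assms by (simp add: dyadic_mean_def)
qed

lemma integral_sum_consecutive:
  fixes \<phi> :: "real \<Rightarrow> real"
  assumes "0 \<le> h" "continuous_on {0..h * real N} \<phi>"
  shows "integral {0..h * real N} \<phi> = (\<Sum>k<N. integral {h * real k..h * real (Suc k)} \<phi>)"
  using assms(2)
proof (induction N)
  case (Suc N)
  have le: "h * real N \<le> h * real (Suc N)" using assms(1) by (intro mult_left_mono) auto
  have "integral {0..h * real (Suc N)} \<phi> =
      integral {0..h * real N} \<phi> + integral {h * real N..h * real (Suc N)} \<phi>"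
    using le assms(1) integrable_continuous_real[OF Suc.prems]
    by (intro Henstock_Kurzweil_Integration.integral_combine[symmetric]) auto
  moreover have "continuous_on {0..h * real N} \<phi>"
    by (rule continuous_on_subset[OF Suc.prems]) (use le in auto)
  ultimately show ?case using Suc.IH by simp
qed simp

lemma LBINT_dyadic_sum:
  fixes \<phi> :: "real \<Rightarrow> real"
  assumes "0 < \<beta>" "continuous_on {0..\<beta>} \<phi>"
  shows "(LBINT \<tau>:{0..\<beta>}. \<phi> \<tau>) = (\<Sum>k<2^n. \<beta> / 2 ^ n * dyadic_mean \<beta> n k \<phi>)"
proof -
  have "(LBINT \<tau>:{0..\<beta>}. \<phi> \<tau>) = integral {0..\<beta> / 2 ^ n * real (2 ^ n)} \<phi>"
    using LBINT_eq_integral[OF assms(2)] by simp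
  also have "\<dots> = (\<Sum>k<2^n. integral (dyadic \<beta> n k) \<phi>)"
    by (subst integral_sum_consecutive) (use assms in \<open>auto simp: dyadic_def\<close>)
  also have "\<dots> = (\<Sum>k<2^n. \<beta> / 2 ^ n * dyadic_mean \<beta> n k \<phi>)"
  proof (rule sum.cong[OF refl])
    fix k :: nat assume "k \<in> {..<2 ^ n}"
    then have "continuous_on (dyadic \<beta> n k) \<phi>"
      using continuous_on_subset[OF assms(2) dyadic_subset] assms(1) by simp
    then show "integral (dyadic \<beta> n k) \<phi> = \<beta> / 2 ^ n * dyadic_mean \<beta> n k \<phi>"
      using assms(1) by (simp add: dyadic_mean_def dyadic_def LBINT_eq_integral)
  qed
  finally show ?thesis .
qed

text \<open>Serves measurability: it exhibits the quantum energy as a limit of expressions in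
  finitely many evaluations of the loops. The left endpoint and the mean value point lie in the same
  dyadic interval, whose length tends to 0, so uniform continuity controls the error.\<close>

lemma riemann_sums_tendsto:
  fixes \<phi> :: "real \<Rightarrow> real"
  assumes \<beta>: "0 < \<beta>" and cont: "continuous_on {0..\<beta>} \<phi>"
  shows "(\<lambda>n. \<Sum>k<2^n. \<beta> / 2 ^ n * \<phi> (\<beta> * real k / 2 ^ n)) \<longlonglongrightarrow> (LBINT \<tau>:{0..\<beta>}. \<phi> \<tau>)"
proof (rule tendstoI)
  fix e :: real assume "0 < e"
  then have "0 < e / (2 * \<beta>)" using \<beta> by simp
  with compact_uniformly_continuous[OF cont compact_Icc] obtain d where d: "0 < d"
    "\<And>s t. s \<in> {0..\<beta>} \<Longrightarrow> t \<in> {0..\<beta>} \<Longrightarrow> dist s t < d \<Longrightarrow> dist (\<phi> s) (\<phi> t) < e / (2 * \<beta>)"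
    unfolding uniformly_continuous_on_def by metis
  have "(\<lambda>n. \<beta> / 2 ^ n) \<longlonglongrightarrow> 0"
    by (rule LIMSEQ_divide_realpow_zero) simp
  then have "eventually (\<lambda>n. \<beta> / 2 ^ n < d) sequentially"
    using d(1) by (rule order_tendstoD)
  then show "eventually (\<lambda>n. dist (\<Sum>k<2^n. \<beta> / 2 ^ n * \<phi> (\<beta> * real k / 2 ^ n))
      (LBINT \<tau>:{0..\<beta>}. \<phi> \<tau>) < e) sequentially"
  proof eventually_elim
    case (elim n)
    have "\<bar>\<phi> (\<beta> * real k / 2 ^ n) - dyadic_mean \<beta> n k \<phi>\<bar> \<le> e / (2 * \<beta>)" if k: "k < 2 ^ n" for k
    proof -
      note sub = dyadic_subset[OF \<beta> k]
      obtain \<xi> where \<xi>: "\<xi> \<in> dyadic \<beta> n k" "dyadic_mean \<beta> n k \<phi> = \<phi> \<xi>"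
        using dyadic_mean_value[OF \<beta> continuous_on_subset[OF cont sub]] by blast
      have l: "\<beta> * real k / 2 ^ n \<in> dyadic \<beta> n k"
        unfolding dyadic_def atLeastAtMost_iff using \<beta> by (intro conjI order_refl divide_right_mono mult_left_mono) auto
      have "dist (\<beta> * real k / 2 ^ n) \<xi> < d"
        using dyadic_diam[OF l \<xi>(1)] elim by (simp add: dist_real_def)
      from d(2)[OF subsetD[OF sub l] subsetD[OF sub \<xi>(1)] this] show ?thesis
        by (simp add: \<xi>(2) dist_real_def)
    qed
    then have "(\<Sum>k<2^n. \<beta> / 2 ^ n * \<bar>\<phi> (\<beta> * real k / 2 ^ n) - dyadic_mean \<beta> n k \<phi>\<bar>)
        \<le> (\<Sum>k<(2::nat)^n. \<beta> / 2 ^ n * (e / (2 * \<beta>)))"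
      by (intro sum_mono mult_left_mono) (use \<beta> in auto)
    also have "\<dots> = e / 2" using \<beta> by simp
    also have "\<dots> < e" using \<open>0 < e\<close> by simp
    finally have "(\<Sum>k<2^n. \<beta> / 2 ^ n * \<bar>\<phi> (\<beta> * real k / 2 ^ n) - dyadic_mean \<beta> n k \<phi>\<bar>) < e" .
    moreover have "\<bar>\<Sum>k<2^n. \<beta> / 2 ^ n * (\<phi> (\<beta> * real k / 2 ^ n) - dyadic_mean \<beta> n k \<phi>)\<bar>
        \<le> (\<Sum>k<2^n. \<beta> / 2 ^ n * \<bar>\<phi> (\<beta> * real k / 2 ^ n) - dyadic_mean \<beta> n k \<phi>\<bar>)"
      by (rule order_trans[OF sum_abs]) (use \<beta> in \<open>simp add: abs_mult\<close>)
    moreover have "(\<Sum>k<2^n. \<beta> / 2 ^ n * (\<phi> (\<beta> * real k / 2 ^ n) - dyadic_mean \<beta> n k \<phi>)) =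
        (\<Sum>k<2^n. \<beta> / 2 ^ n * \<phi> (\<beta> * real k / 2 ^ n)) - (LBINT \<tau>:{0..\<beta>}. \<phi> \<tau>)"
      by (simp only: LBINT_dyadic_sum[OF \<beta> cont, of n] right_diff_distrib sum_subtractf)
    ultimately show ?case
      by (simp only: dist_real_def)
  qed
qed

text \<open>Each average is a value at some point of an interval containing \<open>t\<close>, and
  these intervals shrink to \<open>t\<close>.\<close>

lemma dyadic_mean_tendsto:
  assumes \<beta>: "0 < \<beta>" and cont: "continuous_on {0..\<beta>} \<phi>" and t: "t \<in> {0..\<beta>}"
    and k: "\<And>n. k n < 2 ^ n" "\<And>n. t \<in> dyadic \<beta> n (k n)"
  shows "(\<lambda>n. dyadic_mean \<beta> n (k n) \<phi>) \<longlonglongrightarrow> \<phi> t"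
proof -
  have "\<exists>\<xi>. \<xi> \<in> dyadic \<beta> n (k n) \<and> dyadic_mean \<beta> n (k n) \<phi> = \<phi> \<xi>" for n
    using dyadic_mean_value[OF \<beta> continuous_on_subset[OF cont dyadic_subset[OF \<beta> k(1)]]] by metis
  then obtain \<xi> where \<xi>: "\<And>n. \<xi> n \<in> dyadic \<beta> n (k n)" "\<And>n. dyadic_mean \<beta> n (k n) \<phi> = \<phi> (\<xi> n)"
    by metis
  have "(\<lambda>n. \<beta> / 2 ^ n) \<longlonglongrightarrow> 0" by (rule LIMSEQ_divide_realpow_zero) simp
  then have "(\<lambda>n. \<xi> n - t) \<longlonglongrightarrow> 0"
    by (rule Lim_null_comparison[rotated]) (use dyadic_diam[OF \<xi>(1) k(2)] in simp)
  then have "\<xi> \<longlonglongrightarrow> t" by (simp add: LIM_zero_iff)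
  moreover have "\<xi> n \<in> {0..\<beta>}" for n using \<xi>(1) dyadic_subset[OF \<beta> k(1)] by blast
  ultimately have "(\<lambda>n. \<phi> (\<xi> n)) \<longlonglongrightarrow> \<phi> t"
    using cont t unfolding continuous_on_sequentially by (auto simp: comp_def)
  then show ?thesis by (simp add: \<xi>(2))
qed

subsection \<open>Dyadic increments of the Gaussian loop\<close>

text \<open>Up to endpoints this is \<open>2 ^ n / \<beta>\<close> on interval \<open>j\<close> of
  level \<open>Suc n\<close> and \<open>- 2 ^ n / \<beta>\<close> on its sibling, hence a multiple
  of a Haar function. Pairing it with a loop gives the average over the child minus the average over
  the parent \<open>j div 2\<close>.\<close>

definition haar :: "real \<Rightarrow> nat \<Rightarrow> nat \<Rightarrow> real \<Rightarrow> real" where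
  "haar \<beta> n j \<tau> = 2 ^ Suc n / \<beta> * indicator (dyadic \<beta> (Suc n) j) \<tau>
     - 2 ^ n / \<beta> * indicator (dyadic \<beta> n (j div 2)) \<tau>"

definition dyadic_increment :: "real \<Rightarrow> nat \<Rightarrow> nat \<Rightarrow> (real \<Rightarrow> real) \<Rightarrow> real" where
  "dyadic_increment \<beta> n j \<phi> = dyadic_mean \<beta> (Suc n) j \<phi> - dyadic_mean \<beta> n (j div 2) \<phi>"

lemma div2_less_power: "j < 2 ^ Suc n \<Longrightarrow> j div 2 < (2::nat) ^ n"
  by (simp add: less_mult_imp_div_less)

lemma haar_measurable [measurable]: "haar \<beta> n j \<in> borel_measurable borel"
  unfolding haar_def[abs_def] dyadic_def by measurable

lemma haar_square_integrable: "set_integrable lborel {0..\<beta>} (\<lambda>\<tau>. (haar \<beta> n j \<tau>)\<^sup>2)"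
  unfolding set_integrable_def
proof -
  define B where "B = \<bar>2 ^ Suc n / \<beta>\<bar> + \<bar>2 ^ n / \<beta>\<bar>"
  have "\<bar>haar \<beta> n j x\<bar> \<le> B" for x
    unfolding haar_def B_def
    by (rule order_trans[OF abs_triangle_ineq4], unfold abs_mult, intro add_mono mult_left_le)
      (auto simp: indicator_def)
  then have B: "(haar \<beta> n j x)\<^sup>2 \<le> B\<^sup>2" for x
    by (intro abs_le_square_iff[THEN iffD1]) (metis abs_ge_self order_trans)
  show "integrable lborel (\<lambda>x. indicator {0..\<beta>} x *\<^sub>R (haar \<beta> n j x)\<^sup>2)"
    by (rule integrableI_bounded_set[where A="{0..\<beta>}" and B="B\<^sup>2"])
      (auto simp: emeasure_lborel_Icc_eq B)
qed

lemma LBINT_haar: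
  assumes \<beta>: "0 < \<beta>" and j: "j < 2 ^ Suc n" and cont: "continuous_on {0..\<beta>} \<phi>"
  shows "(LBINT \<tau>:{0..\<beta>}. haar \<beta> n j \<tau> * \<phi> \<tau>) = dyadic_increment \<beta> n j \<phi>"
proof -
  let ?D = "dyadic \<beta> (Suc n) j" and ?E = "dyadic \<beta> n (j div 2)"
  have sub: "?D \<subseteq> {0..\<beta>}" "?E \<subseteq> {0..\<beta>}"
    using dyadic_subset[OF \<beta> j] dyadic_subset[OF \<beta> div2_less_power[OF j]] by auto
  have int: "integrable lborel (\<lambda>\<tau>. indicator ?D \<tau> *\<^sub>R \<phi> \<tau>)" "integrable lborel (\<lambda>\<tau>. indicator ?E \<tau> *\<^sub>R \<phi> \<tau>)"
    using borel_integrable_atLeastAtMost'[OF continuous_on_subset[OF cont sub(1)[unfolded dyadic_def]]]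
      borel_integrable_atLeastAtMost'[OF continuous_on_subset[OF cont sub(2)[unfolded dyadic_def]]]
    by (auto simp: set_integrable_def dyadic_def)
  have "(LBINT \<tau>:{0..\<beta>}. haar \<beta> n j \<tau> * \<phi> \<tau>) =
      (LBINT \<tau>. 2 ^ Suc n / \<beta> * (indicator ?D \<tau> *\<^sub>R \<phi> \<tau>) - 2 ^ n / \<beta> * (indicator ?E \<tau> *\<^sub>R \<phi> \<tau>))"
    unfolding set_lebesgue_integral_def
    by (rule Bochner_Integration.integral_cong)
      (use sub in \<open>auto simp: haar_def algebra_simps split: split_indicator\<close>)
  also have "\<dots> = dyadic_increment \<beta> n j \<phi>"
    using int by (simp add: dyadic_increment_def dyadic_mean_def set_lebesgue_integral_def)
  finally show ?thesis .
qed

text \<open>The child interval lies in the parent, so the two mean value points are at most the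
  length of the parent apart.\<close>

lemma dyadic_increment_value:
  assumes \<beta>: "0 < \<beta>" and j: "j < 2 ^ Suc n" and cont: "continuous_on {0..\<beta>} \<phi>"
  obtains s t where "dyadic_increment \<beta> n j \<phi> = \<phi> s - \<phi> t" "\<bar>s - t\<bar> \<le> \<beta> / 2 ^ n"
proof -
  have sub: "dyadic \<beta> (Suc n) j \<subseteq> {0..\<beta>}" "dyadic \<beta> n (j div 2) \<subseteq> {0..\<beta>}"
    using dyadic_subset[OF \<beta> j] dyadic_subset[OF \<beta> div2_less_power[OF j]] by auto
  obtain s where s: "s \<in> dyadic \<beta> (Suc n) j" "dyadic_mean \<beta> (Suc n) j \<phi> = \<phi> s"
    using dyadic_mean_value[OF \<beta> continuous_on_subset[OF cont sub(1)]] by blast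
  obtain t where t: "t \<in> dyadic \<beta> n (j div 2)" "dyadic_mean \<beta> n (j div 2) \<phi> = \<phi> t"
    using dyadic_mean_value[OF \<beta> continuous_on_subset[OF cont sub(2)]] by blast
  show ?thesis
    using that[of s t] dyadic_diam[OF subsetD[OF dyadic_child_subset[OF \<beta>] s(1)] t(1)] s(2) t(2)
    by (simp add: dyadic_increment_def)
qed

section \<open>Increments of the Fourier modes and the covariance of the Haar functions\<close>

lemma abs_cos_diff_le: "\<bar>cos a - cos b\<bar> \<le> \<bar>a - b\<bar>" for a b :: real
proof -
  have "\<bar>sin ((a + b) / 2)\<bar> * \<bar>sin ((b - a) / 2)\<bar> \<le> 1 * \<bar>(b - a) / 2\<bar>"
    by (intro mult_mono abs_sin_le_one abs_sin_x_le_abs_x) auto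
  then show ?thesis by (simp add: cos_diff_cos abs_mult)
qed

lemma abs_sin_diff_le: "\<bar>sin a - sin b\<bar> \<le> \<bar>a - b\<bar>" for a b :: real
proof -
  have "\<bar>sin ((a - b) / 2)\<bar> * \<bar>cos ((a + b) / 2)\<bar> \<le> \<bar>(a - b) / 2\<bar> * 1"
    by (intro mult_mono abs_cos_le_one abs_sin_x_le_abs_x) auto
  then show ?thesis by (simp add: sin_diff_sin abs_mult)
qed

lemma continuous_on_trig_basis: "continuous_on S (trig_basis \<beta> k)"
proof -
  define q where "q = 2 * pi * of_int k / \<beta>"
  define a where "a = sqrt (2 / \<beta>)"
  have "trig_basis \<beta> k = (\<lambda>\<tau>. if k = 0 then 1 / sqrt \<beta>
      else if k > 0 then a * cos (q * \<tau>) else a * sin (q * \<tau>))"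
    unfolding a_def q_def by (simp add: trig_basis_def[abs_def] Let_def)
  then show ?thesis
    by (cases "k = 0"; cases "k > 0") (auto intro!: continuous_intros)
qed

text \<open>An interpolation between \<open>d^2 \<le> 4\<close> and \<open>d^2 \<le> x^2\<close>.
  Applied with \<open>x\<close> of order \<open>k / 2 ^ n\<close>, an exponent strictly between 0
  and 1 gives decay in the level \<open>n\<close> and, after division by \<open>k^2\<close>, still a
  summable series over the modes; 1/2 is such an exponent.\<close>

lemma square_le_sqrt:
  assumes "0 \<le> d" "d \<le> 2" "d \<le> x"
  shows "d\<^sup>2 \<le> 4 * sqrt (x::real)"
proof (cases "1 \<le> x")
  case True
  have "d\<^sup>2 \<le> 2\<^sup>2" using assms by (intro power_mono) auto
  moreover have "1 \<le> sqrt x" using True by simp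
  ultimately show ?thesis unfolding power2_eq_square[of 2] by linarith
next
  case False
  have "d\<^sup>2 \<le> x\<^sup>2" using assms by (intro power_mono) auto
  also have "\<dots> \<le> x" using False assms by (simp add: power2_eq_square mult_left_le_one_le)
  also have "\<dots> \<le> sqrt x"
    using False assms by (intro real_le_rsqrt) (simp add: power2_eq_square mult_left_le_one_le)
  also have "\<dots> \<le> 4 * sqrt x" using assms by simp
  finally show ?thesis .
qed

text \<open>The increment compares the basis function at two points at distance at most
  \<open>\<beta> / 2 ^ n\<close>, where the phase differs by at most
  \<open>2 * pi * |k| / 2 ^ n\<close>. The constant 8 is the 2 of the squared normalization times
  the 4 of \<open>square_le_sqrt\<close>.\<close>

lemma trig_increment_square_le:
  assumes \<beta>: "0 < \<beta>" and j: "j < 2 ^ Suc n"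
  shows "(dyadic_increment \<beta> n j (trig_basis \<beta> k))\<^sup>2
    \<le> 8 / \<beta> * sqrt (2 * pi * \<bar>of_int k\<bar> / 2 ^ n)"
proof -
  obtain s t where st: "dyadic_increment \<beta> n j (trig_basis \<beta> k) = trig_basis \<beta> k s - trig_basis \<beta> k t"
    "\<bar>s - t\<bar> \<le> \<beta> / 2 ^ n"
    using dyadic_increment_value[OF \<beta> j continuous_on_trig_basis] by metis
  define q where "q = 2 * pi * of_int k / \<beta>"
  have qst: "\<bar>q * s - q * t\<bar> \<le> 2 * pi * \<bar>of_int k\<bar> / 2 ^ n"
  proof -
    have "\<bar>q * s - q * t\<bar> = \<bar>q\<bar> * \<bar>s - t\<bar>" by (simp add: abs_mult[symmetric] algebra_simps)
    also have "\<dots> \<le> \<bar>q\<bar> * (\<beta> / 2 ^ n)" using st(2) by (intro mult_left_mono) auto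
    also have "\<dots> = 2 * pi * \<bar>of_int k\<bar> / 2 ^ n" using \<beta> by (simp add: q_def abs_mult)
    finally show ?thesis .
  qed
  have "\<exists>d. (trig_basis \<beta> k s - trig_basis \<beta> k t)\<^sup>2 = 2 / \<beta> * d\<^sup>2 \<and> 0 \<le> d \<and> d \<le> 2 \<and>
      d \<le> 2 * pi * \<bar>of_int k\<bar> / 2 ^ n"
  proof -
    consider "k = 0" | "k > 0" | "k < 0" by linarith
    then show ?thesis
    proof cases
      case 1
      then show ?thesis by (intro exI[of _ 0]) (simp add: trig_basis_def)
    next
      case 2
      have "\<bar>cos (q * s) - cos (q * t)\<bar> \<le> 2"
        using abs_cos_le_one[of "q * s"] abs_cos_le_one[of "q * t"] by linarith
      moreover have "(trig_basis \<beta> k s - trig_basis \<beta> k t)\<^sup>2 = (sqrt (2 / \<beta>) * (cos (q * s) - cos (q * t)))\<^sup>2"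
        using 2 by (simp add: trig_basis_def Let_def q_def right_diff_distrib)
      ultimately show ?thesis
        using abs_cos_diff_le[of "q * s" "q * t"] qst \<beta>
        by (intro exI[of _ "\<bar>cos (q * s) - cos (q * t)\<bar>"]) (simp add: power_mult_distrib)
    next
      case 3
      have "\<bar>sin (q * s) - sin (q * t)\<bar> \<le> 2"
        using abs_sin_le_one[of "q * s"] abs_sin_le_one[of "q * t"] by linarith
      moreover have "(trig_basis \<beta> k s - trig_basis \<beta> k t)\<^sup>2 = (sqrt (2 / \<beta>) * (sin (q * s) - sin (q * t)))\<^sup>2"
        using 3 by (simp add: trig_basis_def Let_def q_def right_diff_distrib)
      ultimately show ?thesis
        using abs_sin_diff_le[of "q * s" "q * t"] qst \<beta>
        by (intro exI[of _ "\<bar>sin (q * s) - sin (q * t)\<bar>"]) (simp add: power_mult_distrib)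
    qed
  qed
  then obtain d where d: "(trig_basis \<beta> k s - trig_basis \<beta> k t)\<^sup>2 = 2 / \<beta> * d\<^sup>2"
    "0 \<le> d" "d \<le> 2" "d \<le> 2 * pi * \<bar>of_int k\<bar> / 2 ^ n" by blast
  have "2 / \<beta> * d\<^sup>2 \<le> 2 / \<beta> * (4 * sqrt (2 * pi * \<bar>of_int k\<bar> / 2 ^ n))"
    using \<beta> by (intro mult_left_mono square_le_sqrt d) auto
  then show ?thesis by (simp add: st(1) d(1))
qed

lemma summable_on_int_powr: "(\<lambda>k::int. \<bar>of_int k :: real\<bar> powr (- (3 / 2))) summable_on UNIV"
proof -
  have nat: "(\<lambda>n::nat. real n powr (- (3 / 2))) summable_on UNIV"
    by (subst summable_on_UNIV_nonneg_real_iff) (auto simp: summable_real_powr_iff)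
  have 1: "(\<lambda>k::int. \<bar>of_int k :: real\<bar> powr (- (3 / 2))) summable_on range int"
    using nat by (subst summable_on_reindex) (auto simp: comp_def inj_def)
  have 2: "(\<lambda>k::int. \<bar>of_int k :: real\<bar> powr (- (3 / 2))) summable_on range (\<lambda>n. - int n)"
    using nat by (subst summable_on_reindex) (auto simp: comp_def inj_def)
  have "range int \<union> range (\<lambda>n. - int n) = UNIV"
  proof -
    have "k \<in> range int \<union> range (\<lambda>n. - int n)" for k
      by (cases k rule: int_cases2) auto
    then show ?thesis by blast
  qed
  then show ?thesis using summable_on_union[OF 1 2] by simp
qed

text \<open>Dropping the 1 in the denominator extracts the factor \<open>1 / m\<close> and leaves a
  series independent of \<open>m\<close>. This is possible because the mode \<open>k = 0\<close>,
  whose eigenvalue stays 1 for every mass, has no increments.\<close>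

lemma loop_covariance_haar_bound:
  assumes \<beta>: "0 < \<beta>"
  obtains C where "0 < C"
    "\<And>m n j. 0 < m \<Longrightarrow> j < 2 ^ Suc n \<Longrightarrow> 0 \<le> loop_covariance \<beta> m (haar \<beta> n j)"
    "\<And>m n j. 0 < m \<Longrightarrow> j < 2 ^ Suc n \<Longrightarrow> loop_covariance \<beta> m (haar \<beta> n j) \<le> C / m * sqrt (1 / 2) ^ n"
proof -
  define P where "P k = \<bar>of_int k :: real\<bar> powr (- (3 / 2))" for k :: int
  define A where "A = 8 / \<beta> * sqrt (2 * pi) / (2 * pi / \<beta>)\<^sup>2"
  have P: "P summable_on UNIV" unfolding P_def by (rule summable_on_int_powr)
  have A: "0 < A" using \<beta> by (simp add: A_def)
  have P0: "0 \<le> infsum P UNIV" by (rule infsum_nonneg) (simp add: P_def)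
  show ?thesis
  proof
    \<comment> \<open>The summand 1 makes the constant strictly positive without evaluating the
      series.\<close>
    show "0 < A * infsum P UNIV + 1" using A P0 by (simp add: add_nonneg_pos)
    fix m :: real and n j :: nat assume m: "0 < m" and j: "j < 2 ^ Suc n"
    define T where "T k = (LBINT \<tau>:{0..\<beta>}. haar \<beta> n j \<tau> * trig_basis \<beta> k \<tau>)\<^sup>2
                   / (m * (2 * pi * of_int k / \<beta>)\<^sup>2 + 1)" for k :: int
    have T0: "0 \<le> T k" for k using m by (simp add: T_def)
    show "0 \<le> loop_covariance \<beta> m (haar \<beta> n j)"
      unfolding loop_covariance_def using T0 by (intro infsum_nonneg) (simp add: T_def)
    have Tle: "T k \<le> A / m * sqrt (1 / 2) ^ n * P k" for k
    proof (cases "k = 0")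
      case True
      \<comment> \<open>Both sides vanish at \<open>k = 0\<close>: a constant has no increments, and
        \<open>0 powr _\<close> is 0 by convention.\<close>
      obtain t u where "dyadic_increment \<beta> n j (trig_basis \<beta> 0) = trig_basis \<beta> 0 t - trig_basis \<beta> 0 u"
        using dyadic_increment_value[OF \<beta> j continuous_on_trig_basis] by metis
      then have "dyadic_increment \<beta> n j (trig_basis \<beta> 0) = 0"
        by (simp add: trig_basis_def)
      then show ?thesis using True LBINT_haar[OF \<beta> j continuous_on_trig_basis]
        by (simp add: T_def P_def)
    next
      case False
      have pos: "0 < m * (2 * pi * of_int k / \<beta>)\<^sup>2" using m False \<beta> by simp
      have "T k = (dyadic_increment \<beta> n j (trig_basis \<beta> k))\<^sup>2 / (m * (2 * pi * of_int k / \<beta>)\<^sup>2 + 1)"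
        unfolding T_def using LBINT_haar[OF \<beta> j continuous_on_trig_basis] by simp
      also have "\<dots> \<le> (8 / \<beta> * sqrt (2 * pi * \<bar>of_int k\<bar> / 2 ^ n)) / (m * (2 * pi * of_int k / \<beta>)\<^sup>2)"
        using pos \<beta> by (intro frac_le trig_increment_square_le j) auto
      also have "\<dots> = A / m * sqrt (1 / 2) ^ n * (sqrt \<bar>of_int k\<bar> / (of_int k)\<^sup>2)"
        using \<beta> m by (simp add: A_def real_sqrt_mult real_sqrt_divide real_sqrt_power power_divide
            power_mult_distrib field_simps)
      also have "sqrt \<bar>of_int k\<bar> / (of_int k)\<^sup>2 = P k"
      proof -
        have "sqrt \<bar>of_int k\<bar> / (of_int k)\<^sup>2 = \<bar>of_int k :: real\<bar> powr (1 / 2) / \<bar>of_int k\<bar> powr 2"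
          using False by (simp add: powr_half_sqrt powr_numeral)
        also have "\<dots> = P k"
          unfolding P_def powr_diff[symmetric] by simp
        finally show ?thesis .
      qed
      finally show ?thesis .
    qed
    have sP: "(\<lambda>k. A / m * sqrt (1 / 2) ^ n * P k) summable_on UNIV"
      using P by (rule summable_on_cmult_right)
    have "loop_covariance \<beta> m (haar \<beta> n j) = infsum T UNIV"
      by (simp add: loop_covariance_def T_def[abs_def])
    also have "\<dots> \<le> infsum (\<lambda>k. A / m * sqrt (1 / 2) ^ n * P k) UNIV"
      by (intro infsum_mono sP Tle summable_on_comparison_test[OF sP Tle T0])
    also have "\<dots> = A / m * sqrt (1 / 2) ^ n * infsum P UNIV"
      by (rule infsum_cmult_right') 
    also have "\<dots> = A * infsum P UNIV / m * sqrt (1 / 2) ^ n" by simp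
    also have "\<dots> \<le> (A * infsum P UNIV + 1) / m * sqrt (1 / 2) ^ n"
      using m by (intro mult_right_mono divide_right_mono) auto
    finally show "loop_covariance \<beta> m (haar \<beta> n j) \<le> (A * infsum P UNIV + 1) / m * sqrt (1 / 2) ^ n" .
  qed
qed

text \<open>Put \<open>z = x^2 / v\<close> and \<open>s = v / \<theta>^2\<close>, so that the
  squared ratio is \<open>s * z\<close>. The exponential costs at most \<open>exp (z / 4)\<close>,
  and \<open>z / 32 \<le> exp (z / 32)\<close> gives \<open>z^4 \<le> 32^4 * exp (z / 8)\<close>.
  Since - 1/2 + 1/8 + 1/4 = - 1/8, what remains is twice a centered normal density of variance
  \<open>4 * v\<close>; hence 2097152 = 2 * 32^4.\<close>

lemma exp_moment_centered_normal:
  fixes v \<theta> K :: real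
  assumes v: "0 \<le> v" and \<theta>: "0 < \<theta>" and K: "0 \<le> K" "K * (v / \<theta>\<^sup>2) \<le> 1 / 4"
  shows "(\<integral>\<^sup>+ x. ennreal (((x / \<theta>)\<^sup>2) ^ 4 * exp (K * (x / \<theta>)\<^sup>2)) \<partial>centered_normal v)
    \<le> ennreal (2097152 * (v / \<theta>\<^sup>2) ^ 4)"
proof (cases "v = 0")
  case True
  then show ?thesis
    by (simp add: centered_normal_def nn_integral_return)
next
  case False
  with v have v: "0 < v" by simp
  define s where "s = v / \<theta>\<^sup>2"
  have s: "0 < s" using v \<theta> by (simp add: s_def)
  have point: "normal_density 0 (sqrt v) x * (((x / \<theta>)\<^sup>2) ^ 4 * exp (K * (x / \<theta>)\<^sup>2))
      \<le> 2097152 * s ^ 4 * normal_density 0 (2 * sqrt v) x" for x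
  proof -
    define z where "z = x\<^sup>2 / v"
    have z: "0 \<le> z" using v by (simp add: z_def)
    have xz: "(x / \<theta>)\<^sup>2 = s * z" using v by (simp add: s_def z_def power_divide)
    have "(z / 32) ^ 4 \<le> exp (z / 32) ^ 4"
      using z order_trans[OF _ exp_ge_add_one_self, of "z / 32" "z / 32"] by (intro power_mono) auto
    then have z4: "z ^ 4 \<le> 1048576 * exp (z / 8)" by (simp add: power_divide exp_of_nat_mult[symmetric])
    have "exp (K * (s * z)) \<le> exp (z / 4)"
      using mult_right_mono[OF K(2) z] by (simp add: s_def)
    then have "((x / \<theta>)\<^sup>2) ^ 4 * exp (K * (x / \<theta>)\<^sup>2) \<le> s ^ 4 * (1048576 * exp (z / 8)) * exp (z / 4)"
      unfolding xz power_mult_distrib using z4 s z by (intro mult_mono mult_left_mono) auto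
    then have "normal_density 0 (sqrt v) x * (((x / \<theta>)\<^sup>2) ^ 4 * exp (K * (x / \<theta>)\<^sup>2))
        \<le> normal_density 0 (sqrt v) x * (s ^ 4 * (1048576 * exp (z / 8)) * exp (z / 4))"
      by (intro mult_left_mono) auto
    also have "\<dots> = 2097152 * s ^ 4 * normal_density 0 (2 * sqrt v) x"
    proof -
      have "exp (- (z / 2)) * (exp (z / 8) * exp (z / 4)) = exp (- (z / 8))"
        by (simp add: exp_add[symmetric])
      moreover have "normal_density 0 (sqrt v) x = 1 / sqrt (2 * pi * v) * exp (- (z / 2))"
        using v by (simp add: normal_density_def z_def)
      moreover have "normal_density 0 (2 * sqrt v) x = 1 / (2 * sqrt (2 * pi * v)) * exp (- (z / 8))"
      proof -
        have "2 * pi * (2 * sqrt v)\<^sup>2 = 2\<^sup>2 * (2 * pi * v)"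
          using v by (simp add: power_mult_distrib)
        then have "sqrt (2 * pi * (2 * sqrt v)\<^sup>2) = 2 * sqrt (2 * pi * v)"
          by (simp only: real_sqrt_mult[of "2\<^sup>2"] real_sqrt_abs)
        moreover have "(x - 0)\<^sup>2 / (2 * (2 * sqrt v)\<^sup>2) = z / 8"
          using v by (simp add: z_def power_mult_distrib)
        ultimately show ?thesis by (simp only: normal_density_def minus_divide_left[symmetric])
      qed
      ultimately show ?thesis by (simp add: field_simps)
    qed
    finally show ?thesis .
  qed
  have "(\<integral>\<^sup>+ x. ennreal (((x / \<theta>)\<^sup>2) ^ 4 * exp (K * (x / \<theta>)\<^sup>2)) \<partial>centered_normal v) =
      (\<integral>\<^sup>+ x. ennreal (normal_density 0 (sqrt v) x) * ennreal (((x / \<theta>)\<^sup>2) ^ 4 * exp (K * (x / \<theta>)\<^sup>2)) \<partial>lborel)"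
    using v by (simp add: centered_normal_def nn_integral_density)
  also have "\<dots> \<le> (\<integral>\<^sup>+ x. ennreal (2097152 * s ^ 4) * ennreal (normal_density 0 (2 * sqrt v) x) \<partial>lborel)"
    using s point by (intro nn_integral_mono) (simp add: ennreal_mult[symmetric] ennreal_leI)
  also have "\<dots> = ennreal (2097152 * s ^ 4) * (\<integral>\<^sup>+ x. ennreal (normal_density 0 (2 * sqrt v) x) \<partial>lborel)"
    by (rule nn_integral_cmult) auto
  also have "(\<integral>\<^sup>+ x. ennreal (normal_density 0 (2 * sqrt v) x) \<partial>lborel) = 1"
    using v by (subst nn_integral_eq_integral) (auto simp: integral_normal_density integrable_normal_density)
  finally show ?thesis by (simp add: s_def)
qed

subsection \<open>Chaining\<close>

text \<open>The weights form a series of sum 1, so increments bounded by weight times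
  \<open>sqrt M\<close> add up to at most \<open>sqrt M\<close>. The ratio is close to 1 because
  division by the squared weight inflates the variance of level \<open>n\<close> by
  \<open>(16/15)^(2*n)\<close>, which must not destroy the decay that the fourth power
  provides.\<close>

definition chain_weight :: "nat \<Rightarrow> real" where
  "chain_weight n = 1 / 16 * (15 / 16) ^ n"

definition chain_term :: "real \<Rightarrow> nat \<Rightarrow> nat \<Rightarrow> (real \<Rightarrow> real) \<Rightarrow> real" where
  "chain_term \<beta> n j \<omega> = (dyadic_increment \<beta> n j \<omega> / chain_weight n)\<^sup>2"

text \<open>
  There are \<open>2\<^sup>n\<^sup>+\<^sup>1\<close> increments of level \<open>n\<close>, each of variance
  \<open>O(2\<^sup>-\<^sup>n\<^sup>/\<^sup>2)\<close>; the fourth power makes the expectations summable, and with it the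
  sum still dominates the exponential of every term that is at least 1.
\<close>

definition chain_sum :: "real \<Rightarrow> real \<Rightarrow> (real \<Rightarrow> real) \<Rightarrow> ennreal" where
  "chain_sum \<beta> K \<omega> =
     (\<Sum>n. \<Sum>j<2 ^ Suc n. ennreal (chain_term \<beta> n j \<omega> ^ 4 * exp (K * chain_term \<beta> n j \<omega>)))"

lemma chain_weight_pos: "0 < chain_weight n"
  by (simp add: chain_weight_def)

lemma sum_chain_weight_le: "(\<Sum>n<N. chain_weight n) \<le> 1"
proof -
  have "(\<Sum>n<N. (15 / 16 :: real) ^ n) = 16 * (1 - (15 / 16) ^ N)"
    by (simp add: sum_gp_strict)
  then show ?thesis by (simp add: chain_weight_def sum_divide_distrib[symmetric])
qed

lemma chain_term_nonneg: "0 \<le> chain_term \<beta> n j \<omega>"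
  by (simp add: chain_term_def)

lemma space_gaussian_loop_measure:
  assumes "is_gaussian_loop_measure \<beta> m \<gamma>"
  shows "space \<gamma> = mspace (loop_space \<beta>)"
  using assms sets_eq_imp_space_eq space_loop_borel unfolding is_gaussian_loop_measure_def by metis

text \<open>The pairing with \<open>haar\<close> is known to be the increment for continuous
  functions only, so law and measurability are transferred by congruence on
  \<open>space \<gamma>\<close>, which consists of loops.\<close>

lemma dyadic_increment_law:
  assumes \<gamma>: "is_gaussian_loop_measure \<beta> m \<gamma>" and \<beta>: "0 < \<beta>" and j: "j < 2 ^ Suc n"
  shows "dyadic_increment \<beta> n j \<in> borel_measurable \<gamma>"
    "distr \<gamma> borel (dyadic_increment \<beta> n j) = centered_normal (loop_covariance \<beta> m (haar \<beta> n j))"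
proof -
  have *: "(LBINT \<tau>:{0..\<beta>}. haar \<beta> n j \<tau> * \<omega> \<tau>) = dyadic_increment \<beta> n j \<omega>" if "\<omega> \<in> space \<gamma>" for \<omega>
    using LBINT_haar[OF \<beta> j] that space_gaussian_loop_measure[OF \<gamma>] by (simp add: mem_loop_space_iff)
  have "set_borel_measurable lborel {0..\<beta>} (haar \<beta> n j)"
    unfolding set_borel_measurable_def by measurable
  then have "(\<lambda>\<omega>. LBINT \<tau>:{0..\<beta>}. haar \<beta> n j \<tau> * \<omega> \<tau>) \<in> borel_measurable \<gamma> \<and>
      distr \<gamma> borel (\<lambda>\<omega>. LBINT \<tau>:{0..\<beta>}. haar \<beta> n j \<tau> * \<omega> \<tau>)
          = centered_normal (loop_covariance \<beta> m (haar \<beta> n j))"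
    using \<gamma> haar_square_integrable unfolding is_gaussian_loop_measure_def by blast
  moreover have "distr \<gamma> borel (\<lambda>\<omega>. LBINT \<tau>:{0..\<beta>}. haar \<beta> n j \<tau> * \<omega> \<tau>) = distr \<gamma> borel (dyadic_increment \<beta> n j)"
    by (rule distr_cong[OF refl refl *])
  ultimately show "dyadic_increment \<beta> n j \<in> borel_measurable \<gamma>"
    "distr \<gamma> borel (dyadic_increment \<beta> n j) = centered_normal (loop_covariance \<beta> m (haar \<beta> n j))"
    using measurable_cong[of \<gamma> _ "dyadic_increment \<beta> n j", OF *] by auto
qed

section \<open>The law of the time average of a loop\<close>

lemma LBINT_trig_basis:
  assumes \<beta>: "0 < \<beta>"
  shows "(LBINT \<tau>:{0..\<beta>}. trig_basis \<beta> k \<tau>) = (if k = 0 then sqrt \<beta> else 0)"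
proof -
  define q where "q = 2 * pi * of_int k / \<beta>"
  have q\<beta>: "q * \<beta> = 2 * pi * of_int k" using \<beta> by (simp add: q_def)
  have LI: "(LBINT \<tau>:{0..\<beta>}. trig_basis \<beta> k \<tau>) = integral {0..\<beta>} (trig_basis \<beta> k)"
    by (rule LBINT_eq_integral[OF continuous_on_trig_basis])
  consider "k = 0" | "k > 0" | "k < 0" by linarith
  then show ?thesis
  proof cases
    case 1
    then have "integral {0..\<beta>} (trig_basis \<beta> k) = \<beta> / sqrt \<beta>"
      using \<beta> by (simp add: trig_basis_def[abs_def])
    then show ?thesis using 1 LI by (simp add: real_div_sqrt \<beta> less_imp_le)
  next
    case 2
    have q: "q \<noteq> 0" using 2 \<beta> by (simp add: q_def)
    have "(trig_basis \<beta> k has_integral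
        sqrt (2 / \<beta>) * sin (q * \<beta>) / q - sqrt (2 / \<beta>) * sin (q * 0) / q) {0..\<beta>}"
    proof (rule fundamental_theorem_of_calculus)
      fix x assume "x \<in> {0..\<beta>}"
      show "((\<lambda>x. sqrt (2 / \<beta>) * sin (q * x) / q) has_vector_derivative trig_basis \<beta> k x) (at x within {0..\<beta>})"
        unfolding has_real_derivative_iff_has_vector_derivative[symmetric]
        using 2 q by (auto intro!: derivative_eq_intros simp: trig_basis_def Let_def q_def)
    qed (use \<beta> in simp)
    moreover have "sin (q * \<beta>) = 0"
      unfolding q\<beta> by (metis mult.commute sin_int_2pin mult.assoc)
    ultimately show ?thesis using 2 LI by (simp add: integral_unique)
  next
    case 3
    have q: "q \<noteq> 0" using 3 \<beta> by (simp add: q_def)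
    have "(trig_basis \<beta> k has_integral
        - sqrt (2 / \<beta>) * cos (q * \<beta>) / q - (- sqrt (2 / \<beta>) * cos (q * 0) / q)) {0..\<beta>}"
    proof (rule fundamental_theorem_of_calculus)
      fix x assume "x \<in> {0..\<beta>}"
      show "((\<lambda>x. - sqrt (2 / \<beta>) * cos (q * x) / q) has_vector_derivative trig_basis \<beta> k x) (at x within {0..\<beta>})"
        unfolding has_real_derivative_iff_has_vector_derivative[symmetric]
        using 3 q by (auto intro!: derivative_eq_intros simp: trig_basis_def Let_def q_def)
    qed (use \<beta> in simp)
    moreover have "cos (q * \<beta>) = 1"
      unfolding q\<beta> by (metis mult.commute cos_int_2pin mult.assoc)
    ultimately show ?thesis using 3 LI by (simp add: integral_unique)
  qed
qed

text \<open>A constant is orthogonal to every mode except \<open>k = 0\<close>, and the eigenvalue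
  of that mode is 1 for each mass.\<close>

lemma loop_covariance_const:
  assumes \<beta>: "0 < \<beta>"
  shows "loop_covariance \<beta> m (\<lambda>_. 1 / \<beta>) = 1 / \<beta>"
proof -
  have T: "(LBINT \<tau>:{0..\<beta>}. 1 / \<beta> * trig_basis \<beta> k \<tau>) = (if k = 0 then sqrt \<beta> / \<beta> else 0)" for k
    using LBINT_trig_basis[OF \<beta>, of k] by (simp only: set_integral_mult_right) simp
  have "loop_covariance \<beta> m (\<lambda>_. 1 / \<beta>) = infsum (\<lambda>k::int. 1 / \<beta>) {0}"
    unfolding loop_covariance_def
    unfolding T by (rule infsum_cong_neutral) (use \<beta> in \<open>auto simp: power_divide power2_eq_square\<close>)
  then show ?thesis by simp
qed

lemma dyadic_mean_0: "dyadic_mean \<beta> 0 0 \<phi> = 1 / \<beta> * (LBINT \<tau>:{0..\<beta>}. \<phi> \<tau>)"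
  by (simp add: dyadic_mean_def dyadic_def)

text \<open>The normal law of variance \<open>1 / \<beta>\<close>, written like the one-site factor
  of \<open>classical_reference\<close> so that the product measures agree by unfolding.\<close>

definition mean_dist :: "real \<Rightarrow> real measure" where
  "mean_dist \<beta> = density lborel (\<lambda>x. ennreal (sqrt (\<beta> / (2 * pi)) * exp (- \<beta> * x\<^sup>2 / 2)))"

lemma sets_mean_dist [simp, measurable_cong]: "sets (mean_dist \<beta>) = sets borel"
  by (simp add: mean_dist_def)

lemma space_mean_dist [simp]: "space (mean_dist \<beta>) = UNIV"
  by (simp add: mean_dist_def)

lemma mean_law:
  assumes \<gamma>: "is_gaussian_loop_measure \<beta> m \<gamma>" and \<beta>: "0 < \<beta>"
  shows "dyadic_mean \<beta> 0 0 \<in> borel_measurable \<gamma>"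
    "distr \<gamma> borel (dyadic_mean \<beta> 0 0) = mean_dist \<beta>"
proof -
  have *: "(\<lambda>\<omega>. LBINT \<tau>:{0..\<beta>}. 1 / \<beta> * \<omega> \<tau>) = dyadic_mean \<beta> 0 0"
    by (simp add: dyadic_mean_0[abs_def])
  have "set_borel_measurable lborel {0..\<beta>} (\<lambda>_. 1 / \<beta>)"
    "set_integrable lborel {0..\<beta>} (\<lambda>_. (1 / \<beta>)\<^sup>2)"
    unfolding set_borel_measurable_def
    by (measurable, intro borel_integrable_atLeastAtMost' continuous_intros)
  then have "(\<lambda>\<omega>. LBINT \<tau>:{0..\<beta>}. 1 / \<beta> * \<omega> \<tau>) \<in> borel_measurable \<gamma> \<and>
      distr \<gamma> borel (\<lambda>\<omega>. LBINT \<tau>:{0..\<beta>}. 1 / \<beta> * \<omega> \<tau>)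
          = centered_normal (loop_covariance \<beta> m (\<lambda>_. 1 / \<beta>))"
    using \<gamma> unfolding is_gaussian_loop_measure_def by blast
  then have **: "dyadic_mean \<beta> 0 0 \<in> borel_measurable \<gamma>"
    "distr \<gamma> borel (dyadic_mean \<beta> 0 0) = centered_normal (1 / \<beta>)"
    unfolding * loop_covariance_const[OF \<beta>] by auto
  have "normal_density 0 (sqrt (1 / \<beta>)) x = sqrt (\<beta> / (2 * pi)) * exp (- \<beta> * x\<^sup>2 / 2)" for x
    using \<beta> by (simp add: normal_density_def real_sqrt_divide real_sqrt_mult field_simps)
  then have "centered_normal (1 / \<beta>) = mean_dist \<beta>"
    using \<beta> by (simp add: centered_normal_def mean_dist_def)
  with ** show "dyadic_mean \<beta> 0 0 \<in> borel_measurable \<gamma>"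
    "distr \<gamma> borel (dyadic_mean \<beta> 0 0) = mean_dist \<beta>" by auto
qed

lemma chain_sum_measurable:
  assumes \<gamma>: "is_gaussian_loop_measure \<beta> m \<gamma>" and \<beta>: "0 < \<beta>"
  shows "chain_sum \<beta> K \<in> borel_measurable \<gamma>"
proof -
  have [measurable]: "chain_term \<beta> n j \<in> borel_measurable \<gamma>" if "j < 2 ^ Suc n" for n j
    unfolding chain_term_def[abs_def] using dyadic_increment_law(1)[OF \<gamma> \<beta> that] by measurable
  show ?thesis
    unfolding chain_sum_def[abs_def]
    by (intro borel_measurable_suminf_order borel_measurable_sum) auto
qed

text \<open>Level \<open>n\<close> has \<open>2 ^ Suc n\<close> terms, each of expectation at most a
  constant times \<open>(C / m)^4 * \<rho>^(4*n)\<close>. The number of terms and the decay combine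
  to a geometric series of ratio at most 9/10, whose sum is 10.\<close>

lemma nn_integral_chain_sum_le:
  assumes \<beta>: "0 < \<beta>" and K: "0 \<le> K"
  obtains D m0 where "0 \<le> D"
    "\<And>m \<gamma>. m0 \<le> m \<Longrightarrow> 0 < m \<Longrightarrow> is_gaussian_loop_measure \<beta> m \<gamma> \<Longrightarrow>
       (\<integral>\<^sup>+ \<omega>. chain_sum \<beta> K \<omega> \<partial>\<gamma>) \<le> ennreal (D / m ^ 4)"
proof -
  obtain C where C: "0 < C"
    "\<And>m n j. 0 < m \<Longrightarrow> j < 2 ^ Suc n \<Longrightarrow> 0 \<le> loop_covariance \<beta> m (haar \<beta> n j)"
    "\<And>m n j. 0 < m \<Longrightarrow> j < 2 ^ Suc n \<Longrightarrow> loop_covariance \<beta> m (haar \<beta> n j) \<le> C / m * sqrt (1 / 2) ^ n"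
    using loop_covariance_haar_bound[OF \<beta>] by metis
  \<comment> \<open>The decay of the variance per level, corrected by the squared ratio of the
    weights. That it is at most 1 makes the exponent condition uniform in the level;
    \<open>2 * \<rho>^4 \<le> 9 / 10\<close> makes the level sums summable.\<close>
  define \<rho> :: real where "\<rho> = sqrt (1 / 2) * (16 / 15)\<^sup>2"
  have "sqrt (1 / 2) \<le> (71 / 100 :: real)"
    by (rule real_le_lsqrt) (auto simp: power2_eq_square)
  then have \<rho>: "0 \<le> \<rho>" "\<rho> \<le> 1" by (auto simp: \<rho>_def power2_eq_square)
  have "sqrt (1 / 2 :: real) ^ 4 = 1 / 4"
    by (simp add: power4_eq_xxxx)
  then have \<rho>4: "2 * \<rho> ^ 4 \<le> 9 / 10"
    by (simp add: \<rho>_def power_mult_distrib power_mult[symmetric] power_divide)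
  define B where "B = 2097152 * (256 * C) ^ 4 * 2"
  show ?thesis
  proof
    show "0 \<le> B * 10" using C(1) by (simp add: B_def)
    \<comment> \<open>The threshold is fixed here: 256 is the inverse square of the weight at level
      0, and 1024 = 4 * 256 brings \<open>K\<close> times the relative variance down to 1/4.\<close>
    fix m \<gamma> assume m0: "1024 * K * C \<le> m" and m: "0 < m" and \<gamma>: "is_gaussian_loop_measure \<beta> m \<gamma>"
    have each: "(\<integral>\<^sup>+ \<omega>. ennreal (chain_term \<beta> n j \<omega> ^ 4 * exp (K * chain_term \<beta> n j \<omega>)) \<partial>\<gamma>)
       \<le> ennreal (2097152 * (256 * C / m) ^ 4 * (\<rho> ^ 4) ^ n)" if j: "j < 2 ^ Suc n" for n j
    proof -
      let ?v = "loop_covariance \<beta> m (haar \<beta> n j)" and ?\<theta> = "chain_weight n"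
      note law = dyadic_increment_law[OF \<gamma> \<beta> j]
      have "?v / ?\<theta>\<^sup>2 \<le> C / m * sqrt (1 / 2) ^ n / ?\<theta>\<^sup>2"
        using C(3)[OF m j] by (rule divide_right_mono) simp
      also have "\<dots> = 256 * C / m * \<rho> ^ n"
        by (simp add: chain_weight_def \<rho>_def power_mult_distrib power_divide field_simps power_mult[symmetric])
          (simp add: power_mult mult.commute[of n])
      finally have v: "?v / ?\<theta>\<^sup>2 \<le> 256 * C / m * \<rho> ^ n" .
      also have "\<dots> \<le> 256 * C / m * 1"
        using C(1) m \<rho> by (intro mult_left_mono power_le_one) auto
      finally have "K * (?v / ?\<theta>\<^sup>2) \<le> K * (256 * C / m)"
        using K unfolding mult_1_right by (rule mult_left_mono)
      also have "\<dots> \<le> 1 / 4" using m0 m by (simp add: field_simps)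
      finally have K4: "K * (?v / ?\<theta>\<^sup>2) \<le> 1 / 4" .
      have "(\<integral>\<^sup>+ \<omega>. ennreal (chain_term \<beta> n j \<omega> ^ 4 * exp (K * chain_term \<beta> n j \<omega>)) \<partial>\<gamma>)
        = (\<integral>\<^sup>+ x. ennreal (((x / ?\<theta>)\<^sup>2) ^ 4 * exp (K * (x / ?\<theta>)\<^sup>2)) \<partial>distr \<gamma> borel (dyadic_increment \<beta> n j))"
        unfolding chain_term_def using law(1) by (subst nn_integral_distr) auto
      also have "\<dots> \<le> ennreal (2097152 * (?v / ?\<theta>\<^sup>2) ^ 4)"
        unfolding law(2) by (rule exp_moment_centered_normal[OF C(2)[OF m j] chain_weight_pos K K4])
      also have "\<dots> \<le> ennreal (2097152 * (256 * C / m * \<rho> ^ n) ^ 4)"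
        using v C(2)[OF m j] by (intro ennreal_leI mult_left_mono power_mono) auto
      also have "(256 * C / m * \<rho> ^ n) ^ 4 = (256 * C / m) ^ 4 * (\<rho> ^ 4) ^ n"
        by (simp only: power_mult_distrib power_mult[symmetric] mult.commute[of n])
      finally show ?thesis by (simp add: mult.assoc)
    qed
    have meas: "(\<lambda>\<omega>. ennreal (chain_term \<beta> n j \<omega> ^ 4 * exp (K * chain_term \<beta> n j \<omega>))) \<in> borel_measurable \<gamma>"
      if "j < 2 ^ Suc n" for n j
      unfolding chain_term_def using dyadic_increment_law(1)[OF \<gamma> \<beta> that] by measurable
    have "(\<integral>\<^sup>+ \<omega>. chain_sum \<beta> K \<omega> \<partial>\<gamma>) =
        (\<Sum>n. \<Sum>j<2 ^ Suc n. \<integral>\<^sup>+ \<omega>. ennreal (chain_term \<beta> n j \<omega> ^ 4 * exp (K * chain_term \<beta> n j \<omega>)) \<partial>\<gamma>)"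
      unfolding chain_sum_def
      using meas by (subst nn_integral_suminf; (subst nn_integral_sum)?; (intro borel_measurable_sum)?) auto
    also have "\<dots> \<le> (\<Sum>n. ennreal (B / m ^ 4 * (9 / 10) ^ n))"
    proof (rule suminf_le)
      fix n
      have "(\<Sum>j<2 ^ Suc n. \<integral>\<^sup>+ \<omega>. ennreal (chain_term \<beta> n j \<omega> ^ 4 * exp (K * chain_term \<beta> n j \<omega>)) \<partial>\<gamma>)
        \<le> (\<Sum>j<(2::nat) ^ Suc n. ennreal (2097152 * (256 * C / m) ^ 4 * (\<rho> ^ 4) ^ n))"
        by (intro sum_mono each) simp
      also have "\<dots> = ennreal (\<Sum>j<(2::nat) ^ Suc n. 2097152 * (256 * C / m) ^ 4 * (\<rho> ^ 4) ^ n)"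
        using C(1) m \<rho> by (intro sum_ennreal) simp
      also have "(\<Sum>j<(2::nat) ^ Suc n. 2097152 * (256 * C / m) ^ 4 * (\<rho> ^ 4) ^ n) = B / m ^ 4 * (2 * \<rho> ^ 4) ^ n"
        by (simp add: B_def power_mult_distrib power_divide field_simps)
      also have "ennreal (B / m ^ 4 * (2 * \<rho> ^ 4) ^ n) \<le> ennreal (B / m ^ 4 * (9 / 10) ^ n)"
        using C(1) m \<rho> \<rho>4 by (intro ennreal_leI mult_left_mono power_mono) (auto simp: B_def)
      finally show "(\<Sum>j<2 ^ Suc n. \<integral>\<^sup>+ \<omega>. ennreal (chain_term \<beta> n j \<omega> ^ 4 * exp (K * chain_term \<beta> n j \<omega>)) \<partial>\<gamma>)
          \<le> ennreal (B / m ^ 4 * (9 / 10) ^ n)" .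
    qed auto
    also have "\<dots> = ennreal (\<Sum>n. B / m ^ 4 * (9 / 10) ^ n)"
      using C(1) m by (intro suminf_ennreal2 summable_mult summable_geometric) (auto simp: B_def)
    also have "(\<Sum>n. B / m ^ 4 * (9 / 10) ^ n) = B * 10 / m ^ 4"
      by (subst suminf_mult) (auto simp: suminf_geometric)
    finally show "(\<integral>\<^sup>+ \<omega>. chain_sum \<beta> K \<omega> \<partial>\<gamma>) \<le> ennreal (B * 10 / m ^ 4)" .
  qed
qed

text \<open>Along the dyadic intervals that contain \<open>t\<close> the averages lead from the
  overall mean to \<open>\<omega> t\<close>, and the step of level \<open>n\<close> is at most
  \<open>chain_weight n * sqrt M\<close>.\<close>

lemma chaining:
  assumes \<beta>: "0 < \<beta>" and \<omega>: "\<omega> \<in> mspace (loop_space \<beta>)" and M: "0 \<le> M"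
    and le: "\<And>n j. j < 2 ^ Suc n \<Longrightarrow> chain_term \<beta> n j \<omega> \<le> M" and t: "t \<in> {0..\<beta>}"
  shows "(\<omega> t - dyadic_mean \<beta> 0 0 \<omega>)\<^sup>2 \<le> M"
proof -
  have cont: "continuous_on {0..\<beta>} \<omega>" and per: "\<omega> 0 = \<omega> \<beta>" using \<omega> by (auto simp: mem_loop_space_iff)
  \<comment> \<open>The strict bound \<open>t < \<beta>\<close> keeps the interval number below
    \<open>2 ^ n\<close>; the endpoint is recovered from \<open>t = 0\<close> by
    periodicity.\<close>
  have main: "(\<omega> t - dyadic_mean \<beta> 0 0 \<omega>)\<^sup>2 \<le> M" if t: "0 \<le> t" "t < \<beta>" for t
  proof -
    define k where "k n = nat \<lfloor>2 ^ n * t / \<beta>\<rfloor>" for n :: nat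
    have rk: "real (k n) \<le> 2 ^ n * t / \<beta>" "2 ^ n * t / \<beta> < real (Suc (k n))" for n
    proof -
      have "0 \<le> 2 ^ n * t / \<beta>" using t \<beta> by simp
      then show "real (k n) \<le> 2 ^ n * t / \<beta>" "2 ^ n * t / \<beta> < real (Suc (k n))"
        unfolding k_def by linarith+
    qed
    have k2: "k n < 2 ^ n" for n
    proof -
      have "2 ^ n * t / \<beta> < 2 ^ n" using t \<beta> by (simp add: field_simps)
      with rk(1)[of n] have "real (k n) < 2 ^ n" by (rule le_less_trans)
      also have "2 ^ n = real (2 ^ n)" by simp
      finally show ?thesis by (simp only: of_nat_less_iff)
    qed
    \<comment> \<open>The chosen intervals are nested: halving the floor of \<open>2 * u\<close>
      gives the floor of \<open>u\<close>.\<close>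
    have kd: "k n = k (Suc n) div 2" for n
    proof -
      define u where "u = 2 ^ n * t / \<beta>"
      have "2 ^ Suc n * t / \<beta> = 2 * u" by (simp add: u_def)
      then have u: "real (k n) \<le> u" "u < real (Suc (k n))" "real (k (Suc n)) \<le> 2 * u" "2 * u < real (Suc (k (Suc n)))"
        using rk[of n] rk[of "Suc n"] by (simp_all only: u_def)
      have "real (2 * k n) < real (Suc (k (Suc n)))" "real (k (Suc n)) < real (2 * Suc (k n))"
        using u by simp_all
      then have "2 * k n < Suc (k (Suc n))" "k (Suc n) < 2 * Suc (k n)"
        by (simp_all only: of_nat_less_iff)
      then show ?thesis by presburger
    qed
    have kt: "t \<in> dyadic \<beta> n (k n)" for n
      using rk[of n] \<beta> by (simp add: dyadic_def field_simps)
    have lim: "(\<lambda>n. dyadic_mean \<beta> n (k n) \<omega>) \<longlonglongrightarrow> \<omega> t"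
      using dyadic_mean_tendsto[OF \<beta> cont _ k2 kt] t by simp
    have k0: "k 0 = 0" using k2[of 0] by simp
    have "\<bar>dyadic_mean \<beta> N (k N) \<omega> - dyadic_mean \<beta> 0 0 \<omega>\<bar> \<le> (\<Sum>n<N. chain_weight n) * sqrt M" for N
    proof (induction N)
      case (Suc N)
      have "chain_term \<beta> N (k (Suc N)) \<omega> \<le> M" using le[OF k2] .
      then have "\<bar>dyadic_increment \<beta> N (k (Suc N)) \<omega> / chain_weight N\<bar> \<le> sqrt M"
        unfolding chain_term_def by (intro real_le_rsqrt) (simp only: power2_abs)
      then have "\<bar>dyadic_increment \<beta> N (k (Suc N)) \<omega>\<bar> \<le> chain_weight N * sqrt M"
        using chain_weight_pos[of N] by (simp add: field_simps)
      then show ?case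
        using Suc.IH kd[of N] by (simp add: dyadic_increment_def distrib_right)
    qed (simp add: k0)
    moreover have "(\<Sum>n<N. chain_weight n) * sqrt M \<le> 1 * sqrt M" for N
      using M by (intro mult_right_mono sum_chain_weight_le) simp
    ultimately have "\<bar>dyadic_mean \<beta> N (k N) \<omega> - dyadic_mean \<beta> 0 0 \<omega>\<bar> \<le> sqrt M" for N
      by (metis mult_1 order_trans)
    moreover have "(\<lambda>n. \<bar>dyadic_mean \<beta> n (k n) \<omega> - dyadic_mean \<beta> 0 0 \<omega>\<bar>) \<longlonglongrightarrow> \<bar>\<omega> t - dyadic_mean \<beta> 0 0 \<omega>\<bar>"
      using lim by (intro tendsto_intros)
    ultimately have "\<bar>\<omega> t - dyadic_mean \<beta> 0 0 \<omega>\<bar> \<le> sqrt M"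
      by (intro LIMSEQ_le_const2) auto
    then show ?thesis using M by (metis abs_le_square_iff abs_of_nonneg real_sqrt_ge_zero real_sqrt_pow2)
  qed
  show ?thesis
  proof (cases "t = \<beta>")
    case True
    then show ?thesis using main[of 0] \<beta> per by simp
  qed (use t main in auto)
qed

lemma chain_term_le_chain_sum:
  assumes "j < 2 ^ Suc n"
  shows "ennreal (chain_term \<beta> n j \<omega> ^ 4 * exp (K * chain_term \<beta> n j \<omega>)) \<le> chain_sum \<beta> K \<omega>"
proof -
  have "ennreal (chain_term \<beta> n j \<omega> ^ 4 * exp (K * chain_term \<beta> n j \<omega>))
      \<le> (\<Sum>j<2 ^ Suc n. ennreal (chain_term \<beta> n j \<omega> ^ 4 * exp (K * chain_term \<beta> n j \<omega>)))"
    using assms by (intro member_le_sum) auto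
  also have "\<dots> \<le> chain_sum \<beta> K \<omega>"
    unfolding chain_sum_def
    using sum_le_suminf[OF summableI, of "{n}" "\<lambda>n. \<Sum>j<2 ^ Suc n. ennreal (chain_term \<beta> n j \<omega> ^ 4 * exp (K * chain_term \<beta> n j \<omega>))"]
    by simp
  finally show ?thesis .
qed

text \<open>The exponential factor is at least 1, so every term satisfies
  \<open>y^4 \<le> \<epsilon>^8\<close>. The exponent 8 is the 4 of \<open>chain_sum\<close> times
  the 2 of the square in \<open>chain_term\<close>.\<close>

lemma deviation_le:
  assumes \<beta>: "0 < \<beta>" and K: "0 \<le> K" and \<omega>: "\<omega> \<in> mspace (loop_space \<beta>)" and t: "t \<in> {0..\<beta>}"
    and \<epsilon>: "0 \<le> \<epsilon>" and S: "chain_sum \<beta> K \<omega> \<le> ennreal (\<epsilon> ^ 8)"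
  shows "\<bar>\<omega> t - dyadic_mean \<beta> 0 0 \<omega>\<bar> \<le> \<epsilon>"
proof -
  have "chain_term \<beta> n j \<omega> \<le> \<epsilon>\<^sup>2" if j: "j < 2 ^ Suc n" for n j
  proof -
    let ?y = "chain_term \<beta> n j \<omega>"
    have "ennreal (?y ^ 4 * exp (K * ?y)) \<le> ennreal (\<epsilon> ^ 8)"
      using chain_term_le_chain_sum[OF j] S by (rule order_trans)
    then have "?y ^ 4 * exp (K * ?y) \<le> \<epsilon> ^ 8" using \<epsilon> by simp
    moreover have "?y ^ 4 * 1 \<le> ?y ^ 4 * exp (K * ?y)"
      using K chain_term_nonneg by (intro mult_left_mono) auto
    ultimately have "?y ^ 4 \<le> (\<epsilon>\<^sup>2) ^ 4" by (simp add: power_mult[symmetric])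
    \<comment> \<open>The rule speaks of \<open>Suc n\<close>, so \<open>n = 3\<close> stands for
      the fourth power.\<close>
    then show ?thesis by (rule power_le_imp_le_base[where n=3, simplified numeral_eq_Suc, simplified]) simp
  qed
  from chaining[OF \<beta> \<omega> _ this t] have "(\<omega> t - dyadic_mean \<beta> 0 0 \<omega>)\<^sup>2 \<le> \<epsilon>\<^sup>2" by simp
  then show ?thesis using \<epsilon> by (simp add: abs_le_square_iff[symmetric])
qed

text \<open>A term at most 1 has exponential at most \<open>exp K\<close>; for a larger one the
  fourth power exceeds 1, so its exponential is below \<open>s\<close>. Hence chaining applies with
  \<open>M = ln (exp K + s) / K\<close>.\<close>

lemma exp_deviation_le:
  assumes \<beta>: "0 < \<beta>" and K: "0 < K" and \<omega>: "\<omega> \<in> mspace (loop_space \<beta>)" and t: "t \<in> {0..\<beta>}"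
    and S: "chain_sum \<beta> K \<omega> = ennreal s" "0 \<le> s"
  shows "exp (K * (\<omega> t - dyadic_mean \<beta> 0 0 \<omega>)\<^sup>2) \<le> exp K + s"
proof -
  have pos: "1 \<le> exp K + s" using K S(2) by (simp add: add_increasing2)
  have "chain_term \<beta> n j \<omega> \<le> ln (exp K + s) / K" if j: "j < 2 ^ Suc n" for n j
  proof -
    let ?y = "chain_term \<beta> n j \<omega>"
    have "ennreal (?y ^ 4 * exp (K * ?y)) \<le> ennreal s"
      using chain_term_le_chain_sum[OF j, of \<beta> \<omega> K] S(1) by simp
    then have le: "?y ^ 4 * exp (K * ?y) \<le> s" using S(2) by simp
    have "exp (K * ?y) \<le> exp K + s"
    proof (cases "?y \<le> 1")
      case True
      then have "exp (K * ?y) \<le> exp K" using K by simp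
      then show ?thesis using S(2) by linarith
    next
      case False
      then have "1 * exp (K * ?y) \<le> ?y ^ 4 * exp (K * ?y)"
        by (intro mult_right_mono one_le_power) auto
      then have "exp (K * ?y) \<le> s" using le by linarith
      then show ?thesis using exp_ge_zero[of K] by linarith
    qed
    then have "K * ?y \<le> ln (exp K + s)" using pos by (simp add: ln_ge_iff)
    then show ?thesis using K by (simp add: field_simps)
  qed
  from chaining[OF \<beta> \<omega> _ this t] have "(\<omega> t - dyadic_mean \<beta> 0 0 \<omega>)\<^sup>2 \<le> ln (exp K + s) / K"
    using K pos by simp
  then have "K * (\<omega> t - dyadic_mean \<beta> 0 0 \<omega>)\<^sup>2 \<le> ln (exp K + s)" using K by (simp add: field_simps)
  then show ?thesis using pos by (simp add: ln_ge_iff)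
qed

subsection \<open>The energy as a time integral\<close>

lemma finite_lattice_ball: "finite {k :: int ^ 'd. lattice_dist j k \<le> r}"
proof (rule finite_imageD)
  have "vec_nth ` {k. lattice_dist j k \<le> r} \<subseteq> PiE UNIV (\<lambda>i. {j $ i - \<lceil>r\<rceil>..j $ i + \<lceil>r\<rceil>})"
  proof safe
    fix k :: "int ^ 'd" and i assume "lattice_dist j k \<le> r"
    then have "\<bar>real_of_int (j $ i - k $ i)\<bar> \<le> r"
      using component_le_norm_cart[of "\<chi> i. real_of_int (j $ i - k $ i)" i]
      by (simp add: lattice_dist_def)
    then have "\<bar>j $ i - k $ i\<bar> \<le> \<lceil>r\<rceil>" by linarith
    then show "k $ i \<in> {j $ i - \<lceil>r\<rceil>..j $ i + \<lceil>r\<rceil>}" by auto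
  qed auto
  then show "finite (vec_nth ` {k. lattice_dist j k \<le> r})"
    by (rule finite_subset) (auto intro: finite_PiE)
qed (auto simp: inj_on_def vec_eq_iff)

locale lattice_system =
  fixes J :: "int ^ 'd \<Rightarrow> int ^ 'd \<Rightarrow> real"
    and U :: "int ^ 'd \<Rightarrow> real \<Rightarrow> real"
    and r c b c' \<beta> :: real
    and \<Lambda> :: "(int ^ 'd) set"
    and y :: "int ^ 'd \<Rightarrow> real"
    and \<zeta> :: "int ^ 'd \<Rightarrow> real \<Rightarrow> real"
  assumes J_sym: "\<And>j k. J j k = J k j"
    and J_range: "\<And>j k. lattice_dist j k > r \<Longrightarrow> J j k = 0"
    and J_bdd: "bdd_above (range (\<lambda>j. \<Sum>\<^sub>\<infinity>k. \<bar>J j k\<bar>))"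
    and c_def: "c = (SUP j. \<Sum>\<^sub>\<infinity>k. \<bar>J j k\<bar>)"
    and U_cont: "\<And>k. continuous_on UNIV (U k)"
    and c'_gt: "c' > max (c - 1) 0"
    and U_lower: "\<And>k x. U k x \<ge> 1 / 2 * c' * x\<^sup>2 + b"
    and \<beta>_pos: "\<beta> > 0"
    and \<Lambda>_fin: "finite \<Lambda>"
    and \<zeta>: "\<zeta> \<in> Upsilon \<beta> y"
begin

text \<open>Finite range leaves only finitely many outside sites that interact with
  \<open>\<Lambda>\<close>; the infinite sums over \<open>- \<Lambda>\<close> reduce to finite sums
  over this set.\<close>

definition boundary :: "(int ^ 'd) set" where
  "boundary = {k \<in> - \<Lambda>. \<exists>j\<in>\<Lambda>. lattice_dist j k \<le> r}"

lemma finite_boundary: "finite boundary"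
proof -
  have "boundary \<subseteq> (\<Union>j\<in>\<Lambda>. {k. lattice_dist j k \<le> r})" by (auto simp: boundary_def)
  then show ?thesis by (rule finite_subset) (intro finite_UN_I \<Lambda>_fin finite_lattice_ball)
qed

lemma infsum_boundary:
  assumes "j \<in> \<Lambda>"
  shows "(\<Sum>\<^sub>\<infinity>k\<in>-\<Lambda>. J j k * F k) = (\<Sum>k\<in>boundary. J j k * F k)"
proof -
  have "(\<Sum>\<^sub>\<infinity>k\<in>-\<Lambda>. J j k * F k) = (\<Sum>\<^sub>\<infinity>k\<in>boundary. J j k * F k)"
  proof (rule infsum_cong_neutral)
    fix k assume "k \<in> - \<Lambda> - boundary"
    then have "\<not> lattice_dist j k \<le> r" using assms unfolding boundary_def by blast
    then have "J j k = 0" using J_range[of j k] by simp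
    then show "J j k * F k = 0" by simp
  qed (auto simp: boundary_def)
  then show ?thesis using finite_boundary by simp
qed

text \<open>An \<open>infsum\<close> without summability is 0 by convention, so the comparison with
  \<open>c\<close> rests on summability of the row, which finite range supplies.\<close>

lemma sum_abs_J_le: "(\<Sum>k\<in>\<Lambda>. \<bar>J j k\<bar>) \<le> c"
proof -
  have "(\<lambda>k. \<bar>J j k\<bar>) summable_on {k. lattice_dist j k \<le> r}"
    using finite_lattice_ball by (rule summable_on_finite)
  moreover have "(\<lambda>k. \<bar>J j k\<bar>) summable_on {k. lattice_dist j k \<le> r} \<longleftrightarrow> (\<lambda>k. \<bar>J j k\<bar>) summable_on UNIV"
    by (rule summable_on_cong_neutral) (auto simp: J_range)
  ultimately have "(\<lambda>k. \<bar>J j k\<bar>) summable_on UNIV" by simp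
  then have "(\<Sum>k\<in>\<Lambda>. \<bar>J j k\<bar>) \<le> (\<Sum>\<^sub>\<infinity>k. \<bar>J j k\<bar>)"
    by (rule finite_sum_le_infsum) (use \<Lambda>_fin in auto)
  also have "\<dots> \<le> c" unfolding c_def by (rule cSUP_upper[OF _ J_bdd]) simp
  finally show ?thesis .
qed

definition external_field :: "int ^ 'd \<Rightarrow> real \<Rightarrow> real" where
  "external_field j \<tau> = (\<Sum>k\<in>boundary. J j k * \<zeta> k \<tau>)"

text \<open>For fixed \<open>z\<close> it still varies with \<open>\<tau>\<close> through the
  boundary loops; only its time average is the classical energy with boundary values
  \<open>y\<close>.\<close>

definition energy_density :: "real \<Rightarrow> (int ^ 'd \<Rightarrow> real) \<Rightarrow> real" where
  "energy_density \<tau> z = (\<Sum>j\<in>\<Lambda>. U j (z j)) + 1 / 2 * (\<Sum>j\<in>\<Lambda>. \<Sum>k\<in>\<Lambda>. J j k * (z j * z k))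
     + (\<Sum>j\<in>\<Lambda>. z j * external_field j \<tau>)"

lemma \<zeta>_loop: "\<zeta> k \<in> mspace (loop_space \<beta>)"
  using \<zeta> by (auto simp: Upsilon_def Omega_top_def)

lemma \<zeta>_cont: "continuous_on {0..\<beta>} (\<zeta> k)"
  using \<zeta>_loop by (simp add: mem_loop_space_iff)

lemma external_field_cont: "continuous_on {0..\<beta>} (external_field j)"
  unfolding external_field_def[abs_def] by (intro continuous_intros \<zeta>_cont)

lemma U_comp_cont: "continuous_on S f \<Longrightarrow> continuous_on S (\<lambda>\<tau>. U j (f \<tau>))"
  by (rule continuous_on_compose2[OF U_cont]) auto

lemma energy_density_cont:
  assumes "\<And>j. j \<in> \<Lambda> \<Longrightarrow> continuous_on {0..\<beta>} (\<omega> j)"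
  shows "continuous_on {0..\<beta>} (\<lambda>\<tau>. energy_density \<tau> (\<lambda>j. \<omega> j \<tau>))"
  unfolding energy_density_def by (intro continuous_intros U_comp_cont external_field_cont assms)

text \<open>Continuity is assumed rather than membership in the loop space because the identity is
  also applied to constant functions on the whole line, which need not be extensional.\<close>

lemma quantum_energy_eq:
  assumes cont: "\<And>j. j \<in> \<Lambda> \<Longrightarrow> continuous_on {0..\<beta>} (\<omega> j)"
  shows "quantum_energy J U \<beta> \<Lambda> \<omega> \<zeta> = (LBINT \<tau>:{0..\<beta>}. energy_density \<tau> (\<lambda>j. \<omega> j \<tau>))"
proof -
  note int = integrable_continuous_real
  have 1: "(LBINT \<tau>:{0..\<beta>}. U j (\<omega> j \<tau>)) = integral {0..\<beta>} (\<lambda>\<tau>. U j (\<omega> j \<tau>))" if "j \<in> \<Lambda>" for j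
    by (intro LBINT_eq_integral U_comp_cont cont that)
  have 2: "(LBINT \<tau>:{0..\<beta>}. \<omega> j \<tau> * \<omega> k \<tau>) = integral {0..\<beta>} (\<lambda>\<tau>. \<omega> j \<tau> * \<omega> k \<tau>)" if "j \<in> \<Lambda>" "k \<in> \<Lambda>" for j k
    by (intro LBINT_eq_integral continuous_intros cont that)
  have 3: "(\<Sum>\<^sub>\<infinity>k\<in>-\<Lambda>. J j k * (LBINT \<tau>:{0..\<beta>}. \<omega> j \<tau> * \<zeta> k \<tau>))
      = integral {0..\<beta>} (\<lambda>\<tau>. \<omega> j \<tau> * external_field j \<tau>)" if j: "j \<in> \<Lambda>" for j
  proof -
    have "(\<Sum>\<^sub>\<infinity>k\<in>-\<Lambda>. J j k * (LBINT \<tau>:{0..\<beta>}. \<omega> j \<tau> * \<zeta> k \<tau>))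
        = (\<Sum>k\<in>boundary. J j k * integral {0..\<beta>} (\<lambda>\<tau>. \<omega> j \<tau> * \<zeta> k \<tau>))"
      unfolding infsum_boundary[OF j]
      by (intro sum.cong arg_cong2[where f="(*)"] LBINT_eq_integral continuous_intros cont j \<zeta>_cont refl)
    also have "\<dots> = integral {0..\<beta>} (\<lambda>\<tau>. \<Sum>k\<in>boundary. J j k * (\<omega> j \<tau> * \<zeta> k \<tau>))"
      by (subst integral_sum) (auto intro!: finite_boundary int continuous_intros cont j \<zeta>_cont)
    also have "(\<lambda>\<tau>. \<Sum>k\<in>boundary. J j k * (\<omega> j \<tau> * \<zeta> k \<tau>)) = (\<lambda>\<tau>. \<omega> j \<tau> * external_field j \<tau>)"
      by (simp add: external_field_def sum_distrib_left algebra_simps)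
    finally show ?thesis .
  qed
  have "((\<lambda>\<tau>. energy_density \<tau> (\<lambda>j. \<omega> j \<tau>)) has_integral
      (\<Sum>j\<in>\<Lambda>. integral {0..\<beta>} (\<lambda>\<tau>. U j (\<omega> j \<tau>)))
      + 1 / 2 * (\<Sum>j\<in>\<Lambda>. \<Sum>k\<in>\<Lambda>. J j k * integral {0..\<beta>} (\<lambda>\<tau>. \<omega> j \<tau> * \<omega> k \<tau>))
      + (\<Sum>j\<in>\<Lambda>. integral {0..\<beta>} (\<lambda>\<tau>. \<omega> j \<tau> * external_field j \<tau>))) {0..\<beta>}"
    unfolding energy_density_def
    by (intro has_integral_add has_integral_sum has_integral_mult_right \<Lambda>_fin integrable_integral
        int U_comp_cont continuous_on_mult external_field_cont cont)
  then have "(LBINT \<tau>:{0..\<beta>}. energy_density \<tau> (\<lambda>j. \<omega> j \<tau>)) =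
      (\<Sum>j\<in>\<Lambda>. integral {0..\<beta>} (\<lambda>\<tau>. U j (\<omega> j \<tau>)))
      + 1 / 2 * (\<Sum>j\<in>\<Lambda>. \<Sum>k\<in>\<Lambda>. J j k * integral {0..\<beta>} (\<lambda>\<tau>. \<omega> j \<tau> * \<omega> k \<tau>))
      + (\<Sum>j\<in>\<Lambda>. integral {0..\<beta>} (\<lambda>\<tau>. \<omega> j \<tau> * external_field j \<tau>))"
    by (simp only: LBINT_eq_integral[OF energy_density_cont[OF cont]] integral_unique)
  then show ?thesis
    unfolding quantum_energy_def using 1 2 3 by (simp cong: sum.cong)
qed

text \<open>Against a constant configuration the boundary loops count only through their time
  averages, and these are \<open>y\<close> because \<open>\<zeta>\<close> lies in
  \<open>Upsilon \<beta> y\<close>.\<close>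

lemma quantum_energy_const:
  "quantum_energy J U \<beta> \<Lambda> (\<lambda>j \<tau>. x j) \<zeta> = \<beta> * classical_energy J U \<Lambda> x y"
proof -
  have C: "(LBINT \<tau>:{0..\<beta>}. a) = \<beta> * a" for a :: real
    using LBINT_eq_integral[of 0 \<beta> "\<lambda>_. a"] \<beta>_pos by simp
  have Z: "(LBINT \<tau>:{0..\<beta>}. a * \<zeta> k \<tau>) = \<beta> * (a * y k)" for a k
  proof -
    have "1 / \<beta> * (LBINT \<tau>:{0..\<beta>}. \<zeta> k \<tau>) = y k" using \<zeta> by (simp add: Upsilon_def)
    then have "(LBINT \<tau>:{0..\<beta>}. \<zeta> k \<tau>) = \<beta> * y k" using \<beta>_pos by (simp add: field_simps)
    then show ?thesis by simp
  qed
  have I: "(\<Sum>\<^sub>\<infinity>k\<in>-\<Lambda>. J j k * (\<beta> * (x j * y k))) = \<beta> * (\<Sum>\<^sub>\<infinity>k\<in>-\<Lambda>. J j k * x j * y k)" if "j \<in> \<Lambda>" for j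
    using infsum_boundary[OF that, of "\<lambda>k. \<beta> * (x j * y k)"] infsum_boundary[OF that, of "\<lambda>k. x j * y k"]
    by (simp add: mult.assoc sum_distrib_left mult.left_commute)
  have "(\<Sum>j\<in>\<Lambda>. \<Sum>\<^sub>\<infinity>k\<in>-\<Lambda>. J j k * (\<beta> * (x j * y k))) = \<beta> * (\<Sum>j\<in>\<Lambda>. \<Sum>\<^sub>\<infinity>k\<in>-\<Lambda>. J j k * x j * y k)"
    unfolding sum_distrib_left by (rule sum.cong[OF refl I])
  then show ?thesis
    unfolding quantum_energy_def classical_energy_def C Z distrib_left
    by (simp add: sum_distrib_left mult_ac)
qed

section \<open>Bounds on the energy density\<close>

lemma external_field_bounded:
  obtains B where "0 \<le> B" "\<And>j \<tau>. j \<in> \<Lambda> \<Longrightarrow> \<tau> \<in> {0..\<beta>} \<Longrightarrow> \<bar>external_field j \<tau>\<bar> \<le> B"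
proof -
  have "bounded (\<Union>j\<in>\<Lambda>. external_field j ` {0..\<beta>})"
    using \<Lambda>_fin compact_imp_bounded[OF compact_continuous_image[OF external_field_cont compact_Icc]]
    by (intro bounded_UN) auto
  then obtain B where "0 < B" "\<And>x. x \<in> (\<Union>j\<in>\<Lambda>. external_field j ` {0..\<beta>}) \<Longrightarrow> norm x \<le> B"
    unfolding bounded_pos by blast
  note B = this
  show ?thesis
  proof (rule that[of B])
    fix j \<tau> assume "j \<in> \<Lambda>" "\<tau> \<in> {0..\<beta>}"
    then have "external_field j \<tau> \<in> (\<Union>j\<in>\<Lambda>. external_field j ` {0..\<beta>})" by blast
    from B(2)[OF this] show "\<bar>external_field j \<tau>\<bar> \<le> B" by simp
  qed (use B(1) in simp)
qed

text \<open>From \<open>|z j * z k| \<le> ((z j)^2 + (z k)^2) / 2\<close>: symmetry of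
  \<open>J\<close> makes the two halves equal, and the absolute row sums are at most
  \<open>c\<close>.\<close>

lemma interaction_lower:
  "1 / 2 * (\<Sum>j\<in>\<Lambda>. \<Sum>k\<in>\<Lambda>. J j k * (z j * z k)) \<ge> - c / 2 * (\<Sum>j\<in>\<Lambda>. (z j)\<^sup>2)"
proof -
  have "- (J j k * (z j * z k)) \<le> \<bar>J j k\<bar> * ((z j)\<^sup>2 + (z k)\<^sup>2) / 2" for j k
  proof -
    have "\<bar>z j * z k\<bar> \<le> ((z j)\<^sup>2 + (z k)\<^sup>2) / 2"
      using sum_squares_bound[of "\<bar>z j\<bar>" "\<bar>z k\<bar>"] by (simp add: abs_mult)
    then have "\<bar>J j k\<bar> * \<bar>z j * z k\<bar> \<le> \<bar>J j k\<bar> * (((z j)\<^sup>2 + (z k)\<^sup>2) / 2)"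
      by (rule mult_left_mono) simp
    moreover have "- (J j k * (z j * z k)) \<le> \<bar>J j k\<bar> * \<bar>z j * z k\<bar>"
      by (metis abs_ge_minus_self abs_mult)
    ultimately show ?thesis by simp
  qed
  then have "(\<Sum>j\<in>\<Lambda>. \<Sum>k\<in>\<Lambda>. - (J j k * (z j * z k))) \<le> (\<Sum>j\<in>\<Lambda>. \<Sum>k\<in>\<Lambda>. \<bar>J j k\<bar> * ((z j)\<^sup>2 + (z k)\<^sup>2) / 2)"
    by (intro sum_mono)
  also have "\<dots> = (\<Sum>j\<in>\<Lambda>. \<Sum>k\<in>\<Lambda>. \<bar>J j k\<bar> * (z j)\<^sup>2 / 2) + (\<Sum>j\<in>\<Lambda>. \<Sum>k\<in>\<Lambda>. \<bar>J j k\<bar> * (z k)\<^sup>2 / 2)"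
    by (simp add: distrib_left add_divide_distrib sum.distrib)
  also have "(\<Sum>j\<in>\<Lambda>. \<Sum>k\<in>\<Lambda>. \<bar>J j k\<bar> * (z k)\<^sup>2 / 2) = (\<Sum>j\<in>\<Lambda>. \<Sum>k\<in>\<Lambda>. \<bar>J j k\<bar> * (z j)\<^sup>2 / 2)"
    by (subst sum.swap) (simp add: J_sym)
  also have "(\<Sum>j\<in>\<Lambda>. \<Sum>k\<in>\<Lambda>. \<bar>J j k\<bar> * (z j)\<^sup>2 / 2) + (\<Sum>j\<in>\<Lambda>. \<Sum>k\<in>\<Lambda>. \<bar>J j k\<bar> * (z j)\<^sup>2 / 2)
      = (\<Sum>j\<in>\<Lambda>. (\<Sum>k\<in>\<Lambda>. \<bar>J j k\<bar>) * (z j)\<^sup>2)"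
    by (simp add: sum.distrib[symmetric] sum_distrib_right)
  also have "\<dots> \<le> (\<Sum>j\<in>\<Lambda>. c * (z j)\<^sup>2)"
    by (intro sum_mono mult_right_mono sum_abs_J_le) simp
  finally show ?thesis by (simp add: sum_negf sum_distrib_left[symmetric])
qed

text \<open>Potentials and interaction leave the coefficient \<open>- (c - c') / 2\<close>, where
  \<open>c - c' < 1\<close>. Completing a square absorbs the linear coupling to the boundary at the
  cost of \<open>\<delta>\<close>, half of the distance to 1. The maximum with 0 keeps
  \<open>a\<close> positive, as the later choice of \<open>p\<close> divides by it.\<close>

lemma energy_density_lower:
  obtains a C where "0 < a" "a < 1"
    "\<And>\<tau> z. \<tau> \<in> {0..\<beta>} \<Longrightarrow> energy_density \<tau> z \<ge> - C - a / 2 * (\<Sum>j\<in>\<Lambda>. (z j)\<^sup>2)"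
proof -
  obtain B where B: "0 \<le> B" "\<And>j \<tau>. j \<in> \<Lambda> \<Longrightarrow> \<tau> \<in> {0..\<beta>} \<Longrightarrow> \<bar>external_field j \<tau>\<bar> \<le> B"
    using external_field_bounded by metis
  define \<delta> where "\<delta> = (1 - max 0 (c - c')) / 2"
  have max: "0 \<le> max 0 (c - c')" "max 0 (c - c') < 1" using c'_gt by auto
  have \<delta>: "0 < \<delta>" using max by (simp add: \<delta>_def)
  define C where "C = (\<Sum>j\<in>\<Lambda>. B\<^sup>2 / (2 * \<delta>) - b)"
  show ?thesis
  proof
    show "0 < max 0 (c - c') + \<delta>" "max 0 (c - c') + \<delta> < 1" using \<delta> max unfolding \<delta>_def by argo+
    fix \<tau> z assume \<tau>: "\<tau> \<in> {0..\<beta>}"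
    have lin: "z j * external_field j \<tau> \<ge> - (\<delta> / 2) * (z j)\<^sup>2 - B\<^sup>2 / (2 * \<delta>)" if j: "j \<in> \<Lambda>" for j
    proof -
      have "0 \<le> (\<delta> * z j + external_field j \<tau>)\<^sup>2 / (2 * \<delta>)" using \<delta> by simp
      also have "\<dots> = \<delta> / 2 * (z j)\<^sup>2 + z j * external_field j \<tau> + (external_field j \<tau>)\<^sup>2 / (2 * \<delta>)"
        using \<delta> by (simp add: field_simps power2_eq_square)
      also have "(external_field j \<tau>)\<^sup>2 / (2 * \<delta>) \<le> B\<^sup>2 / (2 * \<delta>)"
        using B(1) B(2)[OF j \<tau>] \<delta> by (intro divide_right_mono) (auto simp: abs_le_square_iff[symmetric])
      finally show ?thesis by simp
    qed
    let ?S = "\<Sum>j\<in>\<Lambda>. (z j)\<^sup>2"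
    have S0: "0 \<le> ?S" by (simp add: sum_nonneg)
    have "energy_density \<tau> z \<ge> (\<Sum>j\<in>\<Lambda>. 1 / 2 * c' * (z j)\<^sup>2 + b) + (- c / 2 * ?S)
        + (\<Sum>j\<in>\<Lambda>. - (\<delta> / 2) * (z j)\<^sup>2 - B\<^sup>2 / (2 * \<delta>))"
      unfolding energy_density_def
      by (intro add_mono sum_mono U_lower interaction_lower lin)
    also have "(\<Sum>j\<in>\<Lambda>. 1 / 2 * c' * (z j)\<^sup>2 + b) + (- c / 2 * ?S)
        + (\<Sum>j\<in>\<Lambda>. - (\<delta> / 2) * (z j)\<^sup>2 - B\<^sup>2 / (2 * \<delta>)) = - C - ((c - c') + \<delta>) / 2 * ?S"
      by (simp only: C_def sum.distrib sum_subtractf sum_distrib_left[symmetric]) (simp add: field_simps)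
    finally have "energy_density \<tau> z \<ge> - C - ((c - c') + \<delta>) / 2 * ?S" .
    moreover have "((c - c') + \<delta>) / 2 * ?S \<le> (max 0 (c - c') + \<delta>) / 2 * ?S"
      by (intro mult_right_mono[OF _ S0] divide_right_mono add_right_mono max.cobounded2) simp
    ultimately show "energy_density \<tau> z \<ge> - C - (max 0 (c - c') + \<delta>) / 2 * ?S" by linarith
  qed
qed

text \<open>The potentials are merely continuous, so they are compared on the interval of radius
  \<open>|R| + 1\<close>, where they are uniformly continuous; \<open>\<epsilon> \<le> 1\<close>
  keeps \<open>z\<close> inside. The interaction and the boundary coupling change by at most
  \<open>\<epsilon> * A\<close>.\<close>

lemma energy_density_modulus:
  assumes "0 < e"
  obtains \<epsilon> where "0 < \<epsilon>"
    "\<And>\<tau> x z. \<tau> \<in> {0..\<beta>} \<Longrightarrow> (\<And>j. j \<in> \<Lambda> \<Longrightarrow> \<bar>x j\<bar> \<le> R) \<Longrightarrow> (\<And>j. j \<in> \<Lambda> \<Longrightarrow> \<bar>z j - x j\<bar> \<le> \<epsilon>) \<Longrightarrow>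
       \<bar>energy_density \<tau> z - energy_density \<tau> x\<bar> \<le> e"
proof -
  obtain B where B: "0 \<le> B" "\<And>j \<tau>. j \<in> \<Lambda> \<Longrightarrow> \<tau> \<in> {0..\<beta>} \<Longrightarrow> \<bar>external_field j \<tau>\<bar> \<le> B"
    using external_field_bounded by metis
  \<comment> \<open>Adding 1 to \<open>card \<Lambda>\<close>, and to \<open>A\<close> further down,
    avoids division by zero for an empty \<open>\<Lambda>\<close> or a vanishing
    interaction.\<close>
  define e1 where "e1 = e / (2 * (real (card \<Lambda>) + 1))"
  have e1: "0 < e1" using assms by (simp add: e1_def)
  define A where "A = 1 / 2 * (\<Sum>j\<in>\<Lambda>. \<Sum>k\<in>\<Lambda>. \<bar>J j k\<bar> * (2 * \<bar>R\<bar> + 1)) + real (card \<Lambda>) * B"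
  have A: "0 \<le> A" using B by (simp add: A_def sum_nonneg)
  have "\<exists>d>0. \<forall>x z. \<bar>x\<bar> \<le> R \<and> \<bar>z - x\<bar> \<le> d \<longrightarrow> \<bar>U j z - U j x\<bar> \<le> e1" for j
  proof -
    have "uniformly_continuous_on {-\<bar>R\<bar>-1..\<bar>R\<bar>+1} (U j)"
      by (intro compact_uniformly_continuous continuous_on_subset[OF U_cont] compact_Icc) auto
    then obtain d where d: "0 < d"
      "\<And>x z. x \<in> {-\<bar>R\<bar>-1..\<bar>R\<bar>+1} \<Longrightarrow> z \<in> {-\<bar>R\<bar>-1..\<bar>R\<bar>+1} \<Longrightarrow> dist z x < d \<Longrightarrow> dist (U j z) (U j x) < e1"
      using e1 unfolding uniformly_continuous_on_def by metis
    have "\<bar>U j z - U j x\<bar> \<le> e1" if "\<bar>x\<bar> \<le> R" "\<bar>z - x\<bar> \<le> min 1 (d / 2)" for x z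
    proof -
      have "x \<in> {-\<bar>R\<bar>-1..\<bar>R\<bar>+1}" "z \<in> {-\<bar>R\<bar>-1..\<bar>R\<bar>+1}" "dist z x < d"
        using that d(1) by (auto simp: dist_real_def)
      from d(2)[OF this] show ?thesis by (simp add: dist_real_def)
    qed
    then show ?thesis using d(1) by (intro exI[of _ "min 1 (d / 2)"]) auto
  qed
  then obtain d where d: "\<And>j. 0 < d j"
    "\<And>j x z. \<bar>x\<bar> \<le> R \<Longrightarrow> \<bar>z - x\<bar> \<le> d j \<Longrightarrow> \<bar>U j z - U j x\<bar> \<le> e1" by metis
  define \<epsilon> where "\<epsilon> = Min (insert 1 (insert (e / (2 * (A + 1))) (d ` \<Lambda>)))"
  have \<epsilon>: "0 < \<epsilon>" unfolding \<epsilon>_def using d(1) assms A \<Lambda>_fin by (subst Min_gr_iff) auto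
  have \<epsilon>1: "\<epsilon> \<le> 1" "\<epsilon> \<le> e / (2 * (A + 1))" and \<epsilon>d: "\<And>j. j \<in> \<Lambda> \<Longrightarrow> \<epsilon> \<le> d j"
    unfolding \<epsilon>_def using \<Lambda>_fin by (intro Min_le; simp)+
  show ?thesis
  proof
    show "0 < \<epsilon>" by fact
    fix \<tau> x z assume \<tau>: "\<tau> \<in> {0..\<beta>}" and x: "\<And>j. j \<in> \<Lambda> \<Longrightarrow> \<bar>x j\<bar> \<le> R"
      and z: "\<And>j. j \<in> \<Lambda> \<Longrightarrow> \<bar>z j - x j\<bar> \<le> \<epsilon>"
    have 1: "\<bar>U j (z j) - U j (x j)\<bar> \<le> e1" if "j \<in> \<Lambda>" for j
      by (rule d(2)[OF x[OF that] order_trans[OF z[OF that] \<epsilon>d[OF that]]])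
    have 2: "\<bar>J j k * (z j * z k) - J j k * (x j * x k)\<bar> \<le> \<bar>J j k\<bar> * (2 * \<bar>R\<bar> + 1) * \<epsilon>"
      if "j \<in> \<Lambda>" "k \<in> \<Lambda>" for j k
    proof -
      have "z j * z k - x j * x k = (z j - x j) * z k + x j * (z k - x k)" by (simp add: algebra_simps)
      then have "\<bar>z j * z k - x j * x k\<bar> \<le> \<bar>z j - x j\<bar> * \<bar>z k\<bar> + \<bar>x j\<bar> * \<bar>z k - x k\<bar>"
        using abs_triangle_ineq[of "(z j - x j) * z k" "x j * (z k - x k)"] by (simp only: abs_mult)
      also have "\<dots> \<le> \<epsilon> * (\<bar>R\<bar> + 1) + \<bar>R\<bar> * \<epsilon>"
      proof (intro add_mono mult_mono z that)
        show "\<bar>z k\<bar> \<le> \<bar>R\<bar> + 1" using x[OF that(2)] z[OF that(2)] \<epsilon>1(1) by linarith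
        show "\<bar>x j\<bar> \<le> \<bar>R\<bar>" using x[OF that(1)] by linarith
      qed (use \<epsilon> in simp_all)
      finally have "\<bar>z j * z k - x j * x k\<bar> \<le> (2 * \<bar>R\<bar> + 1) * \<epsilon>" by (simp add: algebra_simps)
      then show ?thesis
        unfolding right_diff_distrib[symmetric] abs_mult mult.assoc by (rule mult_left_mono) simp
    qed
    have 3: "\<bar>z j * external_field j \<tau> - x j * external_field j \<tau>\<bar> \<le> \<epsilon> * B" if "j \<in> \<Lambda>" for j
      unfolding left_diff_distrib[symmetric] abs_mult
      using z[OF that] B(2)[OF that \<tau>] \<epsilon> by (intro mult_mono) auto
    have diff: "energy_density \<tau> z - energy_density \<tau> x =
        (\<Sum>j\<in>\<Lambda>. U j (z j) - U j (x j)) + 1 / 2 * (\<Sum>j\<in>\<Lambda>. \<Sum>k\<in>\<Lambda>. J j k * (z j * z k) - J j k * (x j * x k))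
        + (\<Sum>j\<in>\<Lambda>. z j * external_field j \<tau> - x j * external_field j \<tau>)"
      by (simp only: energy_density_def sum_subtractf right_diff_distrib)
    have "\<bar>energy_density \<tau> z - energy_density \<tau> x\<bar> \<le> \<bar>\<Sum>j\<in>\<Lambda>. U j (z j) - U j (x j)\<bar>
        + 1 / 2 * \<bar>\<Sum>j\<in>\<Lambda>. \<Sum>k\<in>\<Lambda>. J j k * (z j * z k) - J j k * (x j * x k)\<bar>
        + \<bar>\<Sum>j\<in>\<Lambda>. z j * external_field j \<tau> - x j * external_field j \<tau>\<bar>"
      unfolding diff by linarith
    also have "\<dots> \<le> (\<Sum>j\<in>\<Lambda>. e1) + 1 / 2 * (\<Sum>j\<in>\<Lambda>. \<Sum>k\<in>\<Lambda>. \<bar>J j k\<bar> * (2 * \<bar>R\<bar> + 1) * \<epsilon>) + (\<Sum>j\<in>\<Lambda>. \<epsilon> * B)"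
    proof (intro add_mono mult_left_mono)
      show "\<bar>\<Sum>j\<in>\<Lambda>. U j (z j) - U j (x j)\<bar> \<le> (\<Sum>j\<in>\<Lambda>. e1)"
        by (rule order_trans[OF sum_abs sum_mono[OF 1]])
      show "\<bar>\<Sum>j\<in>\<Lambda>. \<Sum>k\<in>\<Lambda>. J j k * (z j * z k) - J j k * (x j * x k)\<bar>
          \<le> (\<Sum>j\<in>\<Lambda>. \<Sum>k\<in>\<Lambda>. \<bar>J j k\<bar> * (2 * \<bar>R\<bar> + 1) * \<epsilon>)"
        by (rule order_trans[OF sum_abs sum_mono[OF order_trans[OF sum_abs sum_mono[OF 2]]]])
      show "\<bar>\<Sum>j\<in>\<Lambda>. z j * external_field j \<tau> - x j * external_field j \<tau>\<bar> \<le> (\<Sum>j\<in>\<Lambda>. \<epsilon> * B)"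
        by (rule order_trans[OF sum_abs sum_mono[OF 3]])
    qed simp
    also have "\<dots> = real (card \<Lambda>) * e1 + \<epsilon> * A"
    proof -
      have S: "(\<Sum>j\<in>\<Lambda>. \<Sum>k\<in>\<Lambda>. \<bar>J j k\<bar> * (2 * \<bar>R\<bar> + 1) * \<epsilon>) = (\<Sum>j\<in>\<Lambda>. \<Sum>k\<in>\<Lambda>. \<bar>J j k\<bar> * (2 * \<bar>R\<bar> + 1)) * \<epsilon>"
        by (simp only: sum_distrib_right)
      show ?thesis unfolding A_def S sum_constant by argo
    qed
    also have "\<dots> \<le> e / 2 + e / 2"
    proof (rule add_mono)
      have half: "e / (2 * u) * u = e / 2" if "u \<noteq> 0" for u using that by simp
      have "real (card \<Lambda>) * e1 \<le> (real (card \<Lambda>) + 1) * e1" using e1 by simp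
      also have "\<dots> = e / 2"
        unfolding e1_def mult.commute[of "real (card \<Lambda>) + 1"]
        by (rule half) (simp add: add_nonneg_eq_0_iff)
      finally show "real (card \<Lambda>) * e1 \<le> e / 2" .
      have "\<epsilon> * A \<le> e / (2 * (A + 1)) * (A + 1)"
        by (rule mult_mono[OF \<epsilon>1(2)]) (use A assms in simp_all)
      also have "\<dots> = e / 2" using A by (intro half) simp
      finally show "\<epsilon> * A \<le> e / 2" .
    qed
    also have "e / 2 + e / 2 = e" by simp
    finally show "\<bar>energy_density \<tau> z - energy_density \<tau> x\<bar> \<le> e" .
  qed
qed

end

subsection \<open>Gaussian moments and normalized densities\<close>

text \<open>With \<open>\<omega> t = X + H\<close> and \<open>X\<close> the mean,
  \<open>|\<omega> t|\<close> is at most the larger of \<open>|X| / l\<close> and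
  \<open>|H| / (1 - l)\<close>. The two exponentials are therefore added, and their expectations can
  be taken separately. For \<open>l\<close> near 1 the coefficient of \<open>X^2\<close> is near
  \<open>q\<close>, while \<open>K\<close> becomes large.\<close>

lemma loop_exp_square_le:
  assumes \<beta>: "0 < \<beta>" and \<omega>: "\<omega> \<in> mspace (loop_space \<beta>)" and t: "t \<in> {0..\<beta>}"
    and q: "0 < q" and l: "0 < l" "l < 1" and K: "K = q / (1 - l)\<^sup>2"
    and S: "chain_sum \<beta> K \<omega> = ennreal s" "0 \<le> s"
  shows "exp (q * (\<omega> t)\<^sup>2) \<le> exp (q / l\<^sup>2 * (dyadic_mean \<beta> 0 0 \<omega>)\<^sup>2) + exp K + s"
proof -
  define X where "X = dyadic_mean \<beta> 0 0 \<omega>"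
  define H where "H = \<omega> t - X"
  have K0: "0 < K" using q l by (simp add: K)
  have w: "\<omega> t = X + H" by (simp add: H_def)
  show ?thesis
  proof (cases "\<bar>H\<bar> / (1 - l) \<le> \<bar>X\<bar> / l")
    case True
    have "\<bar>H\<bar> \<le> (1 - l) * (\<bar>X\<bar> / l)" using True l by (simp add: pos_divide_le_eq mult.commute)
    moreover have "l * (\<bar>X\<bar> / l) = \<bar>X\<bar>" using l by simp
    ultimately have "\<bar>\<omega> t\<bar> \<le> \<bar>X\<bar> / l" unfolding w left_diff_distrib by linarith
    then have "\<bar>\<omega> t\<bar>\<^sup>2 \<le> (\<bar>X\<bar> / l)\<^sup>2" by (rule power_mono) simp
    from mult_left_mono[OF this less_imp_le[OF q]] have "q * (\<omega> t)\<^sup>2 \<le> q / l\<^sup>2 * X\<^sup>2"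
      by (simp add: power_divide)
    then have "exp (q * (\<omega> t)\<^sup>2) \<le> exp (q / l\<^sup>2 * X\<^sup>2)" by simp
    then show ?thesis using S(2) exp_ge_zero[of K] unfolding X_def by linarith
  next
    case False
    then have F: "\<bar>X\<bar> / l \<le> \<bar>H\<bar> / (1 - l)" by simp
    have "\<bar>X\<bar> \<le> l * (\<bar>H\<bar> / (1 - l))" using F l(1) by (simp add: pos_divide_le_eq mult.commute)
    moreover have "(1 - l) * (\<bar>H\<bar> / (1 - l)) = \<bar>H\<bar>" using l by simp
    ultimately have "\<bar>\<omega> t\<bar> \<le> \<bar>H\<bar> / (1 - l)" unfolding w left_diff_distrib by linarith
    then have "\<bar>\<omega> t\<bar>\<^sup>2 \<le> (\<bar>H\<bar> / (1 - l))\<^sup>2" by (rule power_mono) simp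
    from mult_left_mono[OF this less_imp_le[OF q]] have "q * (\<omega> t)\<^sup>2 \<le> K * H\<^sup>2"
      by (simp add: power_divide K)
    then have "exp (q * (\<omega> t)\<^sup>2) \<le> exp (K * H\<^sup>2)" by simp
    also have "\<dots> \<le> exp K + s"
      using exp_deviation_le[OF \<beta> K0 \<omega> t S] by (simp add: H_def X_def)
    finally show ?thesis using exp_ge_zero[of "q / l\<^sup>2 * (dyadic_mean \<beta> 0 0 \<omega>)\<^sup>2"] by linarith
  qed
qed

text \<open>The factor turns the normal density of variance \<open>1 / \<beta>\<close> into a
  multiple of the one of variance \<open>1 / (\<beta> - 2 * \<kappa>)\<close>.\<close>

lemma nn_integral_mean_dist_exp:
  assumes \<beta>: "0 < \<beta>" and \<kappa>: "\<kappa> < \<beta> / 2"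
  shows "(\<integral>\<^sup>+ x. ennreal (exp (\<kappa> * x\<^sup>2)) \<partial>mean_dist \<beta>) < \<top>"
proof -
  define \<sigma> where "\<sigma> = 1 / sqrt (\<beta> - 2 * \<kappa>)"
  have \<sigma>: "0 < \<sigma>" using \<kappa> by (simp add: \<sigma>_def)
  define A where "A = sqrt (\<beta> / (2 * pi)) * sqrt (2 * pi * \<sigma>\<^sup>2)"
  have A: "0 \<le> A" using \<beta> by (simp add: A_def)
  have s2: "x\<^sup>2 / (2 * \<sigma>\<^sup>2) = (\<beta> / 2 - \<kappa>) * x\<^sup>2" for x
    using \<kappa> by (simp add: \<sigma>_def power_divide algebra_simps) (simp add: diff_divide_distrib)
  have eq: "sqrt (\<beta> / (2 * pi)) * exp (- \<beta> * x\<^sup>2 / 2) * exp (\<kappa> * x\<^sup>2) = A * normal_density 0 \<sigma> x" for x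
  proof -
    have "A * normal_density 0 \<sigma> x = sqrt (\<beta> / (2 * pi)) * exp (- ((\<beta> / 2 - \<kappa>) * x\<^sup>2))"
      using \<sigma> by (simp add: A_def normal_density_def s2)
    also have "exp (- ((\<beta> / 2 - \<kappa>) * x\<^sup>2)) = exp (- \<beta> * x\<^sup>2 / 2) * exp (\<kappa> * x\<^sup>2)"
      by (simp add: exp_add[symmetric] algebra_simps)
    finally show ?thesis by simp
  qed
  have "(\<integral>\<^sup>+ x. ennreal (exp (\<kappa> * x\<^sup>2)) \<partial>mean_dist \<beta>) =
      (\<integral>\<^sup>+ x. ennreal A * ennreal (normal_density 0 \<sigma> x) \<partial>lborel)"
    using \<beta> A eq by (simp add: mean_dist_def nn_integral_density ennreal_mult[symmetric] del: minus_mult_minus mult_minus_left)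
  also have "\<dots> = ennreal A * (\<integral>\<^sup>+ x. ennreal (normal_density 0 \<sigma> x) \<partial>lborel)"
    by (rule nn_integral_cmult) auto
  also have "(\<integral>\<^sup>+ x. ennreal (normal_density 0 \<sigma> x) \<partial>lborel) = 1"
    using \<sigma> by (subst nn_integral_eq_integral) (auto simp: integral_normal_density integrable_normal_density)
  finally show ?thesis by simp
qed

text \<open>The kernels are normalized in \<open>ennreal\<close>. A strictly positive integrable
  weight has a finite and positive integral, so the division becomes one of real numbers.\<close>

lemma integral_normalized_density:
  fixes W F :: "'a \<Rightarrow> real"
  assumes "prob_space M" and W: "integrable M W" and pos: "\<And>x. 0 < W x" and F: "F \<in> borel_measurable M"
  shows "(\<integral>x. F x \<partial>density M (\<lambda>x. ennreal (W x) / (\<integral>\<^sup>+ x. ennreal (W x) \<partial>M))) =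
      (\<integral>x. F x * W x \<partial>M) / (\<integral>x. W x \<partial>M)"
    and "0 < (\<integral>x. W x \<partial>M)"
proof -
  interpret prob_space M by fact
  have Wm [measurable]: "W \<in> borel_measurable M" using W by auto
  have nn: "(\<integral>\<^sup>+ x. ennreal (W x) \<partial>M) = ennreal (\<integral>x. W x \<partial>M)"
    using W pos by (intro nn_integral_eq_integral) (auto simp: less_imp_le)
  have "(\<integral>\<^sup>+ x. ennreal (W x) \<partial>M) \<noteq> 0"
  proof
    assume "(\<integral>\<^sup>+ x. ennreal (W x) \<partial>M) = 0"
    then have "AE x in M. ennreal (W x) = 0" by (subst (asm) nn_integral_0_iff_AE) auto
    then have "AE x in M. False" using pos by (auto simp: ennreal_eq_0_iff not_le[symmetric])
    then show False by simp
  qed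
  then show P: "0 < (\<integral>x. W x \<partial>M)" unfolding nn by (simp add: ennreal_eq_0_iff not_le)
  have "(\<integral>x. F x \<partial>density M (\<lambda>x. ennreal (W x) / (\<integral>\<^sup>+ x. ennreal (W x) \<partial>M))) =
      (\<integral>x. F x \<partial>density M (\<lambda>x. ennreal (W x / (\<integral>x. W x \<partial>M))))"
    unfolding nn using P pos by (simp add: divide_ennreal less_imp_le)
  also have "\<dots> = (\<integral>x. (W x / (\<integral>x. W x \<partial>M)) *\<^sub>R F x \<partial>M)"
    using P pos F by (intro integral_density) (auto simp: less_imp_le)
  also have "\<dots> = (\<integral>x. F x * W x / (\<integral>x. W x \<partial>M) \<partial>M)"
    by (simp add: mult.commute)
  also have "\<dots> = (\<integral>x. F x * W x \<partial>M) / (\<integral>x. W x \<partial>M)" by simp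
  finally show "(\<integral>x. F x \<partial>density M (\<lambda>x. ennreal (W x) / (\<integral>\<^sup>+ x. ennreal (W x) \<partial>M))) =
      (\<integral>x. F x * W x \<partial>M) / (\<integral>x. W x \<partial>M)" .
qed

section \<open>Evaluating the energy at one time; measurability of the weights\<close>

context lattice_system
begin

abbreviation quantum_weight :: "(int ^ 'd \<Rightarrow> real \<Rightarrow> real) \<Rightarrow> real" where
  "quantum_weight \<omega> \<equiv> exp (- quantum_energy J U \<beta> \<Lambda> \<omega> \<zeta>)"

abbreviation classical_weight :: "(int ^ 'd \<Rightarrow> real) \<Rightarrow> real" where
  "classical_weight x \<equiv> exp (- \<beta> * classical_energy J U \<Lambda> x y)"

abbreviation means :: "(int ^ 'd \<Rightarrow> real \<Rightarrow> real) \<Rightarrow> int ^ 'd \<Rightarrow> real" where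
  "means \<equiv> compose \<Lambda> (dyadic_mean \<beta> 0 0)"

text \<open>Plays the part of Jensen's inequality: the exponential of the time integral becomes the
  exponential of the density at one time.\<close>

lemma energy_attained:
  assumes cont: "\<And>j. j \<in> \<Lambda> \<Longrightarrow> continuous_on {0..\<beta>} (\<omega> j)"
  obtains \<tau> where "\<tau> \<in> {0..\<beta>}" "quantum_energy J U \<beta> \<Lambda> \<omega> \<zeta> = \<beta> * energy_density \<tau> (\<lambda>j. \<omega> j \<tau>)"
proof (rule LBINT_mean_value[OF less_imp_le[OF \<beta>_pos] energy_density_cont[OF cont]])
  fix \<tau> assume "\<tau> \<in> {0..\<beta>}"
    "(LBINT \<tau>:{0..\<beta>}. energy_density \<tau> (\<lambda>j. \<omega> j \<tau>)) = (\<beta> - 0) * energy_density \<tau> (\<lambda>j. \<omega> j \<tau>)"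
  then show ?thesis using quantum_energy_eq[OF cont] by (intro that[of \<tau>]) simp_all
qed

text \<open>Both energies are time integrals of the same density, at the loops and at the constants
  \<open>x\<close>, so one common time serves the difference.\<close>

lemma energy_difference_attained:
  assumes cont: "\<And>j. j \<in> \<Lambda> \<Longrightarrow> continuous_on {0..\<beta>} (\<omega> j)"
  obtains \<tau> where "\<tau> \<in> {0..\<beta>}"
    "quantum_energy J U \<beta> \<Lambda> \<omega> \<zeta> - \<beta> * classical_energy J U \<Lambda> x y =
       \<beta> * (energy_density \<tau> (\<lambda>j. \<omega> j \<tau>) - energy_density \<tau> x)"
proof -
  have c1: "continuous_on {0..\<beta>} (\<lambda>\<tau>. energy_density \<tau> (\<lambda>j. \<omega> j \<tau>))"
    by (rule energy_density_cont[OF cont])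
  have c2: "continuous_on {0..\<beta>} (\<lambda>\<tau>. energy_density \<tau> x)"
    using energy_density_cont[of "\<lambda>j \<tau>. x j"] by simp
  have "quantum_energy J U \<beta> \<Lambda> \<omega> \<zeta> - \<beta> * classical_energy J U \<Lambda> x y =
      (LBINT \<tau>:{0..\<beta>}. energy_density \<tau> (\<lambda>j. \<omega> j \<tau>)) - (LBINT \<tau>:{0..\<beta>}. energy_density \<tau> x)"
    using quantum_energy_eq[of \<omega>, OF cont] quantum_energy_eq[of "\<lambda>j \<tau>. x j"]
    by (simp add: quantum_energy_const)
  also have "\<dots> = (LBINT \<tau>:{0..\<beta>}. energy_density \<tau> (\<lambda>j. \<omega> j \<tau>) - energy_density \<tau> x)"
    by (rule set_integral_diff(2)[symmetric]) (intro borel_integrable_atLeastAtMost' c1 c2)+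
  finally have eq: "quantum_energy J U \<beta> \<Lambda> \<omega> \<zeta> - \<beta> * classical_energy J U \<Lambda> x y =
      (LBINT \<tau>:{0..\<beta>}. energy_density \<tau> (\<lambda>j. \<omega> j \<tau>) - energy_density \<tau> x)" .
  obtain \<tau> where "\<tau> \<in> {0..\<beta>}"
    "(LBINT \<tau>:{0..\<beta>}. energy_density \<tau> (\<lambda>j. \<omega> j \<tau>) - energy_density \<tau> x) =
       (\<beta> - 0) * (energy_density \<tau> (\<lambda>j. \<omega> j \<tau>) - energy_density \<tau> x)"
    using LBINT_mean_value[OF less_imp_le[OF \<beta>_pos] continuous_on_diff[OF c1 c2]] .
  then show ?thesis using eq by (intro that[of \<tau>]) simp_all
qed

lemma quantum_weight_measurable:
  assumes \<gamma>: "sets \<gamma> = sets (loop_borel \<beta>)"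
  shows "quantum_weight \<in> borel_measurable (PiM \<Lambda> (\<lambda>_. \<gamma>))"
proof -
  let ?P = "PiM \<Lambda> (\<lambda>_. \<gamma>)"
  have cont: "continuous_on {0..\<beta>} (\<omega> j)" if "\<omega> \<in> space ?P" "j \<in> \<Lambda>" for \<omega> j
    using that sets_eq_imp_space_eq[OF \<gamma>]
    by (auto simp: space_PiM PiE_iff space_loop_borel mem_loop_space_iff)
  have ev: "(\<lambda>\<omega>. \<omega> j t) \<in> borel_measurable ?P" if "j \<in> \<Lambda>" "t \<in> {0..\<beta>}" for j t
  proof -
    have "(\<lambda>\<omega>. \<omega> t) \<in> borel_measurable \<gamma>"
      using measurable_loop_eval[OF that(2)] measurable_cong_sets[OF \<gamma> refl] by blast
    from measurable_compose[OF measurable_component_singleton[OF that(1), of "\<lambda>_. \<gamma>"] this]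
    show ?thesis .
  qed
  have U: "U j \<in> borel_measurable borel" for j
    using U_cont by (rule borel_measurable_continuous_onI)
  have ed: "(\<lambda>\<omega>. energy_density t (\<lambda>j. \<omega> j t)) \<in> borel_measurable ?P" if "t \<in> {0..\<beta>}" for t
    unfolding energy_density_def
    by (intro borel_measurable_add borel_measurable_sum borel_measurable_times borel_measurable_const
        measurable_compose[OF ev U] ev that)
  have "(\<lambda>\<omega>. quantum_energy J U \<beta> \<Lambda> \<omega> \<zeta>) \<in> borel_measurable ?P"
  proof (rule borel_measurable_LIMSEQ_real)
    fix \<omega> assume "\<omega> \<in> space ?P"
    note cont = cont[OF this]
    show "(\<lambda>n. \<Sum>k<2^n. \<beta> / 2 ^ n * energy_density (\<beta> * real k / 2 ^ n) (\<lambda>j. \<omega> j (\<beta> * real k / 2 ^ n)))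
        \<longlonglongrightarrow> quantum_energy J U \<beta> \<Lambda> \<omega> \<zeta>"
      by (subst quantum_energy_eq[OF cont], assumption,
          rule riemann_sums_tendsto[OF \<beta>_pos energy_density_cont[OF cont]])
  next
    fix n
    have "\<beta> * real k / 2 ^ n \<in> {0..\<beta>}" if "k < 2 ^ n" for k
    proof -
      have "real k \<le> 2 ^ n" using that by (metis less_imp_le of_nat_le_iff of_nat_numeral of_nat_power)
      then show ?thesis using \<beta>_pos by (simp add: divide_le_eq)
    qed
    then show "(\<lambda>\<omega>. \<Sum>k<2^n. \<beta> / 2 ^ n * energy_density (\<beta> * real k / 2 ^ n) (\<lambda>j. \<omega> j (\<beta> * real k / 2 ^ n)))
        \<in> borel_measurable ?P"
      by (intro borel_measurable_sum borel_measurable_times borel_measurable_const ed) simp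
  qed
  then show ?thesis by measurable
qed

lemma classical_weight_measurable: "classical_weight \<in> borel_measurable (PiM \<Lambda> (\<lambda>_. borel))"
proof -
  have U: "U j \<in> borel_measurable borel" for j
    using U_cont by (rule borel_measurable_continuous_onI)
  have ev: "(\<lambda>x. x j) \<in> borel_measurable (PiM \<Lambda> (\<lambda>_. borel))" if "j \<in> \<Lambda>" for j
    using that by (rule measurable_component_singleton)
  have eq: "classical_energy J U \<Lambda> x y = (\<Sum>j\<in>\<Lambda>. U j (x j))
     + 1 / 2 * (\<Sum>j\<in>\<Lambda>. \<Sum>k\<in>\<Lambda>. J j k * x j * x k)
     + (\<Sum>j\<in>\<Lambda>. \<Sum>k\<in>boundary. J j k * (x j * y k))" for x
    unfolding classical_energy_def mult.assoc by (simp add: infsum_boundary cong: sum.cong)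
  have "(\<lambda>x. classical_energy J U \<Lambda> x y) \<in> borel_measurable (PiM \<Lambda> (\<lambda>_. borel))"
    unfolding eq
    by (intro borel_measurable_add borel_measurable_sum borel_measurable_times borel_measurable_const
        measurable_compose[OF ev U] ev)
  then show ?thesis by measurable
qed

end

subsection \<open>Comparison of the quantum and classical weights\<close>

text \<open>Where the weight exceeds \<open>exp L\<close> it is at most
  \<open>exp (- ((p - 1) * L))\<close> times its power \<open>p\<close>. This is uniform
  integrability as a pointwise inequality.\<close>

lemma exp_minus_le_truncation:
  fixes p L x :: real
  assumes "1 \<le> p"
  shows "exp (- x) \<le> exp L + exp (- ((p - 1) * L)) * exp (- (p * x))"
proof (cases "- x \<le> L")
  case True
  then have "exp (- x) \<le> exp L" by simp
  then show ?thesis by (simp add: add_increasing2)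
next
  case False
  then have "0 \<le> (p - 1) * (- x - L)" using assms by (intro mult_nonneg_nonneg) auto
  then have "- x \<le> - ((p - 1) * L) + - (p * x)" by (simp add: algebra_simps)
  then have "exp (- x) \<le> exp (- ((p - 1) * L)) * exp (- (p * x))"
    unfolding exp_add[symmetric] by simp
  then show ?thesis by (simp add: add_increasing)
qed

lemma abs_exp_minus_one_le: "\<bar>exp u - 1\<bar> \<le> exp \<bar>u\<bar> - (1::real)"
proof (cases "0 \<le> u")
  case False
  have "2 \<le> exp u + exp (- u)"
    using exp_ge_add_one_self[of u] exp_ge_add_one_self[of "- u"] by linarith
  then show ?thesis using False by (simp add: abs_if)
qed simp

lemma ennreal_combination3:
  assumes "0 \<le> a" "0 \<le> b" "0 \<le> c" "0 \<le> x" "0 \<le> y" "0 \<le> z"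
  shows "ennreal a * ennreal x + ennreal b * ennreal y + ennreal c * ennreal z = ennreal (a * x + b * y + c * z)"
  using assms by (simp add: ennreal_mult)

lemma nn_integral_combination3:
  assumes "f \<in> borel_measurable M" "g \<in> borel_measurable M" "h \<in> borel_measurable M"
  shows "(\<integral>\<^sup>+ x. a * f x + b * g x + c * h x \<partial>M) =
    a * (\<integral>\<^sup>+ x. f x \<partial>M) + b * (\<integral>\<^sup>+ x. g x \<partial>M) + c * (\<integral>\<^sup>+ x. h x \<partial>M)"
  using assms by (simp add: nn_integral_add nn_integral_cmult)

context lattice_system
begin

lemma nn_integral_component:
  assumes "prob_space \<gamma>" "j \<in> \<Lambda>" and F: "F \<in> borel_measurable \<gamma>"
  shows "(\<integral>\<^sup>+ \<omega>. F (\<omega> j) \<partial>PiM \<Lambda> (\<lambda>_. \<gamma>)) = (\<integral>\<^sup>+ x. F x \<partial>\<gamma>)"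
proof -
  have "distr (PiM \<Lambda> (\<lambda>_. \<gamma>)) \<gamma> (\<lambda>\<omega>. \<omega> j) = \<gamma>"
    using assms(1,2) \<Lambda>_fin by (intro distr_PiM_component) auto
  then have "(\<integral>\<^sup>+ x. F x \<partial>\<gamma>) = (\<integral>\<^sup>+ x. F x \<partial>distr (PiM \<Lambda> (\<lambda>_. \<gamma>)) \<gamma> (\<lambda>\<omega>. \<omega> j))" by simp
  also have "\<dots> = (\<integral>\<^sup>+ \<omega>. F (\<omega> j) \<partial>PiM \<Lambda> (\<lambda>_. \<gamma>))"
    using assms(2) F by (intro nn_integral_distr) auto
  finally show ?thesis ..
qed

lemma nn_integral_product:
  assumes "prob_space \<gamma>" and F: "F \<in> borel_measurable \<gamma>"
  shows "(\<integral>\<^sup>+ \<omega>. (\<Prod>j\<in>\<Lambda>. F (\<omega> j)) \<partial>PiM \<Lambda> (\<lambda>_. \<gamma>)) = (\<integral>\<^sup>+ x. F x \<partial>\<gamma>) ^ card \<Lambda>"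
proof -
  interpret prob_space \<gamma> by fact
  interpret product_sigma_finite "\<lambda>_ :: int ^ 'd. \<gamma>" ..
  show ?thesis using product_nn_integral_prod[of \<Lambda> "\<lambda>_. F"] \<Lambda>_fin F by simp
qed

text \<open>The loops at different sites are independent under the product measure, hence so are
  their means, and each mean has law \<open>mean_dist \<beta>\<close>.\<close>

lemma classical_reference_law:
  assumes \<gamma>: "is_gaussian_loop_measure \<beta> m \<gamma>"
  shows "means \<in> PiM \<Lambda> (\<lambda>_. \<gamma>) \<rightarrow>\<^sub>M PiM \<Lambda> (\<lambda>_. borel)"
    and "distr (PiM \<Lambda> (\<lambda>_. \<gamma>)) (PiM \<Lambda> (\<lambda>_. borel)) means = classical_reference \<beta> \<Lambda>"
proof -
  have \<gamma>p: "prob_space \<gamma>" using \<gamma> by (simp add: is_gaussian_loop_measure_def)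
  note law = mean_law[OF \<gamma> \<beta>_pos]
  show "means \<in> PiM \<Lambda> (\<lambda>_. \<gamma>) \<rightarrow>\<^sub>M PiM \<Lambda> (\<lambda>_. borel)"
    unfolding compose_def using law(1) by measurable
  have N: "prob_space (mean_dist \<beta>)"
    using prob_space.prob_space_distr[OF \<gamma>p law(1)] by (simp only: law(2))
  have m: "dyadic_mean \<beta> 0 0 \<in> \<gamma> \<rightarrow>\<^sub>M mean_dist \<beta>" using law(1) by simp
  \<comment> \<open>The target is replaced by \<open>mean_dist \<beta>\<close>, which has the same
    measurable sets as \<open>borel\<close> but is a probability measure, as the rule for images of
    products asks.\<close>
  have "distr (PiM \<Lambda> (\<lambda>_. \<gamma>)) (PiM \<Lambda> (\<lambda>_. borel)) means =
      distr (PiM \<Lambda> (\<lambda>_. \<gamma>)) (PiM \<Lambda> (\<lambda>_. mean_dist \<beta>)) means"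
    by (intro distr_cong sets_PiM_cong) auto
  also have "\<dots> = PiM \<Lambda> (\<lambda>_. distr \<gamma> (mean_dist \<beta>) (dyadic_mean \<beta> 0 0))"
    using \<gamma>p N m \<Lambda>_fin by (intro distr_PiM_finite_prob_space') auto
  also have "distr \<gamma> (mean_dist \<beta>) (dyadic_mean \<beta> 0 0) = distr \<gamma> borel (dyadic_mean \<beta> 0 0)"
    by (intro distr_cong) auto
  finally show "distr (PiM \<Lambda> (\<lambda>_. \<gamma>)) (PiM \<Lambda> (\<lambda>_. borel)) means = classical_reference \<beta> \<Lambda>"
    by (simp add: law(2) classical_reference_def mean_dist_def)
qed

section \<open>Estimates for fixed exponents and splitting parameters\<close>

context
  fixes a C p q l K \<kappa> :: real
  assumes a: "0 < a"
    and lower: "\<And>\<tau> z. \<tau> \<in> {0..\<beta>} \<Longrightarrow> energy_density \<tau> z \<ge> - C - a / 2 * (\<Sum>j\<in>\<Lambda>. (z j)\<^sup>2)"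
    and p: "1 < p" and q: "q = p * a * \<beta> / 2" and l: "0 < l" "l < 1"
    and K: "K = q / (1 - l)\<^sup>2" and \<kappa>: "\<kappa> = q / l\<^sup>2"
begin

lemma q_pos: "0 < q"
  using a p \<beta>_pos by (simp add: q)

lemma K_pos: "0 < K"
  using q_pos l by (simp add: K)

lemma q_le_\<kappa>: "q \<le> \<kappa>"
proof -
  have "l\<^sup>2 \<le> 1" using l by (simp add: power_le_one)
  then show ?thesis using q_pos l by (simp add: \<kappa> pos_le_divide_eq mult_left_le)
qed

text \<open>The lower bound on the density is used at the time where the energy is attained, and
  \<open>q\<close> is the resulting coefficient of the squares in the power \<open>p\<close> of the
  weight. That time depends on \<open>\<omega>\<close>, so the bounds \<open>B\<close> are required
  at all times. The lemma covers loops and constant configurations alike.\<close>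

lemma weight_power_le:
  assumes cont: "\<And>j. j \<in> \<Lambda> \<Longrightarrow> continuous_on {0..\<beta>} (\<omega> j)"
    and B: "\<And>j t. j \<in> \<Lambda> \<Longrightarrow> t \<in> {0..\<beta>} \<Longrightarrow> exp (q * (\<omega> j t)\<^sup>2) \<le> B j"
  shows "exp (- (p * quantum_energy J U \<beta> \<Lambda> \<omega> \<zeta>)) \<le> exp (p * \<beta> * C) * (\<Prod>j\<in>\<Lambda>. B j)"
proof -
  obtain \<tau> where \<tau>: "\<tau> \<in> {0..\<beta>}"
    "quantum_energy J U \<beta> \<Lambda> \<omega> \<zeta> = \<beta> * energy_density \<tau> (\<lambda>j. \<omega> j \<tau>)"
    using energy_attained[of \<omega>, OF cont] .
  have "p * \<beta> * (- C - a / 2 * (\<Sum>j\<in>\<Lambda>. (\<omega> j \<tau>)\<^sup>2)) \<le> p * \<beta> * energy_density \<tau> (\<lambda>j. \<omega> j \<tau>)"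
    using lower[OF \<tau>(1)] p \<beta>_pos by (intro mult_left_mono) auto
  then have "- (p * quantum_energy J U \<beta> \<Lambda> \<omega> \<zeta>) \<le> p * \<beta> * C + q * (\<Sum>j\<in>\<Lambda>. (\<omega> j \<tau>)\<^sup>2)"
    unfolding \<tau>(2) q by (simp add: algebra_simps)
  then have "exp (- (p * quantum_energy J U \<beta> \<Lambda> \<omega> \<zeta>)) \<le> exp (p * \<beta> * C) * exp (\<Sum>j\<in>\<Lambda>. q * (\<omega> j \<tau>)\<^sup>2)"
    by (simp add: exp_add[symmetric] sum_distrib_left)
  also have "exp (\<Sum>j\<in>\<Lambda>. q * (\<omega> j \<tau>)\<^sup>2) = (\<Prod>j\<in>\<Lambda>. exp (q * (\<omega> j \<tau>)\<^sup>2))"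
    by (rule exp_sum[OF \<Lambda>_fin])
  also have "exp (p * \<beta> * C) * \<dots> \<le> exp (p * \<beta> * C) * (\<Prod>j\<in>\<Lambda>. B j)"
    using B[OF _ \<tau>(1)] by (intro mult_left_mono prod_mono) auto
  finally show ?thesis .
qed

text \<open>If all means are at most \<open>R\<close> in modulus and all chain sums at most
  \<open>\<epsilon>^8\<close>, the energies differ by at most \<open>\<beta> * e\<close> and the
  first term suffices. Otherwise some summand \<open>?T i\<close> is at least 1, which is Markov's
  inequality in pointwise form, and truncation at \<open>exp L\<close> bounds each of the two
  weights, whence the factors 2.\<close>

lemma weight_difference_le:
  assumes R: "0 \<le> R" and e: "0 < e" and \<epsilon>: "0 < \<epsilon>"
    and modulus: "\<And>\<tau> x z. \<tau> \<in> {0..\<beta>} \<Longrightarrow> (\<And>j. j \<in> \<Lambda> \<Longrightarrow> \<bar>x j\<bar> \<le> R) \<Longrightarrow>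
       (\<And>j. j \<in> \<Lambda> \<Longrightarrow> \<bar>z j - x j\<bar> \<le> \<epsilon>) \<Longrightarrow> \<bar>energy_density \<tau> z - energy_density \<tau> x\<bar> \<le> e"
    and \<omega>: "\<And>j. j \<in> \<Lambda> \<Longrightarrow> \<omega> j \<in> mspace (loop_space \<beta>)"
    and s: "\<And>j. j \<in> \<Lambda> \<Longrightarrow> chain_sum \<beta> K (\<omega> j) = ennreal (s j)" "\<And>j. j \<in> \<Lambda> \<Longrightarrow> 0 \<le> s j"
  shows "\<bar>quantum_weight \<omega> - classical_weight (means \<omega>)\<bar> \<le>
      (exp (\<beta> * e) - 1) * classical_weight (means \<omega>)
      + 2 * exp L * (\<Sum>j\<in>\<Lambda>. 1 / exp (\<kappa> * R\<^sup>2) * exp (\<kappa> * (dyadic_mean \<beta> 0 0 (\<omega> j))\<^sup>2) + 1 / \<epsilon> ^ 8 * s j)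
      + 2 * exp (- ((p - 1) * L)) * exp (p * \<beta> * C)
        * (\<Prod>j\<in>\<Lambda>. exp (\<kappa> * (dyadic_mean \<beta> 0 0 (\<omega> j))\<^sup>2) + exp K + s j)"
    (is "_ \<le> ?A + 2 * exp L * (\<Sum>j\<in>\<Lambda>. ?T j) + 2 * exp (- ((p - 1) * L)) * exp (p * \<beta> * C) * (\<Prod>j\<in>\<Lambda>. ?B j)")
proof -
  define X where "X = means \<omega>"
  have X: "X j = dyadic_mean \<beta> 0 0 (\<omega> j)" if "j \<in> \<Lambda>" for j
    using that by (simp add: X_def compose_def)
  have cont: "continuous_on {0..\<beta>} (\<omega> j)" if "j \<in> \<Lambda>" for j
    using \<omega>[OF that] by (simp add: mem_loop_space_iff)
  have T0: "0 \<le> ?T j" if "j \<in> \<Lambda>" for j using s(2)[OF that] by simp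
  have B0: "0 \<le> ?B j" if "j \<in> \<Lambda>" for j using s(2)[OF that] by (simp add: add_nonneg_nonneg)
  have A0: "0 \<le> ?A" using e \<beta>_pos by simp
  show ?thesis
  proof (cases "\<forall>j\<in>\<Lambda>. \<bar>X j\<bar> \<le> R \<and> s j \<le> \<epsilon> ^ 8")
    case True
    have dev: "\<bar>\<omega> j t - X j\<bar> \<le> \<epsilon>" if "j \<in> \<Lambda>" "t \<in> {0..\<beta>}" for j t
    proof -
      have "chain_sum \<beta> K (\<omega> j) \<le> ennreal (\<epsilon> ^ 8)"
        using True that(1) by (simp add: s(1) ennreal_leI)
      from deviation_le[OF \<beta>_pos less_imp_le[OF K_pos] \<omega>[OF that(1)] that(2) less_imp_le[OF \<epsilon>] this]
      show ?thesis by (simp add: X[OF that(1)])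
    qed
    obtain \<tau> where \<tau>: "\<tau> \<in> {0..\<beta>}"
      "quantum_energy J U \<beta> \<Lambda> \<omega> \<zeta> - \<beta> * classical_energy J U \<Lambda> X y =
         \<beta> * (energy_density \<tau> (\<lambda>j. \<omega> j \<tau>) - energy_density \<tau> X)"
      using energy_difference_attained[of \<omega> X, OF cont] .
    define u where "u = quantum_energy J U \<beta> \<Lambda> \<omega> \<zeta> - \<beta> * classical_energy J U \<Lambda> X y"
    have "\<bar>energy_density \<tau> (\<lambda>j. \<omega> j \<tau>) - energy_density \<tau> X\<bar> \<le> e"
      using modulus[OF \<tau>(1), of X "\<lambda>j. \<omega> j \<tau>"] True dev \<tau>(1) by blast
    then have u: "\<bar>u\<bar> \<le> \<beta> * e"
      unfolding u_def \<tau>(2) abs_mult using \<beta>_pos by simp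
    have "quantum_weight \<omega> = classical_weight X * exp (- u)"
      by (simp add: u_def exp_add[symmetric])
    then have "quantum_weight \<omega> - classical_weight X = classical_weight X * (exp (- u) - 1)"
      by (simp add: right_diff_distrib)
    then have "\<bar>quantum_weight \<omega> - classical_weight X\<bar> = classical_weight X * \<bar>exp (- u) - 1\<bar>"
      by (simp add: abs_mult)
    also have "\<dots> \<le> classical_weight X * (exp (\<beta> * e) - 1)"
    proof (rule mult_left_mono)
      have "\<bar>exp (- u) - 1\<bar> \<le> exp \<bar>u\<bar> - 1" using abs_exp_minus_one_le[of "- u"] by simp
      also have "\<dots> \<le> exp (\<beta> * e) - 1" using u by simp
      finally show "\<bar>exp (- u) - 1\<bar> \<le> exp (\<beta> * e) - 1" .
    qed simp
    also have "\<dots> = ?A" by (simp add: X_def mult.commute)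
    finally have "\<bar>quantum_weight \<omega> - classical_weight (means \<omega>)\<bar> \<le> ?A" by (simp only: X_def)
    moreover have "0 \<le> 2 * exp L * (\<Sum>j\<in>\<Lambda>. ?T j)" using T0 by (intro mult_nonneg_nonneg sum_nonneg) auto
    moreover have "0 \<le> 2 * exp (- ((p - 1) * L)) * exp (p * \<beta> * C) * (\<Prod>j\<in>\<Lambda>. ?B j)"
      using B0 by (intro mult_nonneg_nonneg prod_nonneg) auto
    ultimately show ?thesis by linarith
  next
    case False
    then obtain i where i: "i \<in> \<Lambda>" "R < \<bar>X i\<bar> \<or> \<epsilon> ^ 8 < s i" by fastforce
    have "1 \<le> ?T i"
      using i(2)
    proof
      assume "R < \<bar>X i\<bar>"
      then have "R\<^sup>2 \<le> \<bar>X i\<bar>\<^sup>2" using R by (intro power_mono) auto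
      then have "exp (\<kappa> * R\<^sup>2) \<le> exp (\<kappa> * (X i)\<^sup>2)"
        using q_pos q_le_\<kappa> by (simp add: mult_left_mono)
      then have "1 \<le> 1 / exp (\<kappa> * R\<^sup>2) * exp (\<kappa> * (X i)\<^sup>2)" by simp
      moreover have "0 \<le> 1 / \<epsilon> ^ 8 * s i" using s(2)[OF i(1)] by simp
      ultimately show ?thesis unfolding X[OF i(1)] by linarith
    next
      assume "\<epsilon> ^ 8 < s i"
      then have "1 \<le> 1 / \<epsilon> ^ 8 * s i" using \<epsilon> by (simp add: field_simps)
      moreover have "0 \<le> 1 / exp (\<kappa> * R\<^sup>2) * exp (\<kappa> * (dyadic_mean \<beta> 0 0 (\<omega> i))\<^sup>2)" by simp
      ultimately show ?thesis by linarith
    qed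
    also have "?T i \<le> (\<Sum>j\<in>\<Lambda>. ?T j)"
      by (rule member_le_sum[OF i(1) _ \<Lambda>_fin]) (use T0 in auto)
    finally have T1: "1 \<le> (\<Sum>j\<in>\<Lambda>. ?T j)" .
    have "exp (- (p * quantum_energy J U \<beta> \<Lambda> \<omega> \<zeta>)) \<le> exp (p * \<beta> * C) * (\<Prod>j\<in>\<Lambda>. ?B j)"
    proof (rule weight_power_le)
      fix j t assume j: "j \<in> \<Lambda>" and t: "t \<in> {0..\<beta>}"
      show "exp (q * (\<omega> j t)\<^sup>2) \<le> ?B j"
        unfolding \<kappa> by (rule loop_exp_square_le[OF \<beta>_pos \<omega>[OF j] t q_pos l K s(1)[OF j] s(2)[OF j]])
    qed (rule cont)
    then have Q: "exp (- ((p - 1) * L)) * exp (- (p * quantum_energy J U \<beta> \<Lambda> \<omega> \<zeta>))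
        \<le> exp (- ((p - 1) * L)) * (exp (p * \<beta> * C) * (\<Prod>j\<in>\<Lambda>. ?B j))"
      by (rule mult_left_mono) simp
    have "exp (- (p * quantum_energy J U \<beta> \<Lambda> (\<lambda>j \<tau>. X j) \<zeta>)) \<le> exp (p * \<beta> * C) * (\<Prod>j\<in>\<Lambda>. ?B j)"
    proof (rule weight_power_le)
      fix j assume j: "j \<in> \<Lambda>"
      have "exp (q * (X j)\<^sup>2) \<le> exp (\<kappa> * (X j)\<^sup>2)" using q_le_\<kappa> by (simp add: mult_right_mono)
      then show "exp (q * (X j)\<^sup>2) \<le> ?B j"
        using s(2)[OF j] exp_ge_zero[of K] unfolding X[OF j] by linarith
    qed simp
    then have V: "exp (- ((p - 1) * L)) * exp (- (p * (\<beta> * classical_energy J U \<Lambda> X y)))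
        \<le> exp (- ((p - 1) * L)) * (exp (p * \<beta> * C) * (\<Prod>j\<in>\<Lambda>. ?B j))"
      unfolding quantum_energy_const by (rule mult_left_mono) simp
    have "quantum_weight \<omega> \<le> exp L + exp (- ((p - 1) * L)) * (exp (p * \<beta> * C) * (\<Prod>j\<in>\<Lambda>. ?B j))"
      using exp_minus_le_truncation[of p "quantum_energy J U \<beta> \<Lambda> \<omega> \<zeta>" L] p Q by linarith
    moreover have "classical_weight X \<le> exp L + exp (- ((p - 1) * L)) * (exp (p * \<beta> * C) * (\<Prod>j\<in>\<Lambda>. ?B j))"
      using exp_minus_le_truncation[of p "\<beta> * classical_energy J U \<Lambda> X y" L] p V
      unfolding minus_mult_left[symmetric] by linarith
    moreover have "0 \<le> quantum_weight \<omega>" "0 \<le> classical_weight X" by simp_all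
    ultimately have "\<bar>quantum_weight \<omega> - classical_weight X\<bar>
        \<le> 2 * exp L * 1 + 2 * exp (- ((p - 1) * L)) * exp (p * \<beta> * C) * (\<Prod>j\<in>\<Lambda>. ?B j)"
      unfolding mult.assoc by linarith
    also have "\<dots> \<le> 2 * exp L * (\<Sum>j\<in>\<Lambda>. ?T j) + 2 * exp (- ((p - 1) * L)) * exp (p * \<beta> * C) * (\<Prod>j\<in>\<Lambda>. ?B j)"
      using T1 by (intro add_right_mono mult_left_mono) auto
    finally show ?thesis using A0 unfolding X_def by linarith
  qed
qed

text \<open>The pointwise estimate is integrated: the sum over sites reduces to one-site
  expectations, and the product over sites factorizes by independence.\<close>

lemma weight_L1_le:
  assumes \<gamma>: "is_gaussian_loop_measure \<beta> m \<gamma>" and R: "0 \<le> R" and e: "0 < e" and \<epsilon>: "0 < \<epsilon>"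
    and modulus: "\<And>\<tau> x z. \<tau> \<in> {0..\<beta>} \<Longrightarrow> (\<And>j. j \<in> \<Lambda> \<Longrightarrow> \<bar>x j\<bar> \<le> R) \<Longrightarrow>
       (\<And>j. j \<in> \<Lambda> \<Longrightarrow> \<bar>z j - x j\<bar> \<le> \<epsilon>) \<Longrightarrow> \<bar>energy_density \<tau> z - energy_density \<tau> x\<bar> \<le> e"
  defines "d \<equiv> \<integral>\<^sup>+ x. ennreal (exp (\<kappa> * x\<^sup>2)) \<partial>mean_dist \<beta>"
    and "S \<equiv> \<integral>\<^sup>+ \<omega>. chain_sum \<beta> K \<omega> \<partial>\<gamma>"
  shows "(\<integral>\<^sup>+ \<omega>. ennreal \<bar>quantum_weight \<omega> - classical_weight (means \<omega>)\<bar> \<partial>PiM \<Lambda> (\<lambda>_. \<gamma>)) \<le>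
      ennreal (exp (\<beta> * e) - 1) * (\<integral>\<^sup>+ x. ennreal (classical_weight x) \<partial>classical_reference \<beta> \<Lambda>)
      + ennreal (2 * exp L) * (of_nat (card \<Lambda>) * (ennreal (1 / exp (\<kappa> * R\<^sup>2)) * d + ennreal (1 / \<epsilon> ^ 8) * S))
      + ennreal (2 * exp (- ((p - 1) * L)) * exp (p * \<beta> * C)) * (d + ennreal (exp K) + S) ^ card \<Lambda>"
proof -
  let ?P = "PiM \<Lambda> (\<lambda>_. \<gamma>)"
  let ?M = "dyadic_mean \<beta> 0 0"
  have \<gamma>p: "prob_space \<gamma>" using \<gamma> by (simp add: is_gaussian_loop_measure_def)
  note law = mean_law[OF \<gamma> \<beta>_pos]
  note ref = classical_reference_law[OF \<gamma>]
  have S_meas [measurable]: "chain_sum \<beta> K \<in> borel_measurable \<gamma>" by (rule chain_sum_measurable[OF \<gamma> \<beta>_pos])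
  have [measurable]: "?M \<in> borel_measurable \<gamma>" by (rule law(1))
  have d: "(\<integral>\<^sup>+ \<omega>. ennreal (exp (\<kappa> * (?M \<omega>)\<^sup>2)) \<partial>\<gamma>) = d"
    unfolding d_def law(2)[symmetric] by (subst nn_integral_distr) auto
  define T where "T \<omega> = ennreal (1 / exp (\<kappa> * R\<^sup>2)) * ennreal (exp (\<kappa> * (?M \<omega>)\<^sup>2)) + ennreal (1 / \<epsilon> ^ 8) * chain_sum \<beta> K \<omega>" for \<omega>
  define B where "B \<omega> = ennreal (exp (\<kappa> * (?M \<omega>)\<^sup>2)) + ennreal (exp K) + chain_sum \<beta> K \<omega>" for \<omega>
  have Tm [measurable]: "T \<in> borel_measurable \<gamma>" unfolding T_def[abs_def] by measurable
  have Bm [measurable]: "B \<in> borel_measurable \<gamma>" unfolding B_def[abs_def] by measurable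
  have Vm [measurable]: "(\<lambda>\<omega>. classical_weight (means \<omega>)) \<in> borel_measurable ?P"
    using measurable_compose[OF ref(1) classical_weight_measurable] .
  have TI: "(\<integral>\<^sup>+ \<omega>. T \<omega> \<partial>\<gamma>) = ennreal (1 / exp (\<kappa> * R\<^sup>2)) * d + ennreal (1 / \<epsilon> ^ 8) * S"
    unfolding T_def S_def by (simp add: nn_integral_add nn_integral_cmult d)
  have BI: "(\<integral>\<^sup>+ \<omega>. B \<omega> \<partial>\<gamma>) = d + ennreal (exp K) + S"
    unfolding B_def S_def using prob_space.emeasure_space_1[OF \<gamma>p]
    by (simp add: nn_integral_add d)
  have "ennreal \<bar>quantum_weight \<omega> - classical_weight (means \<omega>)\<bar> \<le>
      ennreal (exp (\<beta> * e) - 1) * ennreal (classical_weight (means \<omega>))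
      + ennreal (2 * exp L) * (\<Sum>j\<in>\<Lambda>. T (\<omega> j))
      + ennreal (2 * exp (- ((p - 1) * L)) * exp (p * \<beta> * C)) * (\<Prod>j\<in>\<Lambda>. B (\<omega> j))"
    if "\<omega> \<in> space ?P" for \<omega>
  proof (cases "\<exists>j\<in>\<Lambda>. chain_sum \<beta> K (\<omega> j) = \<top>")
    case True
    then obtain j where j: "j \<in> \<Lambda>" "chain_sum \<beta> K (\<omega> j) = \<top>" by blast
    \<comment> \<open>Where a chain sum is infinite the right-hand side is infinite too, so the
      inequality holds there without discarding a null set.\<close>
    have "T (\<omega> j) = \<top>" using j(2) \<epsilon> by (simp add: T_def ennreal_mult_top)
    moreover have "T (\<omega> j) \<le> (\<Sum>j\<in>\<Lambda>. T (\<omega> j))"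
      by (rule member_le_sum[OF j(1) _ \<Lambda>_fin]) simp
    ultimately have "(\<Sum>j\<in>\<Lambda>. T (\<omega> j)) = \<top>" by (simp add: top_unique)
    then show ?thesis by (simp add: ennreal_mult_top)
  next
    case False
    define s where "s j = enn2real (chain_sum \<beta> K (\<omega> j))" for j
    have s: "chain_sum \<beta> K (\<omega> j) = ennreal (s j)" "0 \<le> s j" if "j \<in> \<Lambda>" for j
      using False that by (auto simp: s_def less_top)
    have \<omega>: "\<omega> j \<in> mspace (loop_space \<beta>)" if "j \<in> \<Lambda>" for j
      using that \<open>\<omega> \<in> space ?P\<close> space_gaussian_loop_measure[OF \<gamma>] by (auto simp: space_PiM)
    have T: "(\<Sum>j\<in>\<Lambda>. T (\<omega> j)) = ennreal (\<Sum>j\<in>\<Lambda>. 1 / exp (\<kappa> * R\<^sup>2) * exp (\<kappa> * (?M (\<omega> j))\<^sup>2) + 1 / \<epsilon> ^ 8 * s j)"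
      using \<epsilon> by (subst sum_ennreal[symmetric])
        (auto intro!: sum.cong simp: T_def s ennreal_mult[symmetric] ennreal_plus[symmetric] simp del: ennreal_plus)
    have B: "(\<Prod>j\<in>\<Lambda>. B (\<omega> j)) = ennreal (\<Prod>j\<in>\<Lambda>. exp (\<kappa> * (?M (\<omega> j))\<^sup>2) + exp K + s j)"
      by (subst prod_ennreal[symmetric])
        (auto intro!: prod.cong simp: B_def s ennreal_plus[symmetric] add_nonneg_nonneg simp del: ennreal_plus)
    have n1: "0 \<le> exp (\<beta> * e) - 1" using e \<beta>_pos by simp
    have n2: "0 \<le> (\<Sum>j\<in>\<Lambda>. 1 / exp (\<kappa> * R\<^sup>2) * exp (\<kappa> * (?M (\<omega> j))\<^sup>2) + 1 / \<epsilon> ^ 8 * s j)"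
      using s(2) by (intro sum_nonneg) auto
    have n3: "0 \<le> (\<Prod>j\<in>\<Lambda>. exp (\<kappa> * (?M (\<omega> j))\<^sup>2) + exp K + s j)"
      using s(2) by (intro prod_nonneg) (auto simp: add_nonneg_nonneg)
    have n: "0 \<le> 2 * exp L" "0 \<le> 2 * exp (- ((p - 1) * L)) * exp (p * \<beta> * C)"
      "0 \<le> classical_weight (means \<omega>)" by simp_all
    show ?thesis
      unfolding T B ennreal_combination3[OF n1 n(1,2,3) n2 n3]
      by (rule ennreal_leI[OF weight_difference_le[where L=L, OF R e \<epsilon> modulus \<omega> s]])
  qed
  then have "(\<integral>\<^sup>+ \<omega>. ennreal \<bar>quantum_weight \<omega> - classical_weight (means \<omega>)\<bar> \<partial>?P) \<le>
      (\<integral>\<^sup>+ \<omega>. ennreal (exp (\<beta> * e) - 1) * ennreal (classical_weight (means \<omega>))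
      + ennreal (2 * exp L) * (\<Sum>j\<in>\<Lambda>. T (\<omega> j))
      + ennreal (2 * exp (- ((p - 1) * L)) * exp (p * \<beta> * C)) * (\<Prod>j\<in>\<Lambda>. B (\<omega> j)) \<partial>?P)"
    by (rule nn_integral_mono)
  also have "\<dots> = ennreal (exp (\<beta> * e) - 1) * (\<integral>\<^sup>+ \<omega>. ennreal (classical_weight (means \<omega>)) \<partial>?P)
      + ennreal (2 * exp L) * (\<Sum>j\<in>\<Lambda>. \<integral>\<^sup>+ \<omega>. T (\<omega> j) \<partial>?P)
      + ennreal (2 * exp (- ((p - 1) * L)) * exp (p * \<beta> * C)) * (\<integral>\<^sup>+ \<omega>. (\<Prod>j\<in>\<Lambda>. B (\<omega> j)) \<partial>?P)"
  proof -
    have comp: "(\<lambda>\<omega>. F (\<omega> j)) \<in> borel_measurable ?P" if "j \<in> \<Lambda>" "F \<in> borel_measurable \<gamma>"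
      for j and F :: "_ \<Rightarrow> ennreal"
      by (rule measurable_compose[OF measurable_component_singleton[OF that(1), of "\<lambda>_. \<gamma>"] that(2)])
    have "(\<lambda>\<omega>. \<Sum>j\<in>\<Lambda>. T (\<omega> j)) \<in> borel_measurable ?P" "(\<lambda>\<omega>. \<Prod>j\<in>\<Lambda>. B (\<omega> j)) \<in> borel_measurable ?P"
      by (intro borel_measurable_sum borel_measurable_prod_ennreal comp Tm Bm; assumption)+
    moreover have "(\<integral>\<^sup>+ \<omega>. (\<Sum>j\<in>\<Lambda>. T (\<omega> j)) \<partial>?P) = (\<Sum>j\<in>\<Lambda>. \<integral>\<^sup>+ \<omega>. T (\<omega> j) \<partial>?P)"
      by (intro nn_integral_sum comp Tm)
    ultimately show ?thesis
      using nn_integral_combination3[OF measurable_compose[OF Vm measurable_ennreal]] by simp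
  qed
  also have "(\<integral>\<^sup>+ \<omega>. ennreal (classical_weight (means \<omega>)) \<partial>?P) =
      (\<integral>\<^sup>+ x. ennreal (classical_weight x) \<partial>classical_reference \<beta> \<Lambda>)"
    unfolding ref(2)[symmetric] using classical_weight_measurable ref(1)
    by (subst nn_integral_distr) auto
  also have "(\<Sum>j\<in>\<Lambda>. \<integral>\<^sup>+ \<omega>. T (\<omega> j) \<partial>?P) =
      of_nat (card \<Lambda>) * (ennreal (1 / exp (\<kappa> * R\<^sup>2)) * d + ennreal (1 / \<epsilon> ^ 8) * S)"
    using nn_integral_component[OF \<gamma>p _ Tm] by (simp add: TI)
  also have "(\<integral>\<^sup>+ \<omega>. (\<Prod>j\<in>\<Lambda>. B (\<omega> j)) \<partial>?P) = (d + ennreal (exp K) + S) ^ card \<Lambda>"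
    using nn_integral_product[OF \<gamma>p Bm] by (simp add: BI)
  finally show ?thesis .
qed

text \<open>Truncation at \<open>L = 0\<close> bounds the weight by 1 plus its power
  \<open>p\<close>, which is dominated by a product of one-site Gaussian exponentials.\<close>

lemma nn_integral_classical_weight:
  assumes N: "prob_space (mean_dist \<beta>)"
    and d: "(\<integral>\<^sup>+ x. ennreal (exp (\<kappa> * x\<^sup>2)) \<partial>mean_dist \<beta>) < \<top>"
  shows "(\<integral>\<^sup>+ x. ennreal (classical_weight x) \<partial>classical_reference \<beta> \<Lambda>) < \<top>"
proof -
  have le: "ennreal (classical_weight x) \<le>
      1 + ennreal (exp (p * \<beta> * C)) * (\<Prod>j\<in>\<Lambda>. ennreal (exp (\<kappa> * (x j)\<^sup>2)))" for x
  proof -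
    have "exp (- (p * quantum_energy J U \<beta> \<Lambda> (\<lambda>j \<tau>. x j) \<zeta>)) \<le> exp (p * \<beta> * C) * (\<Prod>j\<in>\<Lambda>. exp (\<kappa> * (x j)\<^sup>2))"
      by (rule weight_power_le) (use q_le_\<kappa> in \<open>auto intro: mult_right_mono\<close>)
    then have "classical_weight x \<le> 1 + exp (p * \<beta> * C) * (\<Prod>j\<in>\<Lambda>. exp (\<kappa> * (x j)\<^sup>2))"
      using exp_minus_le_truncation[of p "\<beta> * classical_energy J U \<Lambda> x y" 0] p
      unfolding quantum_energy_const minus_mult_left[symmetric] by simp
    then have "ennreal (classical_weight x) \<le> ennreal (1 + exp (p * \<beta> * C) * (\<Prod>j\<in>\<Lambda>. exp (\<kappa> * (x j)\<^sup>2)))"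
      by (rule ennreal_leI)
    also have "\<dots> = 1 + ennreal (exp (p * \<beta> * C)) * (\<Prod>j\<in>\<Lambda>. ennreal (exp (\<kappa> * (x j)\<^sup>2)))"
      by (simp add: prod_nonneg ennreal_mult prod_ennreal)
    finally show ?thesis .
  qed
  have N1: "emeasure (PiM \<Lambda> (\<lambda>_. mean_dist \<beta>)) (space (PiM \<Lambda> (\<lambda>_. mean_dist \<beta>))) = 1"
    by (rule prob_space.emeasure_space_1[OF prob_space_PiM[OF N]])
  have "(\<integral>\<^sup>+ x. ennreal (classical_weight x) \<partial>classical_reference \<beta> \<Lambda>) \<le>
      (\<integral>\<^sup>+ x. 1 + ennreal (exp (p * \<beta> * C)) * (\<Prod>j\<in>\<Lambda>. ennreal (exp (\<kappa> * (x j)\<^sup>2))) \<partial>PiM \<Lambda> (\<lambda>_. mean_dist \<beta>))"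
    unfolding classical_reference_def mean_dist_def by (intro nn_integral_mono le)
  also have "\<dots> = 1 + ennreal (exp (p * \<beta> * C)) *
      (\<integral>\<^sup>+ x. ennreal (exp (\<kappa> * x\<^sup>2)) \<partial>mean_dist \<beta>) ^ card \<Lambda>"
    using nn_integral_product[OF N, of "\<lambda>x. ennreal (exp (\<kappa> * x\<^sup>2))"]
    by (simp add: nn_integral_add nn_integral_cmult N1)
  also have "\<dots> < \<top>" using d by (simp add: ennreal_mult_less_top power_less_top_ennreal)
  finally show ?thesis .
qed

end

end

subsection \<open>The limit of infinite mass\<close>

context lattice_system
begin

lemma weight_L1_tendsto:
  assumes gaussian: "\<And>m. m > 0 \<Longrightarrow> is_gaussian_loop_measure \<beta> m (\<gamma> m)"
  shows "(\<integral>\<^sup>+ x. ennreal (classical_weight x) \<partial>classical_reference \<beta> \<Lambda>) < \<top>" (is "?Y < \<top>")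
    and "((\<lambda>m. \<integral>\<^sup>+ \<omega>. ennreal \<bar>quantum_weight \<omega> - classical_weight (means \<omega>)\<bar> \<partial>PiM \<Lambda> (\<lambda>_. \<gamma> m))
      \<longlongrightarrow> 0) at_top" (is "(?I \<longlongrightarrow> 0) at_top")
proof -
  obtain a C where a: "0 < a" "a < 1" and
    lower: "\<And>\<tau> z. \<tau> \<in> {0..\<beta>} \<Longrightarrow> energy_density \<tau> z \<ge> - C - a / 2 * (\<Sum>j\<in>\<Lambda>. (z j)\<^sup>2)"
    using energy_density_lower by metis
  \<comment> \<open>The constraint is \<open>p a < l\<^sup>2\<close>, i.e. \<open>\<kappa> < \<beta> / 2\<close>, for integrability of \<open>exp (\<kappa> X\<^sup>2)\<close>.\<close>
  define p where "p = (1 + a) / (2 * a)"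
  define q where "q = p * a * \<beta> / 2"
  define l where "l = (3 + a) / 4"
  define K where "K = q / (1 - l)\<^sup>2"
  define \<kappa> where "\<kappa> = q / l\<^sup>2"
  have p: "1 < p" using a by (simp add: p_def field_simps)
  have l: "0 < l" "l < 1" using a by (auto simp: l_def)
  note aux = a(1) lower p q_def l K_def \<kappa>_def
  have q': "q = (1 + a) * \<beta> / 4" using a by (simp add: q_def p_def)
  \<comment> \<open>Here \<open>p * a = (1 + a) / 2\<close>, and \<open>l\<close> is the midpoint of
    \<open>p * a\<close> and 1, so \<open>p * a < l^2\<close> is the inequality of arithmetic and
    geometric means; in terms of \<open>a\<close> it reads
    \<open>(3 + a)^2 - 8 * (1 + a) = (1 - a)^2 > 0\<close>.\<close>
  have "0 < (1 - a)\<^sup>2" using a by simp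
  then have "(1 + a) * 8 < (3 + a)\<^sup>2" by (simp add: power2_eq_square algebra_simps)
  then have "(1 + a) / 4 < 1 / 2 * l\<^sup>2" by (simp add: l_def power_divide)
  then have "(1 + a) / 4 * \<beta> < 1 / 2 * l\<^sup>2 * \<beta>" using \<beta>_pos by (rule mult_strict_right_mono)
  then have \<kappa>: "\<kappa> < \<beta> / 2" using l by (simp add: \<kappa>_def q' pos_divide_less_eq mult_ac)
  have K0: "0 < K" by (rule K_pos[OF aux])
  have \<kappa>0: "0 < \<kappa>" using q_pos[OF aux] q_le_\<kappa>[OF aux] by linarith
  define d where "d = enn2real (\<integral>\<^sup>+ x. ennreal (exp (\<kappa> * x\<^sup>2)) \<partial>mean_dist \<beta>)"
  have d: "(\<integral>\<^sup>+ x. ennreal (exp (\<kappa> * x\<^sup>2)) \<partial>mean_dist \<beta>) = ennreal d" "0 \<le> d"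
    using nn_integral_mean_dist_exp[OF \<beta>_pos \<kappa>] by (auto simp: d_def)
  \<comment> \<open>The measure of mass 1 is used to see that \<open>mean_dist \<beta>\<close> is a
    probability measure.\<close>
  have \<gamma>1: "is_gaussian_loop_measure \<beta> 1 (\<gamma> 1)" by (rule gaussian) simp
  have "prob_space (\<gamma> 1)" using \<gamma>1 by (simp add: is_gaussian_loop_measure_def)
  then have N: "prob_space (mean_dist \<beta>)"
    using prob_space.prob_space_distr mean_law[OF \<gamma>1 \<beta>_pos] by metis
  show Y: "?Y < \<top>"
    by (rule nn_integral_classical_weight[OF aux N]) (simp_all add: d)
  define Y where "Y = enn2real ?Y"
  have Y': "?Y = ennreal Y" "0 \<le> Y" using Y by (auto simp: Y_def)
  obtain D m0 where D: "0 \<le> D"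
    "\<And>m \<gamma>. m0 \<le> m \<Longrightarrow> 0 < m \<Longrightarrow> is_gaussian_loop_measure \<beta> m \<gamma> \<Longrightarrow>
       (\<integral>\<^sup>+ \<omega>. chain_sum \<beta> K \<omega> \<partial>\<gamma>) \<le> ennreal (D / m ^ 4)"
    using nn_integral_chain_sum_le[OF \<beta>_pos less_imp_le[OF K0]] by metis
  let ?n = "card \<Lambda>"
  have main: "eventually (\<lambda>m. ?I m \<le> ennreal \<eta>) at_top" if \<eta>: "0 < \<eta>" for \<eta> :: real
  proof -
    \<comment> \<open>The order of choice matters: \<open>e\<close> is set against \<open>Y\<close>,
      \<open>L\<close> against the product term, \<open>R\<close> against \<open>L\<close>, and
      \<open>\<epsilon>\<close> against \<open>R\<close> and \<open>e\<close>; the bound on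
      \<open>m\<close> comes last. In \<open>G\<close> the chain integral is replaced by its bound
      \<open>D\<close>, valid for \<open>m\<close> at least \<open>max m0 1\<close>, so
      \<open>L\<close> does not depend on \<open>m\<close>. The middle term splits into two parts of
      size \<open>\<eta> / (6 * H)\<close> before multiplication by \<open>H\<close>.\<close>
    define e where "e = ln (1 + \<eta> / (3 * (Y + 1))) / \<beta>"
    have e: "0 < e" unfolding e_def using \<eta> Y'(2) \<beta>_pos by (intro divide_pos_pos ln_gt_zero) auto
    have "exp (\<beta> * e) - 1 = \<eta> / (3 * (Y + 1))"
      using \<eta> Y'(2) \<beta>_pos by (simp add: e_def add_pos_nonneg)
    then have e': "(exp (\<beta> * e) - 1) * Y \<le> \<eta> / 3"
      using \<eta> Y'(2) by (simp add: pos_divide_le_eq mult_left_mono)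
    define G where "G = 2 * exp (p * \<beta> * C) * (d + exp K + D) ^ ?n"
    have G: "0 \<le> G" using d(2) D(1) by (simp add: G_def add_nonneg_nonneg)
    define L where "L = ln (3 * (G + 1) / \<eta>) / (p - 1)"
    have "exp (- ((p - 1) * L)) = \<eta> / (3 * (G + 1))"
      using p \<eta> G by (simp add: L_def exp_minus)
    then have L: "exp (- ((p - 1) * L)) * G \<le> \<eta> / 3"
      using \<eta> G by (simp add: pos_divide_le_eq mult_left_mono)
    define H where "H = 2 * exp L * (real ?n + 1)"
    have H: "0 < H" by (simp add: H_def add_nonneg_pos)
    \<comment> \<open>The summand 1 under the logarithm makes it nonnegative, so that
      \<open>exp (\<kappa> * R^2)\<close> recovers its argument exactly.\<close>
    define R where "R = sqrt (ln (6 * H * (d + 1) / \<eta> + 1) / \<kappa>)"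
    have R: "0 \<le> R" using H d(2) \<eta> \<kappa>0 by (simp add: R_def)
    have "exp (\<kappa> * R\<^sup>2) = 6 * H * (d + 1) / \<eta> + 1"
      using H d(2) \<eta> \<kappa>0 by (simp add: R_def add_nonneg_pos)
    then have "6 * H * d / \<eta> \<le> exp (\<kappa> * R\<^sup>2)"
      using H \<eta> by (simp add: field_simps)
    then have R': "1 / exp (\<kappa> * R\<^sup>2) * d \<le> \<eta> / (6 * H)"
      using H \<eta> by (simp add: field_simps)
    obtain \<epsilon> where \<epsilon>: "0 < \<epsilon>" and modulus:
      "\<And>\<tau> x z. \<tau> \<in> {0..\<beta>} \<Longrightarrow> (\<And>j. j \<in> \<Lambda> \<Longrightarrow> \<bar>x j\<bar> \<le> R) \<Longrightarrow> (\<And>j. j \<in> \<Lambda> \<Longrightarrow> \<bar>z j - x j\<bar> \<le> \<epsilon>) \<Longrightarrow>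
         \<bar>energy_density \<tau> z - energy_density \<tau> x\<bar> \<le> e"
      using energy_density_modulus[OF e, of R] by blast
    have "?I m \<le> ennreal \<eta>" if m: "m \<ge> max m0 1" "m \<ge> 6 * H * D / (\<eta> * \<epsilon> ^ 8)" for m
    proof -
      have m1: "1 \<le> m" "0 < m" "m0 \<le> m" using m by auto
      note \<gamma> = gaussian[OF m1(2)]
      have m4: "m \<le> m ^ 4" using m1(1) by (simp add: self_le_power)
      have S: "(\<integral>\<^sup>+ \<omega>. chain_sum \<beta> K \<omega> \<partial>\<gamma> m) \<le> ennreal (D / m ^ 4)" by (rule D(2)[OF m1(3,2) \<gamma>])
      also have "D / m ^ 4 \<le> D" using D(1) m1 m4 by (simp add: divide_le_eq mult_left_le_one_le mult_le_cancel_left1)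
      finally have S1: "(\<integral>\<^sup>+ \<omega>. chain_sum \<beta> K \<omega> \<partial>\<gamma> m) \<le> ennreal D"
        by (simp add: ennreal_leI)
      have "1 / \<epsilon> ^ 8 * (D / m ^ 4) \<le> 1 / \<epsilon> ^ 8 * (D / m)"
        using D(1) \<epsilon> m1 m4 by (intro mult_left_mono divide_left_mono) auto
      also have "\<dots> \<le> \<eta> / (6 * H)"
        using m(2) \<epsilon> \<eta> H m1(2) by (simp add: field_simps)
      finally have m': "1 / \<epsilon> ^ 8 * (D / m ^ 4) \<le> \<eta> / (6 * H)" .
      have "?I m \<le> ennreal (exp (\<beta> * e) - 1) * ennreal Y
        + ennreal (2 * exp L) * (of_nat ?n * (ennreal (1 / exp (\<kappa> * R\<^sup>2)) * ennreal d
            + ennreal (1 / \<epsilon> ^ 8) * (\<integral>\<^sup>+ \<omega>. chain_sum \<beta> K \<omega> \<partial>\<gamma> m)))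
        + ennreal (2 * exp (- ((p - 1) * L)) * exp (p * \<beta> * C))
          * (ennreal d + ennreal (exp K) + (\<integral>\<^sup>+ \<omega>. chain_sum \<beta> K \<omega> \<partial>\<gamma> m)) ^ ?n"
        using weight_L1_le[where L=L, OF aux \<gamma> R e \<epsilon> modulus] unfolding d(1) Y'(1) .
      also have "\<dots> \<le> ennreal (exp (\<beta> * e) - 1) * ennreal Y
        + ennreal (2 * exp L) * (of_nat ?n * (ennreal (1 / exp (\<kappa> * R\<^sup>2)) * ennreal d
            + ennreal (1 / \<epsilon> ^ 8) * ennreal (D / m ^ 4)))
        + ennreal (2 * exp (- ((p - 1) * L)) * exp (p * \<beta> * C))
          * (ennreal d + ennreal (exp K) + ennreal D) ^ ?n"
        by (intro add_mono mult_left_mono power_mono S S1 order_refl) auto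
      also have "\<dots> = ennreal ((exp (\<beta> * e) - 1) * Y
        + 2 * exp L * (real ?n * (1 / exp (\<kappa> * R\<^sup>2) * d + 1 / \<epsilon> ^ 8 * (D / m ^ 4)))
        + 2 * exp (- ((p - 1) * L)) * exp (p * \<beta> * C) * (d + exp K + D) ^ ?n)"
      proof -
        have n1: "0 \<le> exp (\<beta> * e) - 1" using e \<beta>_pos by simp
        have n2: "0 \<le> 1 / exp (\<kappa> * R\<^sup>2) * d" "0 \<le> 1 / \<epsilon> ^ 8 * (D / m ^ 4)" using d(2) D(1) by auto
        have n3: "0 \<le> d + exp K + D" using d(2) D(1) by (simp add: add_nonneg_nonneg)
        have 1: "of_nat ?n * (ennreal (1 / exp (\<kappa> * R\<^sup>2)) * ennreal d + ennreal (1 / \<epsilon> ^ 8) * ennreal (D / m ^ 4))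
            = ennreal (real ?n * (1 / exp (\<kappa> * R\<^sup>2) * d + 1 / \<epsilon> ^ 8 * (D / m ^ 4)))"
        proof -
          have "of_nat ?n = ennreal (real ?n)" by (simp add: ennreal_of_nat_eq_real_of_nat)
          moreover have "ennreal (1 / exp (\<kappa> * R\<^sup>2)) * ennreal d = ennreal (1 / exp (\<kappa> * R\<^sup>2) * d)"
            using d(2) by (intro ennreal_mult[symmetric]) auto
          moreover have "ennreal (1 / \<epsilon> ^ 8) * ennreal (D / m ^ 4) = ennreal (1 / \<epsilon> ^ 8 * (D / m ^ 4))"
            using D(1) by (intro ennreal_mult[symmetric]) auto
          ultimately show ?thesis
            using n2 by (simp only: ennreal_plus[symmetric] ennreal_mult[symmetric] add_nonneg_nonneg of_nat_0_le_iff)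
        qed
        have 2: "(ennreal d + ennreal (exp K) + ennreal D) ^ ?n = ennreal ((d + exp K + D) ^ ?n)"
          using d(2) D(1) n3 by (simp add: ennreal_power[symmetric])
        have n4: "0 \<le> real ?n * (1 / exp (\<kappa> * R\<^sup>2) * d + 1 / \<epsilon> ^ 8 * (D / m ^ 4))" "0 \<le> (d + exp K + D) ^ ?n"
          by (rule mult_nonneg_nonneg[OF of_nat_0_le_iff add_nonneg_nonneg[OF n2]]) (rule zero_le_power[OF n3])
        show ?thesis
          unfolding 1 2 by (rule ennreal_combination3) (use n1 n4 Y'(2) in simp_all)
      qed
      also have "\<dots> \<le> ennreal \<eta>"
      proof (rule ennreal_leI)
        have "real ?n * (1 / exp (\<kappa> * R\<^sup>2) * d + 1 / \<epsilon> ^ 8 * (D / m ^ 4))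
            \<le> (real ?n + 1) * (\<eta> / (6 * H) + \<eta> / (6 * H))"
          using R' m' d(2) D(1) by (intro mult_mono add_mono) auto
        then have "2 * exp L * (real ?n * (1 / exp (\<kappa> * R\<^sup>2) * d + 1 / \<epsilon> ^ 8 * (D / m ^ 4)))
            \<le> 2 * exp L * ((real ?n + 1) * (\<eta> / (6 * H) + \<eta> / (6 * H)))"
          by (rule mult_left_mono) simp
        also have "\<dots> = H * (\<eta> / (6 * H) + \<eta> / (6 * H))" by (simp only: H_def mult.assoc)
        also have "\<dots> = \<eta> / 3" using H by (simp add: field_simps)
        finally have 2: "2 * exp L * (real ?n * (1 / exp (\<kappa> * R\<^sup>2) * d + 1 / \<epsilon> ^ 8 * (D / m ^ 4))) \<le> \<eta> / 3" .
        have 3: "2 * exp (- ((p - 1) * L)) * exp (p * \<beta> * C) * (d + exp K + D) ^ ?n \<le> \<eta> / 3"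
          using L by (simp add: G_def mult_ac)
        show "(exp (\<beta> * e) - 1) * Y
          + 2 * exp L * (real ?n * (1 / exp (\<kappa> * R\<^sup>2) * d + 1 / \<epsilon> ^ 8 * (D / m ^ 4)))
          + 2 * exp (- ((p - 1) * L)) * exp (p * \<beta> * C) * (d + exp K + D) ^ ?n \<le> \<eta>"
          using e' 2 3 by linarith
      qed
      finally show ?thesis .
    qed
    note bound = this
    show ?thesis
      using eventually_ge_at_top[of "max m0 1"] eventually_ge_at_top[of "6 * H * D / (\<eta> * \<epsilon> ^ 8)"]
      by eventually_elim (rule bound)
  qed
  \<comment> \<open>No \<open>ennreal\<close> lies below 0, so only upper bounds matter. A given
    \<open>z\<close> may be infinite and is replaced by a finite positive \<open>w\<close> below
    it.\<close>
  show "(?I \<longlongrightarrow> 0) at_top"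
  proof (rule order_tendstoI)
    fix z :: ennreal assume "0 < z"
    then obtain w where w: "0 < w" "w < z" using dense by blast
    have "w < \<top>" using w(2) top_greatest by (rule less_le_trans)
    with w(1) have e: "0 < enn2real w" "ennreal (enn2real w) = w"
      by (simp_all add: enn2real_positive_iff)
    from main[OF e(1), unfolded e(2)] show "eventually (\<lambda>m. ?I m < z) at_top"
      by eventually_elim (rule le_less_trans[OF _ w(2)])
  qed simp
qed

text \<open>For each positive mass the classical weight evaluated at the means integrates to exactly
  the classical integral, so the error is at most \<open>G\<close> times the L1 distance of the
  weights. Integrability of the quantum weight follows from that distance being finite, hence it is
  asserted eventually.\<close>

lemma weighted_integral_tendsto:
  assumes gaussian: "\<And>m. m > 0 \<Longrightarrow> is_gaussian_loop_measure \<beta> m (\<gamma> m)"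
    and h: "h \<in> borel_measurable (PiM \<Lambda> (\<lambda>_. borel))" and bound: "\<And>x. \<bar>h x\<bar> \<le> G"
  shows "((\<lambda>m. \<integral>\<omega>. h (means \<omega>) * quantum_weight \<omega> \<partial>PiM \<Lambda> (\<lambda>_. \<gamma> m))
      \<longlongrightarrow> (\<integral>x. h x * classical_weight x \<partial>classical_reference \<beta> \<Lambda>)) at_top"
    and "eventually (\<lambda>m. integrable (PiM \<Lambda> (\<lambda>_. \<gamma> m)) quantum_weight) at_top"
    and "integrable (classical_reference \<beta> \<Lambda>) classical_weight"
proof -
  let ?P = "\<lambda>m. PiM \<Lambda> (\<lambda>_. \<gamma> m)"
  let ?I = "\<lambda>m. \<integral>\<^sup>+ \<omega>. ennreal \<bar>quantum_weight \<omega> - classical_weight (means \<omega>)\<bar> \<partial>?P m"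
  have L1: "(\<integral>\<^sup>+ x. ennreal (classical_weight x) \<partial>classical_reference \<beta> \<Lambda>) < \<top>" "(?I \<longlongrightarrow> 0) at_top"
    using weight_L1_tendsto[of \<gamma>] gaussian by blast+
  have sets_ref: "sets (classical_reference \<beta> \<Lambda>) = sets (PiM \<Lambda> (\<lambda>_. borel))"
    unfolding classical_reference_def by (intro sets_PiM_cong) auto
  have Vm: "classical_weight \<in> borel_measurable (classical_reference \<beta> \<Lambda>)"
    using classical_weight_measurable measurable_cong_sets[OF sets_ref refl] by blast
  show Vi: "integrable (classical_reference \<beta> \<Lambda>) classical_weight"
    using L1(1) Vm by (intro integrableI_bounded) auto
  have key: "integrable (?P m) quantum_weight \<and>
      \<bar>(\<integral>\<omega>. h (means \<omega>) * quantum_weight \<omega> \<partial>?P m) - (\<integral>x. h x * classical_weight x \<partial>classical_reference \<beta> \<Lambda>)\<bar>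
        \<le> G * enn2real (?I m)" if m: "0 < m" and fin: "?I m < \<top>" for m
  proof -
    note \<gamma> = gaussian[OF m]
    have ref: "means \<in> ?P m \<rightarrow>\<^sub>M PiM \<Lambda> (\<lambda>_. borel)"
      "distr (?P m) (PiM \<Lambda> (\<lambda>_. borel)) means = classical_reference \<beta> \<Lambda>"
      using classical_reference_law[OF \<gamma>] by auto
    have Wm [measurable]: "quantum_weight \<in> borel_measurable (?P m)"
      using \<gamma> by (intro quantum_weight_measurable) (simp add: is_gaussian_loop_measure_def)
    have hm [measurable]: "(\<lambda>\<omega>. h (means \<omega>)) \<in> borel_measurable (?P m)"
      by (rule measurable_compose[OF ref(1) h])
    have Vmm [measurable]: "(\<lambda>\<omega>. classical_weight (means \<omega>)) \<in> borel_measurable (?P m)"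
      by (rule measurable_compose[OF ref(1) classical_weight_measurable])
    have iV: "integrable (?P m) (\<lambda>\<omega>. classical_weight (means \<omega>))"
      using Vi unfolding ref(2)[symmetric]
      by (subst (asm) integrable_distr_eq[OF ref(1) classical_weight_measurable])
    have iD: "integrable (?P m) (\<lambda>\<omega>. quantum_weight \<omega> - classical_weight (means \<omega>))"
      by (rule integrableI_bounded[OF borel_measurable_diff[OF Wm Vmm]]) (use fin in simp)
    have iW: "integrable (?P m) quantum_weight"
      using Bochner_Integration.integrable_add[OF iD iV] by simp
    have iB: "integrable (?P m) (\<lambda>\<omega>. h (means \<omega>) * F \<omega>)" if "integrable (?P m) F" for F :: "_ \<Rightarrow> real"
    proof (rule Bochner_Integration.integrable_bound)
      show "integrable (?P m) (\<lambda>\<omega>. G * F \<omega>)" using that by simp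
      have "\<bar>h (means \<omega>)\<bar> * \<bar>F \<omega>\<bar> \<le> \<bar>G\<bar> * \<bar>F \<omega>\<bar>" for \<omega>
        using bound[of "means \<omega>"] by (intro mult_right_mono) auto
      then show "AE \<omega> in ?P m. norm (h (means \<omega>) * F \<omega>) \<le> norm (G * F \<omega>)" by (simp add: abs_mult)
      show "(\<lambda>\<omega>. h (means \<omega>) * F \<omega>) \<in> borel_measurable (?P m)"
        using borel_measurable_integrable[OF that] by measurable
    qed
    have hVm: "(\<lambda>x. h x * classical_weight x) \<in> borel_measurable (PiM \<Lambda> (\<lambda>_. borel))"
      using h classical_weight_measurable by (rule borel_measurable_times)
    have "(\<integral>x. h x * classical_weight x \<partial>classical_reference \<beta> \<Lambda>) =
        (\<integral>\<omega>. h (means \<omega>) * classical_weight (means \<omega>) \<partial>?P m)"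
      unfolding ref(2)[symmetric] by (rule integral_distr[OF ref(1) hVm])
    then have diff: "(\<integral>\<omega>. h (means \<omega>) * quantum_weight \<omega> \<partial>?P m) - (\<integral>x. h x * classical_weight x \<partial>classical_reference \<beta> \<Lambda>)
        = (\<integral>\<omega>. h (means \<omega>) * (quantum_weight \<omega> - classical_weight (means \<omega>)) \<partial>?P m)"
      using Bochner_Integration.integral_diff[OF iB[OF iW] iB[OF iV]] by (simp only: right_diff_distrib)
    have "\<bar>\<integral>\<omega>. h (means \<omega>) * (quantum_weight \<omega> - classical_weight (means \<omega>)) \<partial>?P m\<bar> \<le> (\<integral>\<omega>. \<bar>h (means \<omega>) * (quantum_weight \<omega> - classical_weight (means \<omega>))\<bar> \<partial>?P m)"
      by (rule integral_abs_bound)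
    also have "\<dots> \<le> (\<integral>\<omega>. G * \<bar>quantum_weight \<omega> - classical_weight (means \<omega>)\<bar> \<partial>?P m)"
    proof (rule integral_mono)
      show "integrable (?P m) (\<lambda>\<omega>. \<bar>h (means \<omega>) * (quantum_weight \<omega> - classical_weight (means \<omega>))\<bar>)"
        using iB[OF iD] by (rule integrable_abs)
      show "integrable (?P m) (\<lambda>\<omega>. G * \<bar>quantum_weight \<omega> - classical_weight (means \<omega>)\<bar>)"
        using integrable_abs[OF iD] by simp
      fix \<omega>
      show "\<bar>h (means \<omega>) * (quantum_weight \<omega> - classical_weight (means \<omega>))\<bar>
          \<le> G * \<bar>quantum_weight \<omega> - classical_weight (means \<omega>)\<bar>"
        unfolding abs_mult by (intro mult_right_mono bound) simp
    qed
    also have "\<dots> = G * enn2real (?I m)"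
      using iD by (subst integral_mult_right_zero, subst integral_eq_nn_integral) auto
    finally show ?thesis using iW unfolding diff by blast
  qed
  have ev: "eventually (\<lambda>m. 0 < m \<and> ?I m < \<top>) at_top"
    by (intro eventually_conj eventually_gt_at_top order_tendstoD(2)[OF L1(2)]) simp_all
  show "eventually (\<lambda>m. integrable (?P m) quantum_weight) at_top"
    using ev by eventually_elim (use key in blast)
  have "((\<lambda>m. enn2real (?I m)) \<longlongrightarrow> 0) at_top"
    by (rule tendsto_enn2real) (simp_all only: ennreal_0 L1(2) order_refl)
  from tendsto_mult[OF tendsto_const[of G] this]
  have lim: "((\<lambda>m. G * enn2real (?I m)) \<longlongrightarrow> 0) at_top" by (simp only: mult_zero_right)
  have "((\<lambda>m. (\<integral>\<omega>. h (means \<omega>) * quantum_weight \<omega> \<partial>?P m) - (\<integral>x. h x * classical_weight x \<partial>classical_reference \<beta> \<Lambda>))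
      \<longlongrightarrow> 0) at_top"
  proof (rule Lim_null_comparison[OF _ lim])
    show "eventually (\<lambda>m. norm ((\<integral>\<omega>. h (means \<omega>) * quantum_weight \<omega> \<partial>?P m)
        - (\<integral>x. h x * classical_weight x \<partial>classical_reference \<beta> \<Lambda>)) \<le> G * enn2real (?I m)) at_top"
      using ev by eventually_elim (use key in \<open>unfold real_norm_def, blast\<close>)
  qed
  then show "((\<lambda>m. \<integral>\<omega>. h (means \<omega>) * quantum_weight \<omega> \<partial>?P m)
      \<longlongrightarrow> (\<integral>x. h x * classical_weight x \<partial>classical_reference \<beta> \<Lambda>)) at_top"
    by (simp add: LIM_zero_iff)
qed

end

subsection \<open>Convergence of the kernels\<close>

lemma sets_classical_reference: "sets (classical_reference \<beta> \<Lambda>) = sets (PiM \<Lambda> (\<lambda>_. borel))"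
  unfolding classical_reference_def by (intro sets_PiM_cong) auto

text \<open>Over a countable index set the Borel sets of the product topology form the product
  sigma-algebra, so measurability of the coordinates suffices.\<close>

lemma measurable_countable_borel:
  fixes F :: "'a \<Rightarrow> 'i::countable \<Rightarrow> real"
  assumes "\<And>i. (\<lambda>x. F x i) \<in> borel_measurable M"
  shows "F \<in> borel_measurable M"
proof -
  have "(\<lambda>x i. F x i) \<in> M \<rightarrow>\<^sub>M PiM UNIV (\<lambda>_. borel)"
    by (rule measurable_PiM_single') (use assms in auto)
  then show ?thesis using measurable_cong_sets[OF refl sets_PiM_equal_borel] by auto
qed

lemma space_Omega_sigma: "space (Omega_sigma \<beta>) = topspace (Omega_top \<beta>)"
  by (simp add: Omega_sigma_def Omega_top_def space_PiM space_loop_borel)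

lemma Upsilon_means:
  assumes "\<omega> \<in> topspace (Omega_top \<beta>)"
  shows "\<omega> \<in> Upsilon \<beta> (\<lambda>j. dyadic_mean \<beta> 0 0 (\<omega> j))"
  using assms by (simp add: Upsilon_def dyadic_mean_0)

context lattice_system
begin

lemma merge_mem:
  assumes "\<omega> \<in> space (PiM \<Lambda> (\<lambda>_. loop_borel \<beta>))"
  shows "merge \<Lambda> (- \<Lambda>) (\<omega>, \<zeta>) \<in> topspace (Omega_top \<beta>)"
  using assms \<zeta>_loop by (auto simp: Omega_top_def space_PiM space_loop_borel merge_def)

text \<open>Averaging commutes with gluing because the loops of \<open>\<zeta>\<close> have averages
  \<open>y\<close>; this matches the boundary conditions of the two kernels.\<close>

lemma means_merge:
  "(\<lambda>j. dyadic_mean \<beta> 0 0 (merge \<Lambda> (- \<Lambda>) (\<omega>, \<zeta>) j)) = merge \<Lambda> (- \<Lambda>) (means \<omega>, y)"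
proof
  fix j
  have "dyadic_mean \<beta> 0 0 (\<zeta> j) = y j" using \<zeta> by (simp add: Upsilon_def dyadic_mean_0)
  then show "dyadic_mean \<beta> 0 0 (merge \<Lambda> (- \<Lambda>) (\<omega>, \<zeta>) j) = merge \<Lambda> (- \<Lambda>) (means \<omega>, y) j"
    by (simp add: merge_def compose_def)
qed

lemma merge_measurable:
  assumes "sets M = sets (PiM \<Lambda> (\<lambda>_. loop_borel \<beta>))"
  shows "(\<lambda>\<omega>. merge \<Lambda> (- \<Lambda>) (\<omega>, \<zeta>)) \<in> M \<rightarrow>\<^sub>M Omega_sigma \<beta>"
  unfolding measurable_cong_sets[OF assms refl] Omega_sigma_def
proof (rule measurable_PiM_single')
  fix j :: "int ^ 'd"
  show "(\<lambda>\<omega>. merge \<Lambda> (- \<Lambda>) (\<omega>, \<zeta>) j) \<in> PiM \<Lambda> (\<lambda>_. loop_borel \<beta>) \<rightarrow>\<^sub>M loop_borel \<beta>"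
    using \<zeta>_loop[of j] by (cases "j \<in> \<Lambda>") (auto simp: merge_def space_loop_borel)
next
  show "(\<lambda>\<omega>. merge \<Lambda> (- \<Lambda>) (\<omega>, \<zeta>)) \<in> space (PiM \<Lambda> (\<lambda>_. loop_borel \<beta>)) \<rightarrow> (\<Pi>\<^sub>E i\<in>UNIV. space (loop_borel \<beta>))"
    using merge_mem by (auto simp: Omega_top_def space_loop_borel)
qed

lemma merge_borel_measurable:
  assumes "sets M = sets (PiM \<Lambda> (\<lambda>_. borel))"
  shows "(\<lambda>x. merge \<Lambda> (- \<Lambda>) (x, y)) \<in> borel_measurable M"
  unfolding measurable_cong_sets[OF assms refl]
proof (rule measurable_countable_borel)
  fix j :: "int ^ 'd"
  show "(\<lambda>x. merge \<Lambda> (- \<Lambda>) (x, y) j) \<in> borel_measurable (PiM \<Lambda> (\<lambda>_. borel))"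
    by (cases "j \<in> \<Lambda>") (auto simp: merge_def)
qed

text \<open>Since \<open>f\<close> is \<open>g\<close> applied to the averages, it is measurable for
  the cylinder sigma-algebra, and on glued configurations it depends on \<open>\<omega>\<close> only
  through the means.\<close>

lemma integral_quantum_kernel:
  fixes g :: "(int ^ 'd \<Rightarrow> real) \<Rightarrow> real"
  assumes \<gamma>: "is_gaussian_loop_measure \<beta> m \<gamma>"
    and W: "integrable (PiM \<Lambda> (\<lambda>_. \<gamma>)) quantum_weight"
    and g: "continuous_on UNIV g"
    and fg: "\<And>x \<omega>. \<omega> \<in> Upsilon \<beta> x \<Longrightarrow> f \<omega> = g x"
  shows "(\<integral>\<omega>. f \<omega> \<partial>quantum_kernel J U \<beta> \<gamma> \<Lambda> \<zeta>) =
      (\<integral>\<omega>. g (merge \<Lambda> (- \<Lambda>) (means \<omega>, y)) * quantum_weight \<omega> \<partial>PiM \<Lambda> (\<lambda>_. \<gamma>)) /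
      (\<integral>\<omega>. quantum_weight \<omega> \<partial>PiM \<Lambda> (\<lambda>_. \<gamma>))"
proof -
  have \<gamma>': "prob_space \<gamma>" "sets \<gamma> = sets (loop_borel \<beta>)"
    using \<gamma> by (auto simp: is_gaussian_loop_measure_def)
  have sets_P: "sets (PiM \<Lambda> (\<lambda>_. \<gamma>)) = sets (PiM \<Lambda> (\<lambda>_. loop_borel \<beta>))"
    by (intro sets_PiM_cong \<gamma>'(2)) auto
  have sets_Q: "sets (quantum_local J U \<beta> \<gamma> \<Lambda> \<zeta>) = sets (PiM \<Lambda> (\<lambda>_. loop_borel \<beta>))"
    by (simp add: quantum_local_def Let_def sets_P)
  have f: "f \<omega> = g (\<lambda>j. dyadic_mean \<beta> 0 0 (\<omega> j))" if "\<omega> \<in> topspace (Omega_top \<beta>)" for \<omega>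
    by (rule fg[OF Upsilon_means[OF that]])
  have "(\<lambda>\<omega>. dyadic_mean \<beta> 0 0 (\<omega> j)) \<in> borel_measurable (Omega_sigma \<beta>)" for j :: "int ^ 'd"
  proof -
    have "dyadic_mean \<beta> 0 0 \<in> borel_measurable (loop_borel \<beta>)"
      using mean_law(1)[OF \<gamma> \<beta>_pos] measurable_cong_sets[OF \<gamma>'(2) refl] by blast
    from measurable_compose[OF measurable_component_singleton[of j UNIV "\<lambda>_. loop_borel \<beta>"] this]
    show ?thesis by (simp add: Omega_sigma_def)
  qed
  then have "(\<lambda>\<omega> (j :: int ^ 'd). dyadic_mean \<beta> 0 0 (\<omega> j)) \<in> borel_measurable (Omega_sigma \<beta>)"
    by (rule measurable_countable_borel)
  from measurable_compose[OF this borel_measurable_continuous_onI[OF g]]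
  have fm: "f \<in> borel_measurable (Omega_sigma \<beta>)"
    by (subst measurable_cong[OF f]) (simp_all add: space_Omega_sigma)
  have "(\<integral>\<omega>. f \<omega> \<partial>quantum_kernel J U \<beta> \<gamma> \<Lambda> \<zeta>) =
      (\<integral>\<omega>. f (merge \<Lambda> (- \<Lambda>) (\<omega>, \<zeta>)) \<partial>quantum_local J U \<beta> \<gamma> \<Lambda> \<zeta>)"
    unfolding quantum_kernel_def by (rule integral_distr[OF merge_measurable[OF sets_Q] fm])
  also have "\<dots> = (\<integral>\<omega>. f (merge \<Lambda> (- \<Lambda>) (\<omega>, \<zeta>)) * quantum_weight \<omega> \<partial>PiM \<Lambda> (\<lambda>_. \<gamma>)) /
      (\<integral>\<omega>. quantum_weight \<omega> \<partial>PiM \<Lambda> (\<lambda>_. \<gamma>))"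
    unfolding quantum_local_def Let_def
    by (rule integral_normalized_density(1)[OF prob_space_PiM[OF \<gamma>'(1)] W])
      (use measurable_compose[OF merge_measurable[OF sets_P] fm] in auto)
  also have "(\<integral>\<omega>. f (merge \<Lambda> (- \<Lambda>) (\<omega>, \<zeta>)) * quantum_weight \<omega> \<partial>PiM \<Lambda> (\<lambda>_. \<gamma>)) =
      (\<integral>\<omega>. g (merge \<Lambda> (- \<Lambda>) (means \<omega>, y)) * quantum_weight \<omega> \<partial>PiM \<Lambda> (\<lambda>_. \<gamma>))"
  proof (rule Bochner_Integration.integral_cong[OF refl])
    fix \<omega> assume "\<omega> \<in> space (PiM \<Lambda> (\<lambda>_. \<gamma>))"
    then have "merge \<Lambda> (- \<Lambda>) (\<omega>, \<zeta>) \<in> topspace (Omega_top \<beta>)"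
      by (intro merge_mem) (simp only: sets_eq_imp_space_eq[OF sets_P])
    from f[OF this] show "f (merge \<Lambda> (- \<Lambda>) (\<omega>, \<zeta>)) * quantum_weight \<omega> =
        g (merge \<Lambda> (- \<Lambda>) (means \<omega>, y)) * quantum_weight \<omega>"
      by (simp only: means_merge)
  qed
  finally show ?thesis .
qed

lemma integral_classical_kernel:
  fixes g :: "(int ^ 'd \<Rightarrow> real) \<Rightarrow> real"
  assumes ref: "prob_space (classical_reference \<beta> \<Lambda>)"
    and V: "integrable (classical_reference \<beta> \<Lambda>) classical_weight"
    and g: "continuous_on UNIV g"
  shows "(\<integral>x. g x \<partial>classical_kernel J U \<beta> \<Lambda> y) =
      (\<integral>x. g (merge \<Lambda> (- \<Lambda>) (x, y)) * classical_weight x \<partial>classical_reference \<beta> \<Lambda>) /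
      (\<integral>x. classical_weight x \<partial>classical_reference \<beta> \<Lambda>)"
proof -
  have gm: "g \<in> borel_measurable borel" by (rule borel_measurable_continuous_onI[OF g])
  have "sets (classical_local J U \<beta> \<Lambda> y) = sets (PiM \<Lambda> (\<lambda>_. borel))"
    by (simp add: classical_local_def Let_def sets_classical_reference)
  then have "(\<integral>x. g x \<partial>classical_kernel J U \<beta> \<Lambda> y) =
      (\<integral>x. g (merge \<Lambda> (- \<Lambda>) (x, y)) \<partial>classical_local J U \<beta> \<Lambda> y)"
    unfolding classical_kernel_def by (intro integral_distr gm merge_borel_measurable)
  also have "\<dots> = (\<integral>x. g (merge \<Lambda> (- \<Lambda>) (x, y)) * classical_weight x \<partial>classical_reference \<beta> \<Lambda>) /
      (\<integral>x. classical_weight x \<partial>classical_reference \<beta> \<Lambda>)"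
    unfolding classical_local_def Let_def
    by (rule integral_normalized_density(1)[OF ref V])
      (use measurable_compose[OF merge_borel_measurable[OF sets_classical_reference] gm] in auto)
  finally show ?thesis .
qed

text \<open>Both sides are quotients of weighted integrals. The numerator is the case of
  \<open>g\<close> after gluing with \<open>y\<close>, the denominator that of the constant 1, whose
  limit is positive. The quotient formula for the quantum kernel holds once the weight is
  integrable, that is for large \<open>m\<close>.\<close>

lemma kernel_tendsto:
  fixes g :: "(int ^ 'd \<Rightarrow> real) \<Rightarrow> real"
  assumes gaussian: "\<And>m. m > 0 \<Longrightarrow> is_gaussian_loop_measure \<beta> m (\<gamma> m)"
    and g: "continuous_on UNIV g" and g_bdd: "bounded (range g)"
    and fg: "\<And>x \<omega>. \<omega> \<in> Upsilon \<beta> x \<Longrightarrow> f \<omega> = g x"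
  shows "((\<lambda>m. \<integral>\<omega>. f \<omega> \<partial>quantum_kernel J U \<beta> (\<gamma> m) \<Lambda> \<zeta>)
           \<longlongrightarrow> (\<integral>x. g x \<partial>classical_kernel J U \<beta> \<Lambda> y)) at_top"
proof -
  obtain G where G: "\<And>x. \<bar>g x\<bar> \<le> G" using g_bdd by (auto simp: bounded_iff)
  have \<gamma>1: "is_gaussian_loop_measure \<beta> 1 (\<gamma> 1)" by (rule gaussian) simp
  then have "prob_space (PiM \<Lambda> (\<lambda>_. \<gamma> 1))"
    by (intro prob_space_PiM) (simp add: is_gaussian_loop_measure_def)
  from prob_space.prob_space_distr[OF this classical_reference_law(1)[OF \<gamma>1]]
  have ref: "prob_space (classical_reference \<beta> \<Lambda>)"
    unfolding classical_reference_law(2)[OF \<gamma>1] .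
  have gm: "(\<lambda>x. g (merge \<Lambda> (- \<Lambda>) (x, y))) \<in> borel_measurable (PiM \<Lambda> (\<lambda>_. borel))"
    by (rule measurable_compose[OF merge_borel_measurable borel_measurable_continuous_onI[OF g]]) simp
  have num: "((\<lambda>m. \<integral>\<omega>. g (merge \<Lambda> (- \<Lambda>) (means \<omega>, y)) * quantum_weight \<omega> \<partial>PiM \<Lambda> (\<lambda>_. \<gamma> m))
      \<longlongrightarrow> (\<integral>x. g (merge \<Lambda> (- \<Lambda>) (x, y)) * classical_weight x \<partial>classical_reference \<beta> \<Lambda>)) at_top"
    "eventually (\<lambda>m. integrable (PiM \<Lambda> (\<lambda>_. \<gamma> m)) quantum_weight) at_top"
    "integrable (classical_reference \<beta> \<Lambda>) classical_weight"
    by (rule weighted_integral_tendsto[OF _ gm G]; rule gaussian; assumption)+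
  have den: "((\<lambda>m. \<integral>\<omega>. quantum_weight \<omega> \<partial>PiM \<Lambda> (\<lambda>_. \<gamma> m))
      \<longlongrightarrow> (\<integral>x. classical_weight x \<partial>classical_reference \<beta> \<Lambda>)) at_top"
    using weighted_integral_tendsto(1)[OF gaussian, of "\<lambda>_. 1" 1] by simp
  have "0 < (\<integral>x. classical_weight x \<partial>classical_reference \<beta> \<Lambda>)"
    using integral_normalized_density(2)[OF ref num(3), of "\<lambda>_. 0"] by simp
  then have nz: "(\<integral>x. classical_weight x \<partial>classical_reference \<beta> \<Lambda>) \<noteq> 0" by (rule less_imp_neq[THEN not_sym])
  have "((\<lambda>m. (\<integral>\<omega>. g (merge \<Lambda> (- \<Lambda>) (means \<omega>, y)) * quantum_weight \<omega> \<partial>PiM \<Lambda> (\<lambda>_. \<gamma> m)) /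
      (\<integral>\<omega>. quantum_weight \<omega> \<partial>PiM \<Lambda> (\<lambda>_. \<gamma> m)))
      \<longlongrightarrow> (\<integral>x. g (merge \<Lambda> (- \<Lambda>) (x, y)) * classical_weight x \<partial>classical_reference \<beta> \<Lambda>) /
      (\<integral>x. classical_weight x \<partial>classical_reference \<beta> \<Lambda>)) at_top"
    by (intro tendsto_divide num(1) den nz)
  moreover have "eventually (\<lambda>m. (\<integral>\<omega>. g (merge \<Lambda> (- \<Lambda>) (means \<omega>, y)) * quantum_weight \<omega> \<partial>PiM \<Lambda> (\<lambda>_. \<gamma> m)) /
      (\<integral>\<omega>. quantum_weight \<omega> \<partial>PiM \<Lambda> (\<lambda>_. \<gamma> m)) = (\<integral>\<omega>. f \<omega> \<partial>quantum_kernel J U \<beta> (\<gamma> m) \<Lambda> \<zeta>)) at_top"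
    using num(2) eventually_gt_at_top[of "0::real"]
  proof eventually_elim
    case (elim m)
    show ?case using integral_quantum_kernel[OF gaussian[OF elim(2)] elim(1) g fg] by simp
  qed
  ultimately show ?thesis
    unfolding integral_classical_kernel[OF ref num(3) g] by (rule Lim_transform_eventually)
qed

end

theorem theorem3p3:
  fixes J :: "int ^ 'd \<Rightarrow> int ^ 'd \<Rightarrow> real"
    and U :: "int ^ 'd \<Rightarrow> real \<Rightarrow> real"
    and r c b c' \<beta> :: real
    and \<gamma> :: "real \<Rightarrow> (real \<Rightarrow> real) measure"
    and \<Lambda> :: "(int ^ 'd) set"
    and y :: "int ^ 'd \<Rightarrow> real"
    and \<zeta> :: "int ^ 'd \<Rightarrow> real \<Rightarrow> real"
    and f :: "(int ^ 'd \<Rightarrow> real \<Rightarrow> real) \<Rightarrow> real"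
    and g :: "(int ^ 'd \<Rightarrow> real) \<Rightarrow> real"
  assumes J_sym: "\<And>j k. J j k = J k j"
    and r_pos: "r > 0"
    and J_range: "\<And>j k. lattice_dist j k > r \<Longrightarrow> J j k = 0"
    and J_bdd: "bdd_above (range (\<lambda>j. \<Sum>\<^sub>\<infinity>k. \<bar>J j k\<bar>))"
    and c_def: "c = (SUP j. \<Sum>\<^sub>\<infinity>k. \<bar>J j k\<bar>)"
    and U_cont: "\<And>k. continuous_on UNIV (U k)"
    and c'_gt: "c' > max (c - 1) 0"
    and U_lower: "\<And>k x. U k x \<ge> 1 / 2 * c' * x\<^sup>2 + b"
    and \<beta>_pos: "\<beta> > 0"
    and gaussian: "\<And>m. m > 0 \<Longrightarrow> is_gaussian_loop_measure \<beta> m (\<gamma> m)"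
    and \<Lambda>_fin: "finite \<Lambda>"
    and \<zeta>: "\<zeta> \<in> Upsilon \<beta> y"
    and f: "f \<in> Cb_tilde \<beta>"
    and g_cont: "continuous_on UNIV g"
    and g_bdd: "bounded (range g)"
    and fg: "\<And>x \<omega>. \<omega> \<in> Upsilon \<beta> x \<Longrightarrow> f \<omega> = g x"
  shows "((\<lambda>m. \<integral>\<omega>. f \<omega> \<partial>quantum_kernel J U \<beta> (\<gamma> m) \<Lambda> \<zeta>)
           \<longlongrightarrow> (\<integral>x. g x \<partial>classical_kernel J U \<beta> \<Lambda> y)) at_top"
proof -
  interpret lattice_system J U r c b c' \<beta> \<Lambda> y \<zeta>
    by unfold_locales (fact J_sym J_range J_bdd c_def U_cont c'_gt U_lower \<beta>_pos \<Lambda>_fin \<zeta>)+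
  show ?thesis
    by (rule kernel_tendsto[OF gaussian g_cont g_bdd fg])
qed

end
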